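(* If \textsc{EdgeTriangleDetection} can be solved in $T(m)$ time, then \textsc{TriangleListing} for $t=m$ can be solved in $\tilde O(T(m))$ time.
   Context: Graphs are undirected with $m$ edges and no isolated vertices; $\tilde O$ hides polylogarithmic factors. \textsc{EdgeTriangleDetection}: given a graph $G=(V,E)$, determine for every edge $e\in E$ whether some triangle of $G$ contains $e$. \textsc{TriangleListing}: given a graph $G$ and an integer $t$, output $t$ (distinct) triangles of $G$, or all triangles of $G$ if $G$ has fewer than $t$ triangles. *)

theory Defs
  imports Complex_Main "HOL-Library.Landau_Symbols"
begin

text \<open>
  Machine model: a word RAM, presented as while programs over word registers and one
  random-access memory. Registers are named by natural numbers; a program mentions only finitely
  many of them. Every executed instruction and every evaluated test costs one unit of time.
\<close>

datatype binop = Add | Sub | Mul | Div | Mod | BitAnd | BitOr | BitXor | ShiftL | ShiftR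

text \<open>Subtraction is truncated at 0; division by 0 yields 0, and \<open>x mod 0 = x\<close>.\<close>

fun eval_op :: "binop \<Rightarrow> nat \<Rightarrow> nat \<Rightarrow> nat" where
  "eval_op Add x y = x + y"
| "eval_op Sub x y = x - y"
| "eval_op Mul x y = x * y"
| "eval_op Div x y = x div y"
| "eval_op Mod x y = x mod y"
| "eval_op BitAnd x y = Bit_Operations.and x y"
| "eval_op BitOr x y = Bit_Operations.or x y"
| "eval_op BitXor x y = Bit_Operations.xor x y"
| "eval_op ShiftL x y = push_bit y x"
| "eval_op ShiftR x y = drop_bit y x"

type_synonym reg = nat

datatype test = Less reg reg | Equal reg reg

datatype prog =
    Skip
  | Const reg nat
  | Op reg binop reg reg
  | Load reg reg
  | Store reg reg
  | Seq prog prog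
  | Branch test prog prog
  | Loop test prog

type_synonym state = "(reg \<Rightarrow> nat) \<times> (nat \<Rightarrow> nat)"

fun holds :: "test \<Rightarrow> (reg \<Rightarrow> nat) \<Rightarrow> bool" where
  "holds (Less x y) r \<longleftrightarrow> r x < r y"
| "holds (Equal x y) r \<longleftrightarrow> r x = r y"

text \<open>
  \<open>exec w p s t s'\<close>: with words of \<open>w\<close> bits, \<open>p\<close> started in state \<open>s\<close> (registers, memory) halts
  after exactly \<open>t\<close> steps in state \<open>s'\<close>. A word is a number below \<open>2 ^ w\<close>; an instruction whose
  result is not a word has no transition, so an overflowing computation is a failed one. This
  replaces the usual reduction modulo \<open>2 ^ w\<close>, which a program can carry out explicitly using
  longer words; since word lengths matter below only up to a constant factor, the two
  conventions give the same running times up to constant factors. Addresses come from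
  registers, hence only cells below \<open>2 ^ w\<close> are accessible.
\<close>

inductive exec :: "nat \<Rightarrow> prog \<Rightarrow> state \<Rightarrow> nat \<Rightarrow> state \<Rightarrow> bool" for w where
  Skip: "exec w Skip s 1 s"
| Const: "n < 2 ^ w \<Longrightarrow> exec w (Const x n) (r, h) 1 (r(x := n), h)"
| Op: "eval_op f (r y) (r z) < 2 ^ w \<Longrightarrow>
    exec w (Op x f y z) (r, h) 1 (r(x := eval_op f (r y) (r z)), h)"
| Load: "h (r y) < 2 ^ w \<Longrightarrow> exec w (Load x y) (r, h) 1 (r(x := h (r y)), h)"
| Store: "exec w (Store x y) (r, h) 1 (r, h(r x := r y))"
| Seq: "exec w p s t s' \<Longrightarrow> exec w q s' t' s'' \<Longrightarrow> exec w (Seq p q) s (t + t') s''"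
| BranchTrue: "holds b (fst s) \<Longrightarrow> exec w p s t s' \<Longrightarrow> exec w (Branch b p q) s (1 + t) s'"
| BranchFalse: "\<not> holds b (fst s) \<Longrightarrow> exec w q s t s' \<Longrightarrow> exec w (Branch b p q) s (1 + t) s'"
| LoopDone: "\<not> holds b (fst s) \<Longrightarrow> exec w (Loop b p) s 1 s"
| LoopStep: "holds b (fst s) \<Longrightarrow> exec w p s t s' \<Longrightarrow> exec w (Loop b p) s' t' s'' \<Longrightarrow>
    exec w (Loop b p) s (1 + t + t') s''"

text \<open>
  Input and output are lists of words, stored from cell 0 on and preceded by their length.
  All other cells and all registers are initially 0; only the output is inspected at the end.
\<close>

definition init_state :: "nat list \<Rightarrow> state" where
  "init_state xs = (\<lambda>_. 0, \<lambda>i. if i \<le> length xs then (length xs # xs) ! i else 0)"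

definition has_output :: "state \<Rightarrow> nat list \<Rightarrow> bool" where
  "has_output s ys \<longleftrightarrow> (\<forall>i \<le> length ys. snd s i = (length ys # ys) ! i)"

text \<open>
  A problem is a set of triples \<open>(m, xs, Y)\<close>: an instance with size parameter \<open>m\<close>, its encoding
  \<open>xs\<close>, and the set \<open>Y\<close> of its correct outputs.
\<close>

type_synonym problem = "(nat \<times> nat list \<times> nat list set) set"

text \<open>
  A single program must handle all instances, on words of \<open>c * log (m + 2)\<close> bits for some
  constant \<open>c\<close> that may depend on the program; \<open>m + 2\<close> only serves to keep the length positive.
\<close>

definition word_length :: "nat \<Rightarrow> nat \<Rightarrow> nat" where
  "word_length c m = c * nat \<lceil>log 2 (real m + 2)\<rceil>"

definition solvable_in_time :: "problem \<Rightarrow> (nat \<Rightarrow> real) \<Rightarrow> bool" where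
  "solvable_in_time \<Pi> f \<longleftrightarrow>
    (\<exists>p c. \<forall>(m, xs, Y) \<in> \<Pi>. \<exists>t s ys.
       exec (word_length c m) p (init_state xs) t s \<and> real t \<le> f m \<and> has_output s ys \<and> ys \<in> Y)"

definition soft_O :: "(nat \<Rightarrow> real) \<Rightarrow> (nat \<Rightarrow> real) set" where
  "soft_O T = (\<Union>k::nat. O(\<lambda>m. T m * ln (real m) ^ k))"

definition graph :: "nat set \<Rightarrow> nat set set \<Rightarrow> bool" where
  "graph V E \<longleftrightarrow> finite V \<and> (\<forall>e \<in> E. e \<subseteq> V \<and> card e = 2)"

definition no_isolated :: "nat set \<Rightarrow> nat set set \<Rightarrow> bool" where
  "no_isolated V E \<longleftrightarrow> (\<forall>v \<in> V. \<exists>e \<in> E. v \<in> e)"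

definition triangles :: "nat set \<Rightarrow> nat set set \<Rightarrow> nat set set" where
  "triangles V E = {T. T \<subseteq> V \<and> card T = 3 \<and> (\<forall>u \<in> T. \<forall>v \<in> T. u \<noteq> v \<longrightarrow> {u, v} \<in> E)}"

text \<open>
  A graph is presented by its number \<open>n\<close> of vertices, which are \<open>0, \<dots>, n - 1\<close>, and a list of its
  edges, each listed once, in arbitrary order and with arbitrary orientation.
\<close>

definition presents :: "nat \<Rightarrow> (nat \<times> nat) list \<Rightarrow> nat set \<Rightarrow> nat set set \<Rightarrow> bool" where
  "presents n es V E \<longleftrightarrow> V = {..<n} \<and>
     distinct (map (\<lambda>(u, v). {u, v}) es) \<and> set (map (\<lambda>(u, v). {u, v}) es) = E"

definition encode_graph :: "nat \<Rightarrow> (nat \<times> nat) list \<Rightarrow> nat list" where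
  "encode_graph n es = n # length es # concat (map (\<lambda>(u, v). [u, v]) es)"

text \<open>The output has one bit per edge, in the order of the given edge list.\<close>

definition EdgeTriangleDetection :: problem where
  "EdgeTriangleDetection =
    {(card E, encode_graph n es,
      {map (\<lambda>(u, v). if \<exists>T \<in> triangles V E. {u, v} \<subseteq> T then 1 else 0) es}) | V E n es.
     graph V E \<and> no_isolated V E \<and> presents n es V E}"

definition correct_listing ::
  "nat set \<Rightarrow> nat set set \<Rightarrow> nat \<Rightarrow> (nat \<times> nat \<times> nat) list \<Rightarrow> bool" where
  "correct_listing V E t L \<longleftrightarrow>
     (let ts = map (\<lambda>(a, b, c). {a, b, c}) L in
       distinct ts \<and>
       (if card (triangles V E) < t then set ts = triangles V E
        else length ts = t \<and> set ts \<subseteq> triangles V E))"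

text \<open>\<open>TriangleListing \<tau>\<close> consists of the instances in which \<open>t = \<tau> m\<close>; \<open>t\<close> is part of the input.\<close>

definition TriangleListing :: "(nat \<Rightarrow> nat) \<Rightarrow> problem" where
  "TriangleListing \<tau> =
    {(card E, t # encode_graph n es,
      {concat (map (\<lambda>(a, b, c). [a, b, c]) L) | L. correct_listing V E t L}) | V E n es t.
     graph V E \<and> no_isolated V E \<and> presents n es V E \<and> t = \<tau> (card E)}"

end

theory Submission
  imports Defs
begin

text \<open>
  Every triangle is found at its edge between the two smaller vertices. For a modulus \<open>d = 2 ^ k\<close>, call
  a pair of an edge \<open>{u, v}\<close> with \<open>u < v\<close> and a residue \<open>i\<close> modulo \<open>d\<close> good if \<open>u\<close> and \<open>v\<close> have a common
  neighbour \<open>w > v\<close> with \<open>w mod d = i\<close>. A good pair for \<open>d\<close> gives one or two pairs among \<open>i\<close> and \<open>i + d\<close>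
  that are good for \<open>2 d\<close>, and once \<open>d\<close> exceeds all vertices, good pairs are triangles. So it suffices to
  double \<open>d\<close> about \<open>log n\<close> times, keeping at most \<open>m\<close> good pairs each time.

  To test at most \<open>2 m\<close> pairs \<open>({u, v}, i)\<close> simultaneously, join \<open>(u, i)\<close> in one vertex class to
  \<open>(v, i)\<close> in a second class, and for every edge \<open>{x, w}\<close> with \<open>x < w\<close> join \<open>(x, w mod d)\<close> in both classes
  to \<open>w\<close> in a third class. A pair is good iff its edge lies in a triangle of this graph, which has at most
  \<open>4 m\<close> edges and is handled by a constant number of calls on exactly \<open>m\<close> edges. The remaining work is
  \<open>O(m log m)\<close>, and \<open>T m\<close> is at least linear because the output must be written.
\<close>

section \<open>Running times of programs\<close>

text \<open>The hypothesis supplies a program on words of \<open>c * bits m\<close> bits for an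
  unknown constant \<open>c\<close>. One call may touch cells anywhere in a polynomially large
  memory and leave them dirty, and erasing that whole range would be too slow. Every call therefore
  runs in a fresh region of zeros. There are 8000 calls per doubling and at most
  \<open>bits m + 1\<close> doublings, so all regions together still have polynomially many cells,
  and words of \<open>(c + 12) * bits m\<close> bits can address them. Fresh memory also pays for
  renumbering vertices: a pair \<open>(x, i)\<close> becomes a key of size about
  \<open>m ^ 2\<close>, and the table indexed by keys needs no initialisation.

  Residues modulo growing powers of two reveal the binary digits of the third vertex from the lowest
  on, so that one round of calls advances a binary search for all pairs at once. The number of
  rounds is the single factor \<open>ln m\<close> in the final bound. Using the edge between the two
  smaller vertices gives every triangle exactly one final pair, so duplicates need no
  treatment.\<close>

abbreviation seq (infixr ";;" 60) where "p ;; q \<equiv> Seq p q"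

primrec writes :: "prog \<Rightarrow> nat set" where
  "writes Skip = {}"
| "writes (Const x n) = {x}"
| "writes (Op x f y z) = {x}"
| "writes (Load x y) = {x}"
| "writes (Store x y) = {}"
| "writes (Seq p q) = writes p \<union> writes q"
| "writes (Branch b p q) = writes p \<union> writes q"
| "writes (Loop b p) = writes p"

lemma exec_writes: "exec w p s t s' \<Longrightarrow> x \<notin> writes p \<Longrightarrow> fst s' x = fst s x"
  by (induction rule: exec.induct) auto

text \<open>One step changes at most one cell. Hence a run that must change many cells is long,
  which later yields the linear lower bound on detection.\<close>

lemma exec_memory_changes:
  "exec w p s t s' \<Longrightarrow> finite {a. snd s' a \<noteq> snd s a} \<and> card {a. snd s' a \<noteq> snd s a} \<le> t"
proof (induction rule: exec.induct)
  case (Store x y r h)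
  have "{a. snd (r, h(r x := r y)) a \<noteq> snd (r, h) a} \<subseteq> {r x}" by auto
  moreover have "card {r x} = 1" by simp
  ultimately show ?case using card_mono[of "{r x}"] finite_subset[of _ "{r x}"]
    by (metis (lifting) finite.emptyI finite.insertI)
next
  case (Seq p s t s' q t' s'')
  have sub: "{a. snd s'' a \<noteq> snd s a} \<subseteq> {a. snd s' a \<noteq> snd s a} \<union> {a. snd s'' a \<noteq> snd s' a}"
    by auto
  have "card {a. snd s'' a \<noteq> snd s a} \<le> t + t'"
    using Seq card_mono[OF _ sub] card_Un_le[of "{a. snd s' a \<noteq> snd s a}" "{a. snd s'' a \<noteq> snd s' a}"]
    by (meson add_mono finite_UnI le_trans)
  then show ?case using Seq finite_subset[OF sub] by blast
next
  case (LoopStep b s p t s' t' s'')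
  have sub: "{a. snd s'' a \<noteq> snd s a} \<subseteq> {a. snd s' a \<noteq> snd s a} \<union> {a. snd s'' a \<noteq> snd s' a}"
    by auto
  have "card {a. snd s'' a \<noteq> snd s a} \<le> t + t'"
    using LoopStep card_mono[OF _ sub] card_Un_le[of "{a. snd s' a \<noteq> snd s a}" "{a. snd s'' a \<noteq> snd s' a}"]
    by (meson add_mono finite_UnI le_trans)
  then show ?case using LoopStep finite_subset[OF sub] by auto
qed auto

text \<open>A total-correctness triple with a time budget. The budget is an upper bound, not the
  exact time, so that branches and iterations of different lengths can share one.\<close>

definition runs :: "nat \<Rightarrow> prog \<Rightarrow> (nat \<Rightarrow> nat) \<Rightarrow> (nat \<Rightarrow> nat) \<Rightarrow> nat \<Rightarrow>
    ((nat \<Rightarrow> nat) \<Rightarrow> (nat \<Rightarrow> nat) \<Rightarrow> bool) \<Rightarrow> bool" where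
  "runs w p r h T Q \<longleftrightarrow> (\<exists>t r' h'. exec w p (r, h) t (r', h') \<and> t \<le> T \<and> Q r' h')"

text \<open>The frame condition on unwritten registers comes for free from \<open>writes\<close>.
  Postconditions therefore mention only memory and the registers of interest.\<close>

lemma runs_mono:
  assumes "runs w p r h T Q" and "T \<le> T'"
    and "\<And>r' h'. Q r' h' \<Longrightarrow> \<forall>x. x \<notin> writes p \<longrightarrow> r' x = r x \<Longrightarrow> Q' r' h'"
  shows "runs w p r h T' Q'"
proof -
  obtain t r' h' where 1: "exec w p (r, h) t (r', h')" "t \<le> T" "Q r' h'"
    using assms(1) unfolding runs_def by blast
  have "\<forall>x. x \<notin> writes p \<longrightarrow> r' x = r x" using exec_writes[OF 1(1)] by simp
  then have "Q' r' h'" "t \<le> T'" using assms 1 by auto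
  then show ?thesis using 1 unfolding runs_def by blast
qed

lemma runs_Seq:
  assumes "runs w p r h T Q"
    and "\<And>r' h'. Q r' h' \<Longrightarrow> \<forall>x. x \<notin> writes p \<longrightarrow> r' x = r x \<Longrightarrow> runs w q r' h' T' Q'"
    and "T + T' \<le> T''"
  shows "runs w (p ;; q) r h T'' Q'"
proof -
  obtain t r' h' where 1: "exec w p (r, h) t (r', h')" "t \<le> T" "Q r' h'"
    using assms(1) unfolding runs_def by blast
  have "\<forall>x. x \<notin> writes p \<longrightarrow> r' x = r x" using exec_writes[OF 1(1)] by simp
  then obtain t' r'' h'' where 2: "exec w q (r', h') t' (r'', h'')" "t' \<le> T'" "Q' r'' h''"
    using assms(2) 1 unfolding runs_def by blast
  have "t + t' \<le> T''" using 1 2 assms(3) by linarith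
  then show ?thesis unfolding runs_def using exec.Seq[OF 1(1) 2(1)] 2(3) by blast
qed

text \<open>Only for loop-free programs: the values at \<open>Loop\<close> are dummies.\<close>

primrec wp :: "nat \<Rightarrow> prog \<Rightarrow> ((nat \<Rightarrow> nat) \<Rightarrow> (nat \<Rightarrow> nat) \<Rightarrow> bool) \<Rightarrow> (nat \<Rightarrow> nat) \<Rightarrow> (nat \<Rightarrow> nat) \<Rightarrow> bool"
  where
  "wp w Skip Q = Q"
| "wp w (Const x n) Q = (\<lambda>r h. n < 2 ^ w \<and> Q (r(x := n)) h)"
| "wp w (Op x f y z) Q = (\<lambda>r h. eval_op f (r y) (r z) < 2 ^ w \<and> Q (r(x := eval_op f (r y) (r z))) h)"
| "wp w (Load x y) Q = (\<lambda>r h. h (r y) < 2 ^ w \<and> Q (r(x := h (r y))) h)"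
| "wp w (Store x y) Q = (\<lambda>r h. Q r (h(r x := r y)))"
| "wp w (Seq p q) Q = wp w p (wp w q Q)"
| "wp w (Branch b p q) Q = (\<lambda>r h. if holds b r then wp w p Q r h else wp w q Q r h)"
| "wp w (Loop b p) Q = (\<lambda>r h. False)"

primrec cost :: "prog \<Rightarrow> nat" where
  "cost Skip = 1"
| "cost (Const x n) = 1"
| "cost (Op x f y z) = 1"
| "cost (Load x y) = 1"
| "cost (Store x y) = 1"
| "cost (Seq p q) = cost p + cost q"
| "cost (Branch b p q) = 1 + max (cost p) (cost q)"
| "cost (Loop b p) = 0"

lemma wp_exec: "wp w p Q r h \<Longrightarrow> \<exists>t r' h'. exec w p (r, h) t (r', h') \<and> t \<le> cost p \<and> Q r' h'"
proof (induction p arbitrary: Q r h)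
  case (Seq p q)
  then have "wp w p (wp w q Q) r h" by simp
  from Seq.IH(1)[OF this] obtain t r' h' where
    1: "exec w p (r, h) t (r', h')" "t \<le> cost p" "wp w q Q r' h'" by blast
  from Seq.IH(2)[OF 1(3)] obtain t' r'' h'' where
    2: "exec w q (r', h') t' (r'', h'')" "t' \<le> cost q" "Q r'' h''" by blast
  have "t + t' \<le> cost (p ;; q)" using 1 2 by simp
  then show ?case using exec.Seq[OF 1(1) 2(1)] 2(3) by blast
next
  case (Branch b p q)
  show ?case
  proof (cases "holds b r")
    case True
    then have "wp w p Q r h" using Branch.prems by simp
    from Branch.IH(1)[OF this] obtain t r' h' where
      1: "exec w p (r, h) t (r', h')" "t \<le> cost p" "Q r' h'" by blast
    have "1 + t \<le> cost (Branch b p q)" using 1 by simp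
    then show ?thesis using exec.BranchTrue[of b "(r, h)", OF _ 1(1)] True 1(3) by (metis fst_conv)
  next
    case False
    then have "wp w q Q r h" using Branch.prems by simp
    from Branch.IH(2)[OF this] obtain t r' h' where
      1: "exec w q (r, h) t (r', h')" "t \<le> cost q" "Q r' h'" by blast
    have "1 + t \<le> cost (Branch b p q)" using 1 by simp
    then show ?thesis using exec.BranchFalse[of b "(r, h)", OF _ 1(1)] False 1(3) by (metis fst_conv)
  qed
next
  case Skip
  then show ?case using exec.Skip by fastforce
next
  case (Const x n)
  then show ?case using exec.Const by fastforce
next
  case (Op x f y z)
  then show ?case using exec.Op by fastforce
next
  case (Load x y)
  then show ?case using exec.Load by fastforce
next
  case (Store x y)
  then show ?case using exec.Store by fastforce
next
  case (Loop b p)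
  then show ?case by simp
qed

text \<open>Reduces loop-free code to a goal that simplification computes, including the check that
  no intermediate result overflows a word.\<close>

lemma runs_wp: "wp w p Q r h \<Longrightarrow> cost p \<le> T \<Longrightarrow> runs w p r h T Q"
  unfolding runs_def using wp_exec le_trans by blast

lemma runs_Branch:
  assumes "holds b r \<Longrightarrow> runs w p r h T Q" "\<not> holds b r \<Longrightarrow> runs w q r h T Q" "1 + T \<le> T'"
  shows "runs w (Branch b p q) r h T' Q"
proof (cases "holds b r")
  case True
  then obtain t r' h' where "exec w p (r, h) t (r', h')" "t \<le> T" "Q r' h'"
    using assms unfolding runs_def by blast
  then show ?thesis using exec.BranchTrue[of b "(r, h)" w p t "(r', h')" q] True assms(3)
    unfolding runs_def by (intro exI[of _ "1 + t"] exI[of _ r'] exI[of _ h']) auto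
next
  case False
  then obtain t r' h' where "exec w q (r, h) t (r', h')" "t \<le> T" "Q r' h'"
    using assms unfolding runs_def by blast
  then show ?thesis using exec.BranchFalse[of b "(r, h)" w q t "(r', h')" p] False assms(3)
    unfolding runs_def by (intro exI[of _ "1 + t"] exI[of _ r'] exI[of _ h']) auto
qed

text \<open>The invariant is indexed by the number of completed iterations. Since a true test forces
  \<open>k < K\<close>, the difference \<open>K - k\<close> serves as termination measure and as
  budget at the same time.\<close>

lemma runs_Loop_aux:
  assumes step: "\<And>k r h. I k r h \<Longrightarrow> holds b r \<Longrightarrow> k < K \<and> runs w p r h T (I (Suc k))"
  shows "I k r h \<Longrightarrow> k \<le> K \<Longrightarrow>
    runs w (Loop b p) r h ((K - k) * (T + 1) + 1) (\<lambda>r' h'. \<not> holds b r' \<and> (\<exists>k \<le> K. I k r' h'))"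
proof (induction "K - k" arbitrary: k r h rule: less_induct)
  case less
  show ?case
  proof (cases "holds b r")
    case False
    then show ?thesis unfolding runs_def using less.prems exec.LoopDone[of b "(r, h)" w p]
      by (intro exI[of _ 1] exI[of _ r] exI[of _ h]) auto
  next
    case True
    from step[OF less.prems(1) True] obtain t r' h' where
      1: "k < K" "exec w p (r, h) t (r', h')" "t \<le> T" "I (Suc k) r' h'"
      unfolding runs_def by blast
    have "runs w (Loop b p) r' h' ((K - Suc k) * (T + 1) + 1)
        (\<lambda>r' h'. \<not> holds b r' \<and> (\<exists>k \<le> K. I k r' h'))"
      using 1 by (intro less.hyps) simp_all
    then obtain t' r'' h'' where 2: "exec w (Loop b p) (r', h') t' (r'', h'')"
      "t' \<le> (K - Suc k) * (T + 1) + 1" "\<not> holds b r''" "\<exists>k \<le> K. I k r'' h''"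
      unfolding runs_def by blast
    have "exec w (Loop b p) (r, h) (1 + t + t') (r'', h'')"
      using exec.LoopStep[OF _ 1(2) 2(1)] True by simp
    moreover have "1 + t + t' \<le> (K - k) * (T + 1) + 1"
    proof -
      have "(K - k) = Suc (K - Suc k)" using 1 by simp
      then show ?thesis using 1 2 by simp
    qed
    ultimately show ?thesis unfolding runs_def using 2 by blast
  qed
qed

lemma runs_Loop:
  assumes "I 0 r h"
    and "\<And>k r' h'. I k r' h' \<Longrightarrow> holds b r' \<Longrightarrow> \<forall>x. x \<notin> writes p \<longrightarrow> r' x = r x \<Longrightarrow>
      k < K \<and> runs w p r' h' T (I (Suc k))"
    and "K * (T + 1) + 1 \<le> T'"
  shows "runs w (Loop b p) r h T' (\<lambda>r' h'. \<not> holds b r' \<and> (\<exists>k \<le> K. I k r' h'))"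
proof -
  let ?I = "\<lambda>k r' h'. I k r' h' \<and> (\<forall>x. x \<notin> writes p \<longrightarrow> r' x = r x)"
  have "runs w (Loop b p) r h ((K - 0) * (T + 1) + 1)
     (\<lambda>r' h'. \<not> holds b r' \<and> (\<exists>k \<le> K. ?I k r' h'))"
  proof (rule runs_Loop_aux)
    fix k r' h' assume I: "?I k r' h'" and "holds b r'"
    then have "k < K" and *: "runs w p r' h' T (I (Suc k))" using assms(2) by blast+
    moreover have "runs w p r' h' T (?I (Suc k))"
      by (rule runs_mono[OF *]) (use I in auto)
    ultimately show "k < K \<and> runs w p r' h' T (?I (Suc k))" by blast
  qed (use assms in auto)
  then show ?thesis by (rule runs_mono) (use assms in auto)
qed

text \<open>Register 1 is meant to contain 1.\<close>

definition For :: "nat \<Rightarrow> nat \<Rightarrow> prog \<Rightarrow> prog" where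
  "For i n body = Const i 0 ;; Loop (Less i n) (body ;; Op i Add i 1)"

lemma writes_For [simp]: "writes (For i n body) = insert i (writes body)"
  unfolding For_def by auto

text \<open>The body ends before the counter is incremented, so its postcondition is stated for
  \<open>r''(i := Suc k)\<close>, the state at the next test. An iteration costs the body plus a
  test and an increment; the final 2 pays for the initialisation and the failing test.\<close>

lemma runs_For:
  assumes r: "r 1 = 1" "r n < 2 ^ w"
    and W: "i \<notin> writes body" "n \<notin> insert i (writes body)" "1 \<notin> insert i (writes body)"
    and start: "I 0 (r(i := 0)) h"
    and step: "\<And>k r' h'. k < r n \<Longrightarrow> r' i = k \<Longrightarrow> \<forall>x. x \<notin> insert i (writes body) \<longrightarrow> r' x = r x \<Longrightarrow>
      I k r' h' \<Longrightarrow> runs w body r' h' T (\<lambda>r'' h''. I (Suc k) (r''(i := Suc k)) h'')"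
    and T': "r n * (T + 2) + 2 \<le> T'"
  shows "runs w (For i n body) r h T' (I (r n))"
proof -
  let ?I = "\<lambda>k r' h'. I k r' h' \<and> r' i = k \<and> k \<le> r n \<and> (\<forall>x. x \<notin> insert i (writes body) \<longrightarrow> r' x = r x)"
  have pos: "(0::nat) < 2 ^ w" by simp
  have 1: "runs w (Const i 0) r h 1 (\<lambda>r' h'. r' = r(i := 0) \<and> h' = h)"
    by (rule runs_wp) auto
  have 2: "runs w (Loop (Less i n) (body ;; Op i Add i 1)) (r(i := 0)) h (r n * (T + 2) + 1)
    (\<lambda>r' h'. \<not> holds (Less i n) r' \<and> (\<exists>k \<le> r n. ?I k r' h'))"
  proof (rule runs_Loop[where T = "T + 1"])
    fix k r' h' assume I: "?I k r' h'" and "holds (Less i n) r'"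
    then have k: "k < r n" using W by auto
    have "runs w (body ;; Op i Add i 1) r' h' (T + 1) (?I (Suc k))"
    proof (rule runs_Seq)
      show "runs w body r' h' T (\<lambda>r'' h''. I (Suc k) (r''(i := Suc k)) h'')"
        using step[OF k] I by blast
    next
      fix r'' h'' assume Q: "I (Suc k) (r''(i := Suc k)) h''"
        and fr: "\<forall>x. x \<notin> writes body \<longrightarrow> r'' x = r' x"
      have "r'' 1 = 1" "r'' i = k" using fr I W r by auto
      then show "runs w (Op i Add i 1) r'' h'' 1 (?I (Suc k))"
        using Q fr I W r k by (intro runs_wp) auto
    qed simp
    then show "k < r n \<and> runs w (body ;; Op i Add i 1) r' h' (T + 1) (?I (Suc k))"
      using k by blast
  qed (use start in auto)
  show ?thesis unfolding For_def
  proof (rule runs_Seq[OF 1])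
    fix r' h' assume "r' = r(i := 0) \<and> h' = h"
    then have eq: "r' = r(i := 0)" "h' = h" by auto
    show "runs w (Loop (Less i n) (body ;; Op i Add i 1)) r' h' (r n * (T + 2) + 1) (I (r n))"
      unfolding eq
    proof (rule runs_mono[OF 2])
      fix r' h' assume *: "\<not> holds (Less i n) r' \<and> (\<exists>k \<le> r n. ?I k r' h')"
      then obtain k where k: "k \<le> r n" "?I k r' h'" by blast
      then have "r' n = r n" using W by blast
      with * k have "r n = k" by simp
      with k show "I (r n) r' h'" by simp
    qed simp
  qed (use T' in simp)
qed

section \<open>Simulating a program at a memory offset\<close>

primrec regs_of_test :: "test \<Rightarrow> nat set" where
  "regs_of_test (Less x y) = {x, y}"
| "regs_of_test (Equal x y) = {x, y}"

primrec regs :: "prog \<Rightarrow> nat set" where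
  "regs Skip = {}"
| "regs (Const x n) = {x}"
| "regs (Op x f y z) = {x, y, z}"
| "regs (Load x y) = {x, y}"
| "regs (Store x y) = {x, y}"
| "regs (Seq p q) = regs p \<union> regs q"
| "regs (Branch b p q) = regs_of_test b \<union> regs p \<union> regs q"
| "regs (Loop b p) = regs_of_test b \<union> regs p"

text \<open>Gives a bound on the register names of the detection program, so that they can all be
  reset between calls.\<close>

lemma finite_regs: "finite (regs p)"
proof -
  have "finite (regs_of_test b)" for b by (cases b) auto
  then show ?thesis by (induction p) auto
qed

text \<open>
  Register \<open>x\<close> of the simulated program becomes register \<open>x + 50\<close>, and its memory starts at the
  address in register 16. Registers below 50 are left for the reduction; 40 is scratch space.
\<close>

primrec embed_test :: "test \<Rightarrow> test" where
  "embed_test (Less x y) = Less (x + 50) (y + 50)"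
| "embed_test (Equal x y) = Equal (x + 50) (y + 50)"

primrec embed :: "prog \<Rightarrow> prog" where
  "embed Skip = Skip"
| "embed (Const x n) = Const (x + 50) n"
| "embed (Op x f y z) = Op (x + 50) f (y + 50) (z + 50)"
| "embed (Load x y) = Op 40 Add (y + 50) 16 ;; Load (x + 50) 40"
| "embed (Store x y) = Op 40 Add (x + 50) 16 ;; Store 40 (y + 50)"
| "embed (Seq p q) = embed p ;; embed q"
| "embed (Branch b p q) = Branch (embed_test b) (embed p) (embed q)"
| "embed (Loop b p) = Loop (embed_test b) (embed p)"

lemma writes_embed: "x < 50 \<Longrightarrow> x \<noteq> 40 \<Longrightarrow> x \<notin> writes (embed p)"
  by (induction p) auto

text \<open>Only register values need a bound: they serve as addresses, and with
  \<open>2 ^ v <= B\<close> every access stays inside the region. A cell may hold anything, since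
  loading a value that is not a word has no transition.\<close>

definition simulates :: "nat \<Rightarrow> nat \<Rightarrow> nat \<Rightarrow> nat \<Rightarrow> state \<Rightarrow> (nat \<Rightarrow> nat) \<Rightarrow> (nat \<Rightarrow> nat) \<Rightarrow> bool" where
  "simulates v R B off s r h \<longleftrightarrow> (\<forall>x<R. fst s x < 2 ^ v \<and> r (x + 50) = fst s x) \<and> r 16 = off \<and>
     (\<forall>a<B. h (off + a) = snd s a)"

lemma holds_embed_test:
  assumes "simulates v R B off s r h" "regs_of_test b \<subseteq> {..<R}"
  shows "holds (embed_test b) r \<longleftrightarrow> holds b (fst s)"
  using assms unfolding simulates_def by (cases b) auto

text \<open>The factor 2 pays for the address addition before each load and store. The bounds
  \<open>2 ^ v <= B\<close> and \<open>off + B <= 2 ^ w\<close> turn every simulated word and every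
  shifted address into a word of the simulating machine.\<close>

lemma embed_simulates:
  assumes "exec v p s t s'" and "regs p \<subseteq> {..<R}"
    and "2 ^ v \<le> B" "off + B \<le> 2 ^ w" "simulates v R B off s r h"
  shows "runs w (embed p) r h (2 * t) (\<lambda>r' h'. simulates v R B off s' r' h' \<and>
    (\<forall>a. a < off \<or> off + B \<le> a \<longrightarrow> h' a = h a))"
  using assms
proof (induction arbitrary: r h rule: exec.induct)
  case (Skip s)
  then show ?case by (intro runs_wp) auto
next
  case (Const n x r0 h0)
  then have "n < 2 ^ w" by linarith
  with Const show ?case by (intro runs_wp) (auto simp: simulates_def)
next
  case (Op f r0 y z x h0)
  then have "eval_op f (r0 y) (r0 z) < 2 ^ w" by linarith
  with Op show ?case by (intro runs_wp) (auto simp: simulates_def)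
next
  case (Load h0 r0 y x)
  then have y: "r0 y < 2 ^ v" "r (y + 50) = r0 y" "r 16 = off"
    by (auto simp: simulates_def)
  then have "h (off + r0 y) = h0 (r0 y)" using Load by (auto simp: simulates_def)
  moreover have "h0 (r0 y) < 2 ^ w" "off + r0 y < 2 ^ w" using Load y by linarith+
  ultimately show ?case using Load y by (intro runs_wp) (auto simp: simulates_def add.commute)
next
  case (Store x y r0 h0)
  then have y: "r0 x < 2 ^ v" "r (x + 50) = r0 x" "r 16 = off" "r (y + 50) = r0 y"
    by (auto simp: simulates_def)
  moreover have "off + r0 x < 2 ^ w" using Store y by linarith
  ultimately show ?case using Store
    by (intro runs_wp) (auto simp: simulates_def add.commute)
next
  case (Seq p s t s' q t' s'')
  show ?case unfolding embed.simps
  proof (rule runs_Seq[OF Seq.IH(1)])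
    fix r' h' assume *: "simulates v R B off s' r' h' \<and> (\<forall>a. a < off \<or> off + B \<le> a \<longrightarrow> h' a = h a)"
    show "runs w (embed q) r' h' (2 * t') (\<lambda>r' h'. simulates v R B off s'' r' h' \<and>
      (\<forall>a. a < off \<or> off + B \<le> a \<longrightarrow> h' a = h a))"
      by (rule runs_mono[OF Seq.IH(2)]) (use Seq.prems * in auto)
  qed (use Seq.prems in auto)
next
  case (BranchTrue b s p t s' q)
  then show ?case unfolding embed.simps
    by (intro runs_Branch[where T = "2 * t"]) (auto simp: holds_embed_test)
next
  case (BranchFalse b s q t s' p)
  then show ?case unfolding embed.simps
    by (intro runs_Branch[where T = "2 * t"]) (auto simp: holds_embed_test)
next
  case (LoopDone b s p)
  then have "exec w (Loop (embed_test b) (embed p)) (r, h) 1 (r, h)"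
    by (intro exec.LoopDone) (auto simp: holds_embed_test)
  then show ?case using LoopDone unfolding runs_def by fastforce
next
  case (LoopStep b s p t s' t' s'')
  let ?Q = "\<lambda>s r' h'. simulates v R B off s r' h' \<and> (\<forall>a. a < off \<or> off + B \<le> a \<longrightarrow> h' a = h a)"
  have "runs w (embed p) r h (2 * t) (?Q s')"
    by (rule LoopStep.IH(1)) (use LoopStep.prems in auto)
  then obtain t1 r1 h1 where 1: "exec w (embed p) (r, h) t1 (r1, h1)" "t1 \<le> 2 * t" "?Q s' r1 h1"
    unfolding runs_def by blast
  have "runs w (embed (Loop b p)) r1 h1 (2 * t') (?Q s'')"
    by (rule runs_mono[OF LoopStep.IH(2)]) (use LoopStep.prems 1 in auto)
  then obtain t2 r2 h2 where 2: "exec w (Loop (embed_test b) (embed p)) (r1, h1) t2 (r2, h2)"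
    "t2 \<le> 2 * t'" "?Q s'' r2 h2"
    unfolding runs_def by auto
  have "exec w (Loop (embed_test b) (embed p)) (r, h) (1 + t1 + t2) (r2, h2)"
    by (rule exec.LoopStep[OF _ 1(1) 2(1)]) (use LoopStep in \<open>auto simp: holds_embed_test\<close>)
  then show ?case unfolding runs_def embed.simps using 1 2
    by (intro exI[of _ "1 + t1 + t2"] exI[of _ r2] exI[of _ h2]) auto
qed

text \<open>A call must start with zero registers, but the previous call left values there. Register
  names cannot be computed, so the reset is unrolled; its length depends only on the detection
  program.\<close>

primrec zero_regs :: "nat \<Rightarrow> prog" where
  "zero_regs 0 = Skip"
| "zero_regs (Suc k) = zero_regs k ;; Const (k + 50) 0"

lemma writes_zero_regs: "x < 50 \<Longrightarrow> x \<notin> writes (zero_regs k)"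
  by (induction k) simp_all

lemma runs_zero_regs:
  "runs w (zero_regs R) r h (R + 1) (\<lambda>r' h'. h' = h \<and> (\<forall>x<R. r' (x + 50) = 0))"
proof (induction R)
  case 0
  show ?case by (rule runs_wp) auto
next
  case (Suc R)
  show ?case unfolding zero_regs.simps
    by (rule runs_Seq[OF Suc, where T' = 1]) (auto intro!: runs_wp simp: less_Suc_eq)
qed

section \<open>Padding and splitting instances of edge triangle detection\<close>

abbreviation unordered :: "nat \<times> nat \<Rightarrow> nat set" where
  "unordered \<equiv> (\<lambda>(u, v). {u, v})"

text \<open>Membership of an edge in a triangle, phrased by adjacency alone so that it transfers
  along injective renamings of vertices. The vertex \<open>c\<close> differs from \<open>u\<close>
  and \<open>v\<close> automatically, because edges of a graph have two elements.\<close>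

definition covered :: "nat set set \<Rightarrow> nat \<Rightarrow> nat \<Rightarrow> bool" where
  "covered E u v \<longleftrightarrow> (\<exists>c. {u, c} \<in> E \<and> {v, c} \<in> E)"

lemma in_triangle_iff_covered:
  assumes "graph V E" "{u, v} \<in> E"
  shows "(\<exists>T \<in> triangles V E. {u, v} \<subseteq> T) \<longleftrightarrow> covered E u v"
proof
  assume "\<exists>T \<in> triangles V E. {u, v} \<subseteq> T"
  then obtain T where T: "T \<in> triangles V E" "u \<in> T" "v \<in> T" by auto
  have "card T = 3" using T unfolding triangles_def by simp
  moreover have "card {u, v} \<le> 2" by (simp add: card_insert_if)
  ultimately have "\<not> T \<subseteq> {u, v}" using card_mono[of "{u, v}" T] by fastforce
  then obtain c where "c \<in> T" "c \<noteq> u" "c \<noteq> v" by blast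
  moreover have "\<forall>x \<in> T. \<forall>y \<in> T. x \<noteq> y \<longrightarrow> {x, y} \<in> E"
    using T(1) unfolding triangles_def by simp
  ultimately have "{u, c} \<in> E" "{v, c} \<in> E" using T(2,3) by metis+
  then show "covered E u v" unfolding covered_def by blast
next
  assume "covered E u v"
  then obtain c where c: "{u, c} \<in> E" "{v, c} \<in> E" unfolding covered_def by blast
  have ne: "card {u, v} = 2" "card {u, c} = 2" "card {v, c} = 2" "{u, v} \<subseteq> V" "{u, c} \<subseteq> V"
    using assms c unfolding graph_def by blast+
  have neq: "u \<noteq> v" "u \<noteq> c" "v \<noteq> c"
    using ne by (auto simp: card_insert_if split: if_splits)
  have com: "{v, u} \<in> E" "{c, u} \<in> E" "{c, v} \<in> E"
    using assms(2) c by (simp_all add: insert_commute)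
  have "{u, v, c} \<in> triangles V E"
    unfolding triangles_def using neq com assms(2) c ne(4,5) by simp
  then show "\<exists>T \<in> triangles V E. {u, v} \<subseteq> T" by blast
qed

text \<open>A matching on new vertices is encoded by consecutive numbers. So padding is a plain
  counting loop, and the encoding of a perfect matching is easy to compare with its output.\<close>

lemma concat_map_pair_upt:
  "concat (map (\<lambda>(u, v). [u, v]) (map (\<lambda>j. (a + 2 * j, Suc (a + 2 * j))) [0..<k])) = [a..<a + 2 * k]"
proof (induction k)
  case (Suc k)
  have "a + 2 * Suc k = Suc (Suc (a + 2 * k))" by simp
  then have "[a..<a + 2 * Suc k] = [a..<a + 2 * k] @ [a + 2 * k, Suc (a + 2 * k)]"
    by (simp only: upt_Suc_append[of a] le_add1 le_SucI) simp
  then show ?case using Suc.IH by simp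
qed simp

lemma concat_map_pair_map:
  "concat (map (\<lambda>(u, v). [u, v]) (map (\<lambda>(a, b). (f a, f b)) ps)) =
   map f (concat (map (\<lambda>(u, v). [u, v]) ps))"
  by (induction ps) auto

lemma length_concat_map_pair: "length (concat (map (\<lambda>(u, v). [u, v]) ps)) = 2 * length ps"
  by (induction ps) auto

lemma set_concat_map_pair: "set (concat (map (\<lambda>(u, v). [u, v]) ps)) = \<Union> (unordered ` set ps)"
  by (induction ps) auto

text \<open>
  The time bound \<open>T\<close> is an arbitrary function, so \<open>T m'\<close> for \<open>m' < m\<close> says nothing about \<open>T m\<close>:
  every call must be on exactly \<open>m\<close> edges. Missing edges are added as a matching on new vertices,
  which creates no triangles and no isolated vertices.
\<close>

definition padded_edges :: "(nat \<Rightarrow> nat) \<Rightarrow> (nat \<times> nat) list \<Rightarrow> nat \<Rightarrow> nat \<Rightarrow> (nat \<times> nat) list" where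
  "padded_edges f ps v0 m = map (\<lambda>(a, b). (f a, f b)) ps @
     map (\<lambda>j. (v0 + 2 * j, Suc (v0 + 2 * j))) [0..<m - length ps]"

lemma encode_padded_edges:
  assumes "length ps \<le> m"
  shows "encode_graph n (padded_edges f ps v0 m) =
    n # m # map f (concat (map (\<lambda>(u, v). [u, v]) ps)) @ [v0..<v0 + 2 * (m - length ps)]"
  using assms concat_map_pair_upt[of v0 "m - length ps"] concat_map_pair_map[of f ps]
  by (simp add: encode_graph_def padded_edges_def)

text \<open>The renaming \<open>f\<close> is an isomorphism onto the vertices below
  \<open>v0\<close>, and the added matching lives on the vertices from \<open>v0\<close> on. Hence
  the answers for the first \<open>length ps\<close> edges are those of the original edges. That
  \<open>f\<close> hits every number below \<open>v0\<close> is what excludes isolated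
  vertices.\<close>

lemma padded_instance:
  fixes ps :: "(nat \<times> nat) list"
  assumes dist: "distinct (map unordered ps)"
    and loopfree: "\<And>a b. (a, b) \<in> set ps \<Longrightarrow> a \<noteq> b"
    and inj: "inj_on f (\<Union> (unordered ` set ps))"
    and img: "f ` \<Union> (unordered ` set ps) = {..<v0}"
    and len: "length ps \<le> m"
  shows "\<exists>ys. (m, encode_graph (v0 + 2 * (m - length ps)) (padded_edges f ps v0 m), {ys})
      \<in> EdgeTriangleDetection \<and> length ys = m \<and>
    (\<forall>i<length ps. ys ! i = (if covered (unordered ` set ps) (fst (ps ! i)) (snd (ps ! i)) then 1 else 0))"
proof -
  let ?K = "\<Union> (unordered ` set ps)"
  define es where "es = padded_edges f ps v0 m"
  define n where "n = v0 + 2 * (m - length ps)"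
  define V where "V = {..<n}"
  define E1 where "E1 = (\<lambda>e. f ` e) ` (unordered ` set ps)"
  define E2 where "E2 = (\<lambda>j. {v0 + 2 * j, Suc (v0 + 2 * j)}) ` {0..<m - length ps}"
  define E where "E = E1 \<union> E2"
  have Kmem: "a \<in> ?K" "b \<in> ?K" if "(a, b) \<in> set ps" for a b using that by force+
  have set1: "set (map unordered (map (\<lambda>(a, b). (f a, f b)) ps)) = E1"
    unfolding E1_def set_map image_image by (rule image_cong) auto
  have setE: "set (map unordered es) = E"
    using set1 unfolding es_def padded_edges_def E_def E2_def by auto
  have small: "f a < v0" if "a \<in> ?K" for a using img that by blast
  have E1_small: "e \<subseteq> {..<v0}" if "e \<in> E1" for e
    using that img unfolding E1_def by blast
  have E2_large: "x \<ge> v0" if "e \<in> E2" "x \<in> e" for e x using that unfolding E2_def by auto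
  have dist1: "distinct (map unordered (map (\<lambda>(a, b). (f a, f b)) ps))"
  proof -
    have "inj_on (\<lambda>e. f ` e) (unordered ` set ps)"
      using inj by (intro inj_onI) (metis Union_upper inj_on_image_eq_iff)
    then have "distinct (map (\<lambda>e. f ` e) (map unordered ps))"
      using dist by (subst distinct_map) auto
    moreover have "map (\<lambda>e. f ` e) (map unordered ps) =
        map unordered (map (\<lambda>(a, b). (f a, f b)) ps)"
      by auto
    ultimately show ?thesis by (simp only:)
  qed
  have dist2: "distinct (map unordered (map (\<lambda>j. (v0 + 2 * j, Suc (v0 + 2 * j))) [0..<k]))" for k
    unfolding map_map by (subst distinct_map) (auto intro!: inj_onI simp: doubleton_eq_iff)
  have disj: "E1 \<inter> E2 = {}"
  proof -
    have False if "e \<in> E1" "e \<in> E2" for e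
    proof -
      have "e \<noteq> {}" using that unfolding E2_def by auto
      then obtain x where "x \<in> e" by blast
      then show False using E1_small[OF that(1)] E2_large[OF that(2)] by fastforce
    qed
    then show ?thesis by blast
  qed
  have dist_es: "distinct (map unordered es)"
    using dist1 dist2[of "m - length ps"] disj set1
    unfolding es_def padded_edges_def map_append distinct_append E2_def by simp
  have len_es: "length es = m" using len unfolding es_def padded_edges_def by simp
  have cardE: "card E = m"
    using distinct_card[OF dist_es] len_es setE by simp
  have graph: "graph V E"
    unfolding graph_def
  proof (intro conjI ballI)
    fix e assume "e \<in> E"
    then consider a b where "(a, b) \<in> set ps" "e = {f a, f b}" | "e \<in> E2"
      unfolding E_def E1_def by fastforce
    then show "e \<subseteq> V"
    proof cases
      case 1
      then show ?thesis using small Kmem unfolding V_def n_def by (simp add: trans_less_add1)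
    next
      case 2
      then show ?thesis unfolding E2_def V_def n_def by auto
    qed
    from \<open>e \<in> E\<close> consider a b where "(a, b) \<in> set ps" "e = {f a, f b}" | "e \<in> E2"
      unfolding E_def E1_def by fastforce
    then show "card e = 2"
    proof cases
      case 1
      then have "f a \<noteq> f b" using inj Kmem loopfree inj_onD by metis
      then show ?thesis using 1 by simp
    next
      case 2
      then show ?thesis unfolding E2_def by auto
    qed
  qed (simp add: V_def)
  have iso: "no_isolated V E"
    unfolding no_isolated_def
  proof
    fix x assume x: "x \<in> V"
    show "\<exists>e \<in> E. x \<in> e"
    proof (cases "x < v0")
      case True
      then have "x \<in> f ` ?K" unfolding img by simp
      then obtain a e where "x = f a" "e \<in> unordered ` set ps" "a \<in> e" by blast
      then have "f ` e \<in> E" "x \<in> f ` e" unfolding E_def E1_def by simp_all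
      then show ?thesis by blast
    next
      case False
      define j where "j = (x - v0) div 2"
      have "j < m - length ps" using x False unfolding V_def n_def j_def by auto
      moreover have "x = v0 + 2 * j \<or> x = Suc (v0 + 2 * j)" using False unfolding j_def by linarith
      ultimately have "{v0 + 2 * j, Suc (v0 + 2 * j)} \<in> E" "x \<in> {v0 + 2 * j, Suc (v0 + 2 * j)}"
        unfolding E_def E2_def by simp_all
      then show ?thesis by blast
    qed
  qed
  have pres: "presents n es V E" unfolding presents_def V_def using dist_es setE by simp
  define ys where "ys = map (\<lambda>(u, v). if \<exists>T \<in> triangles V E. {u, v} \<subseteq> T then 1 else 0::nat) es"
  have "(card E, encode_graph n es, {ys}) \<in> EdgeTriangleDetection"
    unfolding EdgeTriangleDetection_def ys_def using graph iso pres by blast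
  moreover have "ys ! i = (if covered (unordered ` set ps) (fst (ps ! i)) (snd (ps ! i)) then 1 else 0)"
    if i: "i < length ps" for i
  proof -
    obtain a b where ab: "ps ! i = (a, b)" by fastforce
    then have mem: "(a, b) \<in> set ps" using i by (metis nth_mem)
    have esi: "es ! i = (f a, f b)" using ab i unfolding es_def padded_edges_def by (simp add: nth_append)
    have "{a, b} \<in> unordered ` set ps" using mem by force
    then have "f ` {a, b} \<in> E" unfolding E_def E1_def by (intro UnI1 imageI)
    then have "{f a, f b} \<in> E" by simp
    have "covered E (f a) (f b) \<longleftrightarrow> covered (unordered ` set ps) a b"
    proof
      assume "covered E (f a) (f b)"
      then obtain c' where c': "{f a, c'} \<in> E" "{f b, c'} \<in> E" unfolding covered_def by blast
      \<comment> \<open>A vertex below \<open>v0\<close> has no matching edge, so a common neighbour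
        is reached through renamed edges only and has a preimage under \<open>f\<close>.\<close>
      have inE1: "{f x, c'} \<in> E1" if "x \<in> ?K" "{f x, c'} \<in> E" for x
        using that E2_large small unfolding E_def by (metis UnE insertI1 not_le)
      have E1a: "{f a, c'} \<in> E1" and E1b: "{f b, c'} \<in> E1" using inE1 c' Kmem[OF mem] by blast+
      then have "c' < v0" using E1_small by blast
      then have "c' \<in> f ` ?K" using img by blast
      then obtain c where c: "c \<in> ?K" "c' = f c" by blast
      have "{x, c} \<in> unordered ` set ps" if x: "x \<in> ?K" "{f x, c'} \<in> E1" for x
      proof -
        have "f ` {x, c} \<in> E1" using x(2) c(2) by simp
        then obtain e where e: "e \<in> unordered ` set ps" "f ` {x, c} = f ` e"
          unfolding E1_def by (rule imageE)
        have "{x, c} \<subseteq> ?K" "e \<subseteq> ?K" using x(1) c(1) e(1) by simp_all (rule Union_upper)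
        then have "{x, c} = e" using e(2) inj_on_image_eq_iff[OF inj] by metis
        then show ?thesis using e(1) by simp
      qed
      then show "covered (unordered ` set ps) a b"
        unfolding covered_def using E1a E1b Kmem[OF mem] by (intro exI[of _ c] conjI)
    next
      assume "covered (unordered ` set ps) a b"
      then obtain c where c: "{a, c} \<in> unordered ` set ps" "{b, c} \<in> unordered ` set ps"
        unfolding covered_def by (elim exE conjE) (rule that)
      have "f ` {a, c} \<in> E1" "f ` {b, c} \<in> E1"
        unfolding E1_def by (rule imageI[OF c(1)], rule imageI[OF c(2)])
      then have "{f a, f c} \<in> E" "{f b, f c} \<in> E" unfolding E_def by simp_all
      then show "covered E (f a) (f b)" unfolding covered_def by blast
    qed
    then show ?thesis
      using i ab esi len_es len in_triangle_iff_covered[OF graph \<open>{f a, f b} \<in> E\<close>]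
      unfolding ys_def by simp
  qed
  moreover have "length ys = m" using len_es unfolding ys_def by simp
  ultimately show ?thesis unfolding es_def n_def cardE by blast
qed

text \<open>
  At most \<open>4 m\<close> edges are split into 20 chunks of size \<open>m div 3\<close>, and \<open>k < 8000\<close> encodes a triple of
  chunks in base 20. A triple has at most \<open>m\<close> edges, and every triangle lies in some triple.
\<close>

definition chunks :: "nat \<Rightarrow> nat set" where
  "chunks k = {k mod 20, k div 20 mod 20, k div 400}"

definition selected :: "nat \<Rightarrow> nat \<Rightarrow> nat \<Rightarrow> nat list" where
  "selected s N k = filter (\<lambda>e. e div s \<in> chunks k) [0..<N]"

text \<open>The three chunk indices may coincide, so this is only an upper bound. For
  \<open>s = m div 3\<close> it is at most \<open>m\<close>, and padding makes up the
  difference.\<close>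

lemma length_selected:
  assumes "s > 0"
  shows "length (selected s N k) \<le> 3 * s"
proof -
  have eq: "{e. e div s = x} = {x * s..<x * s + s}" for x
  proof (intro set_eqI)
    fix e
    have "e div s = x \<longleftrightarrow> x \<le> e div s \<and> e div s < Suc x" by auto
    also have "\<dots> \<longleftrightarrow> x * s \<le> e \<and> e < Suc x * s"
      using assms by (simp only: less_eq_div_iff_mult_less_eq div_less_iff_less_mult)
    finally show "e \<in> {e. e div s = x} \<longleftrightarrow> e \<in> {x * s..<x * s + s}" by (simp add: add.commute)
  qed
  have "set (selected s N k) \<subseteq> (\<Union>x\<in>chunks k. {e. e div s = x})"
    unfolding selected_def by auto
  moreover have fin: "finite (\<Union>x\<in>chunks k. {e. e div s = x})" unfolding eq chunks_def by simp
  ultimately have "card (set (selected s N k)) \<le> card (\<Union>x\<in>chunks k. {e. e div s = x})"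
    by (rule card_mono[rotated])
  also have "\<dots> \<le> (\<Sum>x\<in>chunks k. card {e. e div s = x})"
    by (rule card_UN_le) (simp add: chunks_def)
  also have "\<dots> = card (chunks k) * s" unfolding eq by simp
  also have "\<dots> \<le> 3 * s" unfolding chunks_def by (intro mult_right_mono) (auto simp: card_insert_if)
  finally show ?thesis using distinct_card[of "selected s N k"] unfolding selected_def by simp
qed

text \<open>Origin of the constant 20: for \<open>m >= 3\<close> the remainder modulo 3 is at most
  twice the quotient, so \<open>m <= 5 * (m div 3)\<close> and
  \<open>4 * m <= 20 * (m div 3)\<close>. The number of triples of chunks is then
  \<open>20 ^ 3 = 8000\<close>.\<close>

lemma chunk_index_less:
  fixes m :: nat
  assumes "m \<ge> 3" "e < 4 * m"
  shows "e div (m div 3) < 20"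
proof -
  have "m = 3 * (m div 3) + m mod 3" "m mod 3 < 3" by simp_all
  moreover have "m div 3 \<ge> 1" using assms(1) by (simp add: less_eq_div_iff_mult_less_eq)
  ultimately have "e < 20 * (m div 3)" using assms(2) by linarith
  then show ?thesis by (simp add: less_mult_imp_div_less)
qed

lemma ex_chunks:
  fixes x y z :: nat
  assumes "x < 20" "y < 20" "z < 20"
  shows "\<exists>k<8000. x \<in> chunks k \<and> y \<in> chunks k \<and> z \<in> chunks k"
proof (intro exI conjI)
  let ?k = "x + 20 * (y + 20 * z)"
  have "x + 20 * y + 400 * z < 8000" using assms by linarith
  then show "?k < 8000" by simp
  have "?k mod 20 = x" using assms by (simp only: mod_mult_self2) simp
  moreover have d: "?k div 20 = y + 20 * z" using assms by simp
  moreover have "?k div 20 mod 20 = y" unfolding d using assms by (simp only: mod_mult_self2) simp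
  moreover have "?k div 400 = z"
  proof -
    have "?k div 400 = ?k div 20 div 20" by (simp only: div_mult2_eq[symmetric]) simp
    then show ?thesis unfolding d using assms by simp
  qed
  ultimately show "x \<in> chunks ?k" "y \<in> chunks ?k" "z \<in> chunks ?k" unfolding chunks_def by simp_all
qed

text \<open>A subgraph has no new triangles, so a positive answer of a single call is never wrong.
  This is why the answers of all calls may be combined by disjunction.\<close>

lemma covered_iff_ex_selected:
  assumes m: "m \<ge> 3" "N \<le> 4 * m" and e: "e < N"
  shows "covered ((\<lambda>e. {f e, g e}) ` {..<N}) (f e) (g e) \<longleftrightarrow>
    (\<exists>k<8000. e \<in> set (selected (m div 3) N k) \<and>
      covered ((\<lambda>e. {f e, g e}) ` set (selected (m div 3) N k)) (f e) (g e))"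
proof
  assume "covered ((\<lambda>e. {f e, g e}) ` {..<N}) (f e) (g e)"
  then obtain c e1 e2 where c: "{f e, c} = {f e1, g e1}" "e1 < N" "{g e, c} = {f e2, g e2}" "e2 < N"
    unfolding covered_def by auto
  obtain k where k: "k < 8000" "e div (m div 3) \<in> chunks k" "e1 div (m div 3) \<in> chunks k"
    "e2 div (m div 3) \<in> chunks k"
    using ex_chunks[of "e div (m div 3)" "e1 div (m div 3)" "e2 div (m div 3)"]
      chunk_index_less[OF m(1)] e c m(2) by (meson less_le_trans)
  then have sel: "e \<in> set (selected (m div 3) N k)" "e1 \<in> set (selected (m div 3) N k)"
      "e2 \<in> set (selected (m div 3) N k)"
    using c e unfolding selected_def by auto
  then have "covered ((\<lambda>e. {f e, g e}) ` set (selected (m div 3) N k)) (f e) (g e)"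
    using c unfolding covered_def by blast
  then show "\<exists>k<8000. e \<in> set (selected (m div 3) N k) \<and>
      covered ((\<lambda>e. {f e, g e}) ` set (selected (m div 3) N k)) (f e) (g e)"
    using k sel by blast
next
  assume "\<exists>k<8000. e \<in> set (selected (m div 3) N k) \<and>
      covered ((\<lambda>e. {f e, g e}) ` set (selected (m div 3) N k)) (f e) (g e)"
  moreover have "set (selected (m div 3) N k) \<subseteq> {..<N}" for k unfolding selected_def by auto
  ultimately show "covered ((\<lambda>e. {f e, g e}) ` {..<N}) (f e) (g e)"
    unfolding covered_def by blast
qed

section \<open>Calling the detection program\<close>

text \<open>Register 26 holds the current edge, \<open>x\<close> the base of a key array, 27 the
  number of endpoints written so far, 28 the number of distinct keys so far, and 32 the base of the
  table. The offset 3 skips the cells of the length and of the two counts that precede the edge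
  list.\<close>

definition add_endpoint :: "nat \<Rightarrow> prog" where
  "add_endpoint x =
     Op 31 Add x 26 ;; Load 31 31 ;; Op 31 Add 31 32 ;; Load 33 31 ;;
     Branch (Equal 33 0) (Op 28 Add 28 1 ;; Store 31 28 ;; Op 33 Add 28 0) Skip ;;
     Op 33 Sub 33 1 ;; Op 34 Add 16 27 ;; Op 34 Add 34 3 ;; Store 34 33 ;; Op 27 Add 27 1"

lemma writes_add_endpoint: "writes (add_endpoint x) = {27, 28, 31, 33, 34}"
  unfolding add_endpoint_def by auto

text \<open>
  Vertices are arbitrary keys below \<open>B\<close> and get consecutive numbers at their first occurrence. The
  region from \<open>off + B\<close> on is a table that maps a key to its number plus one, so that untouched
  memory, which is zero, means that a key is new. The region from \<open>off\<close> on is the memory of the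
  simulated program, whose input has the list of endpoints in cell 3 and beyond.
\<close>

definition numbering :: "nat \<Rightarrow> nat \<Rightarrow> nat list \<Rightarrow> (nat \<Rightarrow> nat) \<Rightarrow> (nat \<Rightarrow> nat) \<Rightarrow> (nat \<Rightarrow> nat) \<Rightarrow> bool" where
  "numbering B off ks h0 r h \<longleftrightarrow> r 27 = length ks \<and> r 28 = card (set ks) \<and> set ks \<subseteq> {..<B} \<and>
     inj_on (\<lambda>k. h (off + B + k)) (set ks) \<and>
     (\<lambda>k. h (off + B + k)) ` set ks = {1..card (set ks)} \<and>
     (\<forall>k<B. k \<notin> set ks \<longrightarrow> h (off + B + k) = 0) \<and>
     (\<forall>i<length ks. Suc (h (off + 3 + i)) = h (off + B + ks ! i)) \<and>
     (\<forall>a. a < off \<or> off + 2 * B \<le> a \<longrightarrow> h a = h0 a) \<and>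
     (\<forall>i<B. i < 3 \<or> length ks + 3 \<le> i \<longrightarrow> h (off + i) = 0)"

lemma numbering_Nil:
  assumes "\<And>a. a \<ge> off \<Longrightarrow> h a = 0" "r 27 = 0" "r 28 = 0"
  shows "numbering B off [] h r h"
  unfolding numbering_def using assms by auto

lemma numbering_frame:
  "numbering B off ks h0 r h \<Longrightarrow> r' 27 = r 27 \<Longrightarrow> r' 28 = r 28 \<Longrightarrow> numbering B off ks h0 r' h"
  unfolding numbering_def by simp

lemma numbering_step_old:
  assumes num: "numbering B off ks h0 r h" and k: "k \<in> set ks" and len: "length ks + 4 < B"
    and r': "r' 27 = Suc (r 27)" "r' 28 = r 28"
  shows "numbering B off (ks @ [k]) h0 r' (h(off + 3 + length ks := h (off + B + k) - 1))"
proof -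
  let ?h = "h(off + 3 + length ks := h (off + B + k) - 1)"
  \<comment> \<open>The endpoint list grows from \<open>off + 3\<close> and, by the bound on its
    length, stays below the table at \<open>off + B\<close>.\<close>
  have eq: "?h (off + B + j) = h (off + B + j)" for j using len by simp
  have pos: "h (off + B + k) \<ge> 1"
    using num k unfolding numbering_def by (metis atLeastAtMost_iff imageI)
  have set_eq: "set (ks @ [k]) = set ks" using k by auto
  have cells: "Suc (?h (off + 3 + i)) = ?h (off + B + (ks @ [k]) ! i)" if i: "i < length (ks @ [k])" for i
  proof (cases "i = length ks")
    case True
    then show ?thesis unfolding eq using pos by simp
  next
    case False
    then have "i < length ks" using i by simp
    then show ?thesis unfolding eq using num by (simp add: numbering_def nth_append)
  qed
  show ?thesis
    unfolding numbering_def set_eq eq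
  proof (intro conjI allI impI)
    fix i assume "i < length (ks @ [k])"
    then show "Suc (?h (off + 3 + i)) = h (off + B + (ks @ [k]) ! i)" using cells eq by simp
  next
    fix a assume "a < off \<or> off + 2 * B \<le> a"
    then show "?h a = h0 a" using num len unfolding numbering_def by auto
  next
    fix i assume "i < B" "i < 3 \<or> length (ks @ [k]) + 3 \<le> i"
    then show "?h (off + i) = 0" using num unfolding numbering_def by auto
  qed (use num r' in \<open>simp_all add: numbering_def\<close>)
qed

lemma numbering_step_new:
  assumes num: "numbering B off ks h0 r h" and k: "k \<notin> set ks" "k < B" and len: "length ks + 4 < B"
    and r': "r' 27 = Suc (r 27)" "r' 28 = Suc (r 28)"
  shows "numbering B off (ks @ [k]) h0 r'
    (h(off + B + k := Suc (card (set ks)), off + 3 + length ks := card (set ks)))"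
proof -
  let ?c = "card (set ks)"
  let ?h = "h(off + B + k := Suc ?c, off + 3 + length ks := ?c)"
  have new: "?h (off + B + k) = Suc ?c" using len by simp
  have old: "?h (off + B + j) = h (off + B + j)" if "j \<noteq> k" for j using len that by simp
  have old': "?h (off + B + j) = h (off + B + j)" if "j \<in> set ks" for j using old that k by metis
  have card: "card (set (ks @ [k])) = Suc ?c" using k by simp
  have img: "(\<lambda>k. h (off + B + k)) ` set ks = {1..?c}" using num unfolding numbering_def by simp
  have img': "(\<lambda>k. ?h (off + B + k)) ` set ks = {1..?c}"
    unfolding img[symmetric] using old' by (intro image_cong) auto
  have inj: "inj_on (\<lambda>k. h (off + B + k)) (set ks)" using num unfolding numbering_def by simp
  have inj': "inj_on (\<lambda>k. ?h (off + B + k)) (set ks)"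
    by (rule inj_on_cong[THEN iffD1, OF _ inj]) (use old' in auto)
  have set_eq: "set (ks @ [k]) = insert k (set ks)" by simp
  show ?thesis
    unfolding numbering_def card
  proof (intro conjI allI impI)
    show "inj_on (\<lambda>k. ?h (off + B + k)) (set (ks @ [k]))"
      unfolding set_eq
    proof (subst inj_on_insert, intro conjI)
      have "?h (off + B + k) \<notin> (\<lambda>k. ?h (off + B + k)) ` set ks" unfolding img' new by simp
      then show "?h (off + B + k) \<notin> (\<lambda>k. ?h (off + B + k)) ` (set ks - {k})" by blast
    qed (rule inj')
    show "(\<lambda>k. ?h (off + B + k)) ` set (ks @ [k]) = {1..Suc ?c}"
      unfolding set_eq image_insert img' new by auto
  next
    fix j assume "j < B" "j \<notin> set (ks @ [k])"
    then show "?h (off + B + j) = 0" using num old[of j] by (simp add: numbering_def)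
  next
    fix i assume i: "i < length (ks @ [k])"
    show "Suc (?h (off + 3 + i)) = ?h (off + B + (ks @ [k]) ! i)"
    proof (cases "i = length ks")
      case True
      then show ?thesis using new by simp
    next
      case False
      then have i': "i < length ks" using i by simp
      then have "(ks @ [k]) ! i = ks ! i" "ks ! i \<in> set ks" by (simp_all add: nth_append)
      moreover have "?h (off + 3 + i) = h (off + 3 + i)" using i' len by simp
      ultimately show ?thesis using old' i' num by (simp add: numbering_def)
    qed
  next
    fix a assume "a < off \<or> off + 2 * B \<le> a"
    then show "?h a = h0 a" using num len k unfolding numbering_def by auto
  next
    fix i assume "i < B" "i < 3 \<or> length (ks @ [k]) + 3 \<le> i"
    then show "?h (off + i) = 0" using num unfolding numbering_def by auto
  qed (use num r' k in \<open>simp_all add: numbering_def\<close>)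
qed

lemma runs_add_endpoint:
  assumes r: "r 0 = 0" "r 1 = 1" "r 3 = 3" "r 16 = off" "r 32 = off + B"
    and x: "x \<notin> {27, 28, 31, 33, 34}" "r x + r 26 < 2 ^ w" "h (r x + r 26) = k" "k < B"
    and num: "numbering B off ks h0 r h" and len: "length ks + 4 < B" and w: "off + 2 * B \<le> 2 ^ w"
  shows "runs w (add_endpoint x) r h 14 (numbering B off (ks @ [k]) h0)"
proof -
  have r27: "r 27 = length ks" and r28: "r 28 = card (set ks)" using num unfolding numbering_def by auto
  have cB: "card (set ks) \<le> length ks" by (rule card_length)
  have zero_iff: "h (off + B + k) = 0 \<longleftrightarrow> k \<notin> set ks"
    using num x(4) unfolding numbering_def
    by (metis atLeastAtMost_iff imageI not_one_le_zero)
  have kw: "k < 2 ^ w" "off + B + k < 2 ^ w" using x(4) w by linarith+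
  have lw: "Suc (length ks) < 2 ^ w" "Suc (card (set ks)) < 2 ^ w" "off + length ks < 2 ^ w"
     "off + length ks + 3 < 2 ^ w"
    using len w cB by linarith+
  show ?thesis
  proof (cases "k \<in> set ks")
    case True
    have "h (off + B + k) \<in> {1..card (set ks)}" using num True unfolding numbering_def by blast
    then have hw: "0 < h (off + B + k)" "h (off + B + k) < 2 ^ w" "h (off + B + k) - Suc 0 < 2 ^ w"
      using lw by auto
    note step = numbering_step_old[OF num True len]
    show ?thesis
      unfolding add_endpoint_def
      by (rule runs_wp)
        (use step[of "_(27 := Suc (length ks))"] x r r27 r28 kw lw hw in \<open>simp_all add: ac_simps\<close>)
  next
    case False
    then have z: "h (off + B + k) = 0" using zero_iff by simp
    note step = numbering_step_new[OF num False x(4) len]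
    show ?thesis
      unfolding add_endpoint_def
      by (rule runs_wp)
        (use step[of "_(27 := Suc (length ks))"] x r r27 r28 kw lw z in \<open>simp_all add: ac_simps\<close>)
  qed
qed

text \<open>
  Arrays of at most \<open>B\<close> cells start at \<open>bU\<close> and \<open>bV\<close> (smaller and larger endpoints of the edges),
  \<open>bK\<close> and \<open>bL\<close> (keys of the endpoints of the edges to be tested), \<open>bR\<close> (results of the tests), \<open>bC\<close>
  (candidates) and \<open>bE\<close> (refined candidates). Every call of the detection program uses two fresh
  regions above \<open>b0\<close>, hence no memory is ever cleared.
\<close>

locale ram =
  fixes w m n B bU bV bK bL bR bC bE b0 :: nat
  assumes m3: "3 \<le> m" and n_le: "n \<le> 2 * m" and B_large: "100 * m + 8000 \<le> B" and B_square: "100 * (m * m) \<le> B"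
    and bases: "B \<le> bU" "bU + B \<le> bV" "bV + B \<le> bK" "bK + B \<le> bL" "bL + B \<le> bR" "bR + B \<le> bC"
      "bC + B \<le> bE" "bE + B \<le> b0" "b0 \<le> 2 ^ w"
begin

text \<open>Instructions operate on registers only, so literals and array bases are kept in
  registers that nothing after the setup overwrites.\<close>

definition const_regs :: "(nat \<Rightarrow> nat) \<Rightarrow> bool" where
  "const_regs r \<longleftrightarrow> r 0 = 0 \<and> r 1 = 1 \<and> r 2 = 2 \<and> r 3 = 3 \<and> r 4 = m \<and> r 5 = n \<and> r 6 = B \<and>
     r 7 = m div 3 \<and> r 8 = 4 * m \<and> r 9 = bU \<and> r 10 = bV \<and> r 11 = bK \<and> r 12 = bL \<and> r 13 = bR \<and>
     r 14 = bC \<and> r 15 = bE \<and> r 21 = 20 \<and> r 22 = 8000 \<and> r 43 = 2 * m"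

lemma const_regs_frame:
  assumes "const_regs r" "\<forall>x. x \<notin> W \<longrightarrow> r' x = r x" "\<forall>x \<in> {0..15} \<union> {21, 22, 43}. x \<notin> W"
  shows "const_regs r'"
proof -
  have "r' x = r x" if "x \<in> {0..15} \<union> {21, 22, 43}" for x using assms(2,3) that by blast
  then show ?thesis using assms(1) unfolding const_regs_def by simp
qed

lemma const_regsD:
  assumes "const_regs r"
  shows "r 0 = 0" "r 1 = 1" "r (Suc 0) = 1" "r 2 = 2" "r 3 = 3" "r 4 = m" "r 5 = n" "r 6 = B"
     "r 7 = m div 3" "r 8 = 4 * m" "r 9 = bU" "r 10 = bV" "r 11 = bK" "r 12 = bL" "r 13 = bR"
     "r 14 = bC" "r 15 = bE" "r 21 = 20" "r 22 = 8000" "r 43 = 2 * m"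
  using assms unfolding const_regs_def by simp_all

end

section \<open>Writing the padded input of one call\<close>

definition if_selected :: "prog \<Rightarrow> prog" where
  "if_selected p = Op 30 Div 26 7 ;;
     Branch (Equal 30 23) p (Branch (Equal 30 24) p (Branch (Equal 30 25) p Skip))"

lemma writes_if_selected: "writes (if_selected p) = insert 30 (writes p)"
  unfolding if_selected_def by auto

lemma runs_Skip: "Q r h \<Longrightarrow> 1 \<le> T \<Longrightarrow> runs w Skip r h T Q"
  by (rule runs_wp) simp_all

text \<open>The program \<open>p\<close> occurs three times in the code, but the nesting of the
  tests makes it run at most once, even if chunk indices coincide. The 4 extra steps are one
  division and three tests.\<close>

lemma runs_if_selected:
  assumes w: "r 26 div r 7 < 2 ^ w" and T: "1 \<le> T"
    and yes: "r 26 div r 7 \<in> {r 23, r 24, r 25} \<Longrightarrow> runs w p (r(30 := r 26 div r 7)) h T Q"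
    and no: "r 26 div r 7 \<notin> {r 23, r 24, r 25} \<Longrightarrow> Q (r(30 := r 26 div r 7)) h"
  shows "runs w (if_selected p) r h (T + 4) Q"
  unfolding if_selected_def
proof (rule runs_Seq)
  let ?r = "r(30 := r 26 div r 7)"
  show "runs w (Op 30 Div 26 7) r h 1 (\<lambda>r' h'. r' = ?r \<and> h' = h)"
    by (rule runs_wp) (simp_all add: w)
  fix r' h' assume "r' = ?r \<and> h' = h"
  then have eq: "r' = ?r" "h' = h" by auto
  have skip: "runs w Skip ?r h T Q" if "r 26 div r 7 \<notin> {r 23, r 24, r 25}"
    by (rule runs_Skip[OF _ T]) (rule no[OF that])
  have yes': "runs w p ?r h T Q" if "r 26 div r 7 \<in> {r 23, r 24, r 25}" using yes[OF that] .
  have b3: "runs w (Branch (Equal 30 25) p Skip) ?r h (T + 1) Q"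
    if "r 26 div r 7 \<noteq> r 23" "r 26 div r 7 \<noteq> r 24"
  proof (rule runs_Branch[where T = T])
    assume "holds (Equal 30 25) ?r"
    then show "runs w p ?r h T Q" using yes' by simp
  next
    assume "\<not> holds (Equal 30 25) ?r"
    then show "runs w Skip ?r h T Q" using skip that by simp
  qed simp
  have b2: "runs w (Branch (Equal 30 24) p (Branch (Equal 30 25) p Skip)) ?r h (T + 2) Q"
    if "r 26 div r 7 \<noteq> r 23"
  proof (rule runs_Branch[where T = "T + 1"])
    assume "holds (Equal 30 24) ?r"
    then have "runs w p ?r h T Q" using yes' by simp
    then show "runs w p ?r h (T + 1) Q" by (rule runs_mono) simp_all
  next
    assume "\<not> holds (Equal 30 24) ?r"
    then show "runs w (Branch (Equal 30 25) p Skip) ?r h (T + 1) Q" using b3 that by simp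
  qed simp
  show "runs w (Branch (Equal 30 23) p (Branch (Equal 30 24) p (Branch (Equal 30 25) p Skip))) r' h'
      (T + 3) Q"
    unfolding eq
  proof (rule runs_Branch[where T = "T + 2"])
    assume "holds (Equal 30 23) ?r"
    then have "runs w p ?r h T Q" using yes' by simp
    then show "runs w p ?r h (T + 2) Q" by (rule runs_mono) simp_all
  next
    assume "\<not> holds (Equal 30 23) ?r"
    then show "runs w (Branch (Equal 30 24) p (Branch (Equal 30 25) p Skip)) ?r h (T + 2) Q"
      using b2 by simp
  qed simp
qed simp

lemma selected_Suc:
  "selected s (Suc j) k = selected s j k @ (if j div s \<in> chunks k then [j] else [])"
  unfolding selected_def by simp

definition endpoints :: "(nat \<Rightarrow> nat) \<Rightarrow> (nat \<Rightarrow> nat) \<Rightarrow> nat list \<Rightarrow> nat list" where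
  "endpoints f g es = concat (map (\<lambda>e. [f e, g e]) es)"

lemma length_endpoints [simp]: "length (endpoints f g es) = 2 * length es"
  unfolding endpoints_def by (induction es) auto

lemma endpoints_snoc: "endpoints f g (es @ [e]) = (endpoints f g es @ [f e]) @ [g e]"
  unfolding endpoints_def by simp

context ram
begin

lemma length_selected_le: "length (selected (m div 3) N k) \<le> m"
proof -
  have "m div 3 > 0" using m3 by (simp add: div_greater_zero_iff)
  from length_selected[OF this] show ?thesis
    by (metis le_trans mult.commute div_times_less_eq_dividend)
qed

definition build_prog :: prog where
  "build_prog = For 26 19 (if_selected (add_endpoint 11 ;; add_endpoint 12))"

lemma writes_build_prog: "writes build_prog = {26, 27, 28, 30, 31, 33, 34}"
  unfolding build_prog_def writes_For writes_if_selected writes.simps writes_add_endpoint by auto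

lemma runs_build_prog:
  assumes c: "const_regs r" and N: "r 19 = N" "N \<le> 4 * m" and ch: "{r 23, r 24, r 25} = chunks k"
    and off: "r 16 = off" "r 32 = off + B" "b0 \<le> off" "off + 2 * B \<le> 2 ^ w"
    and cnt: "r 27 = 0" "r 28 = 0" and z: "\<And>a. off \<le> a \<Longrightarrow> h a = 0"
    and f: "\<And>e. e < N \<Longrightarrow> h (bK + e) = f e \<and> f e < B"
    and g: "\<And>e. e < N \<Longrightarrow> h (bL + e) = g e \<and> g e < B"
  shows "runs w build_prog r h (N * 40 + 2)
    (numbering B off (endpoints f g (selected (m div 3) N k)) h)"
proof -
  let ?ks = "\<lambda>j. endpoints f g (selected (m div 3) j k)"
  let ?I = "\<lambda>j. numbering B off (?ks j) h"
  note cD = const_regsD[OF c]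
  have Nw: "N < 2 ^ w" using N(2) B_large off(4) by linarith
  have "runs w build_prog r h (N * 40 + 2) (?I (r 19))"
    unfolding build_prog_def
  proof (rule runs_For[where T = 32])
    show "?I 0 (r(26 := 0)) h"
      using numbering_Nil[of off h "r(26 := 0)" B] z cnt by (simp add: selected_def endpoints_def)
  next
    fix j r' h' assume j: "j < r 19" "r' 26 = j" and
      fr: "\<forall>x. x \<notin> insert 26 (writes (if_selected (add_endpoint 11 ;; add_endpoint 12))) \<longrightarrow> r' x = r x"
      and I: "?I j r' h'"
    have fr': "r' x = r x" if "x \<notin> {26, 27, 28, 30, 31, 33, 34}" for x
      using fr that by (auto simp: writes_if_selected writes_add_endpoint)
    have c': "const_regs r'" by (rule const_regs_frame[OF c, of "{26, 27, 28, 30, 31, 33, 34}"]) (use fr' in auto)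
    note cD' = const_regsD[OF c']
    have jN: "j < N" using j N by simp
    have jB: "j < B" using jN N B_large by linarith
    have low: "h' a = h a" if "a < off" for a using I that unfolding numbering_def by blast
    have fj: "h' (bK + j) = f j" "f j < B" using low[of "bK + j"] f[OF jN] jB bases off by auto
    have bKj: "bK + j < 2 ^ w" "bL + j < 2 ^ w" "j div (m div 3) < 2 ^ w"
      using jB bases div_le_dividend[of j "m div 3"] by linarith+
    have "2 * length (selected (m div 3) j k) + 5 < B"
      using length_selected_le[of j k] B_large by linarith
    then have len: "length (?ks j) + 4 < B" "length (?ks j @ [f j]) + 4 < B" by auto
    show "runs w (if_selected (add_endpoint 11 ;; add_endpoint 12)) r' h' 32
        (\<lambda>r'' h''. ?I (Suc j) (r''(26 := Suc j)) h'')"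
    proof (rule runs_mono[OF runs_if_selected[where T = 28]])
      show "r' 26 div r' 7 < 2 ^ w" using j(2) cD' bKj by simp
    next
      assume sel: "r' 26 div r' 7 \<in> {r' 23, r' 24, r' 25}"
      let ?r = "r'(30 := r' 26 div r' 7)"
      have "{r' 23, r' 24, r' 25} = chunks k" using ch fr' by simp
      then have sel': "j div (m div 3) \<in> chunks k" using sel j(2) cD' by simp
      show "runs w (add_endpoint 11 ;; add_endpoint 12) ?r h' 28
          (\<lambda>r'' h''. ?I (Suc j) (r''(26 := Suc j)) h'')"
      proof (rule runs_Seq)
        have I': "numbering B off (?ks j) h ?r h'" by (rule numbering_frame[OF I]) simp_all
        have o: "r' 16 = off" "r' 32 = off + B" using fr' off by simp_all
        show "runs w (add_endpoint 11) ?r h' 14 (numbering B off (?ks j @ [f j]) h)"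
          by (rule runs_add_endpoint[OF _ _ _ _ _ _ _ _ _ I' len(1) off(4)])
            (simp_all add: cD' o fj bKj j(2))
      next
        fix r2 h2 assume num: "numbering B off (?ks j @ [f j]) h r2 h2"
          and fr2: "\<forall>x. x \<notin> writes (add_endpoint 11) \<longrightarrow> r2 x = ?r x"
        have fr2': "r2 x = r' x" if "x \<notin> {27, 28, 30, 31, 33, 34}" for x
          using fr2 that by (simp add: writes_add_endpoint)
        have low: "h2 a = h a" if "a < off" for a using num that unfolding numbering_def by blast
        have o: "r' 16 = off" "r' 32 = off + B" using fr' off by simp_all
        have gj: "h2 (bL + j) = g j" "g j < B" using low[of "bL + j"] g[OF jN] jB bases off by auto
        have eq: "?ks (Suc j) = (?ks j @ [f j]) @ [g j]"
          using sel' by (simp add: selected_Suc endpoints_snoc)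
        have "runs w (add_endpoint 12) r2 h2 14 (?I (Suc j))"
          unfolding eq
          by (rule runs_add_endpoint[OF _ _ _ _ _ _ _ _ _ num len(2) off(4)])
            (simp_all add: cD' fr2' o gj bKj j(2))
        then show "runs w (add_endpoint 12) r2 h2 14 (\<lambda>r'' h''. ?I (Suc j) (r''(26 := Suc j)) h'')"
          by (rule runs_mono) (auto elim: numbering_frame)
      qed simp
    next
      assume sel: "r' 26 div r' 7 \<notin> {r' 23, r' 24, r' 25}"
      have "{r' 23, r' 24, r' 25} = chunks k" using ch fr' by simp
      then have "?ks (Suc j) = ?ks j" using sel j(2) cD' by (simp add: selected_Suc)
      then show "?I (Suc j) ((r'(30 := r' 26 div r' 7))(26 := Suc j)) h'"
        using numbering_frame[OF I] by simp
    qed auto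
  qed (use cD N Nw in \<open>simp_all add: writes_if_selected writes_add_endpoint\<close>)
  then show ?thesis using N by simp
qed

text \<open>Registers 27 and 28 are increased together until \<open>2 * m\<close> endpoints are
  written, so 28 ends up as the number of vertices of the padded graph. The header with length,
  vertex count and edge count comes last because that number is known only then.\<close>

definition pad_prog :: prog where
  "pad_prog = Loop (Less 27 43)
     (Op 34 Add 16 27 ;; Op 34 Add 34 3 ;; Store 34 28 ;; Op 28 Add 28 1 ;; Op 27 Add 27 1) ;;
     Op 34 Add 43 2 ;; Store 16 34 ;; Op 34 Add 16 1 ;; Store 34 28 ;; Op 34 Add 16 2 ;; Store 34 4"

lemma writes_pad_prog: "writes pad_prog = {27, 28, 34}"
  unfolding pad_prog_def by auto

lemma runs_pad_prog:
  assumes c: "const_regs r" and off: "r 16 = off" "off + 2 * B \<le> 2 ^ w"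
    and len: "r 27 = l" "l \<le> 2 * m" and v0: "r 28 = v0" "v0 \<le> 2 * m"
  shows "runs w pad_prog r h (m * 20 + 10) (\<lambda>r' h'. h' = (\<lambda>a.
    if a = off then 2 * m + 2 else if a = off + 1 then v0 + (2 * m - l) else if a = off + 2 then m
    else if off + 3 + l \<le> a \<and> a < off + 3 + 2 * m then v0 + (a - (off + 3 + l)) else h a))"
proof -
  let ?body = "Op 34 Add 16 27 ;; Op 34 Add 34 3 ;; Store 34 28 ;; Op 28 Add 28 1 ;; Op 27 Add 27 1"
  note cD = const_regsD[OF c]
  define G where "G = (\<lambda>j a. if off + 3 + l \<le> a \<and> a < off + 3 + l + j then v0 + (a - (off + 3 + l)) else h a)"
  let ?I = "\<lambda>j r' h'. r' 27 = l + j \<and> r' 28 = v0 + j \<and> l + j \<le> 2 * m \<and> h' = G j"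
  have G_Suc: "(G j)(off + 3 + (l + j) := v0 + j) = G (Suc j)" for j
    unfolding G_def by (auto simp: fun_eq_iff)
  show ?thesis
    unfolding pad_prog_def
  proof (rule runs_Seq)
    show "runs w (Loop (Less 27 43) ?body) r h
        ((2 * m - l) * 6 + 1) (\<lambda>r' h'. \<not> holds (Less 27 43) r' \<and> (\<exists>j \<le> 2 * m - l. ?I j r' h'))"
    proof (rule runs_Loop[where T = 5])
      show "?I 0 r h" using len v0 unfolding G_def by auto
    next
      fix j r' h' assume I: "?I j r' h'" and t: "holds (Less 27 43) r'" and
        fr: "\<forall>x. x \<notin> writes ?body \<longrightarrow> r' x = r x"
      have fr': "r' 43 = 2 * m" "r' 16 = off" "r' 1 = 1" "r' 3 = 3" "r' (Suc 0) = 1" using fr cD off by auto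
      have lt: "l + j < 2 * m" using t I fr' by simp
      then have w: "off + (l + j) < 2 ^ w" "off + (l + j) + 3 < 2 ^ w" "Suc (v0 + j) < 2 ^ w" "Suc (l + j) < 2 ^ w"
        using B_large off v0 by linarith+
      have G: "(G j)(off + (l + j) + 3 := v0 + j) = G (Suc j)" using G_Suc[of j] by (simp add: ac_simps)
      show "j < 2 * m - l \<and> runs w ?body r' h' 5 (?I (Suc j))"
        by (intro conjI runs_wp) (use lt I fr' w G in \<open>simp_all del: fun_upd_apply add: fun_upd_same fun_upd_other\<close>)
    qed (use len in auto)
  next
    fix r' h' assume post: "\<not> holds (Less 27 43) r' \<and> (\<exists>j \<le> 2 * m - l. ?I j r' h')" and
      fr: "\<forall>x. x \<notin> writes (Loop (Less 27 43) ?body) \<longrightarrow> r' x = r x"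
    have fr': "r' 43 = 2 * m" "r' 16 = off" "r' 1 = 1" "r' 2 = 2" "r' (Suc 0) = 1" "r' 4 = m" using fr cD off by auto
    have I: "?I (2 * m - l) r' h'"
    proof -
      obtain j where j: "?I j r' h'" using post by blast
      then have "\<not> l + j < 2 * m" using post fr' by simp
      then have "j = 2 * m - l" using j by linarith
      then show ?thesis using j by simp
    qed
    have w: "Suc (Suc (2 * m)) < 2 ^ w" "Suc off < 2 ^ w" "Suc (Suc off) < 2 ^ w" using B_large off by linarith+
    show "runs w (Op 34 Add 43 2 ;; Store 16 34 ;; Op 34 Add 16 1 ;; Store 34 28 ;; Op 34 Add 16 2 ;; Store 34 4)
      r' h' 6 (\<lambda>r' h'. h' = (\<lambda>a.
    if a = off then 2 * m + 2 else if a = off + 1 then v0 + (2 * m - l) else if a = off + 2 then m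
    else if off + 3 + l \<le> a \<and> a < off + 3 + 2 * m then v0 + (a - (off + 3 + l)) else h a))"
      by (rule runs_wp) (use I fr' w len in \<open>auto simp: fun_eq_iff G_def\<close>)
  qed (use len in \<open>auto simp: algebra_simps\<close>)
qed

end

lemma endpoints_eq: "endpoints f g es = concat (map (\<lambda>(u, v). [u, v]) (map (\<lambda>e. (f e, g e)) es))"
  unfolding endpoints_def by (simp add: comp_def)

lemma snd_init_state: "snd (init_state xs) a = (if a \<le> length xs then (length xs # xs) ! a else 0)"
  unfolding init_state_def by simp

text \<open>Agreement is needed on all \<open>B\<close> cells and not just on the input: the
  detection program may rely on zeros beyond its input, and the freshness of the region provides
  them.\<close>

lemma instance_in_memory:
  assumes num: "numbering B off (endpoints f g es) h0 r h"
    and len: "length es \<le> m" "2 * m + 3 \<le> B"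
    and dist: "distinct (map (\<lambda>e. {f e, g e}) es)"
    and loopfree: "\<And>e. e \<in> set es \<Longrightarrow> f e \<noteq> g e"
    and h': "h' = (\<lambda>a. if a = off then 2 * m + 2 else if a = off + 1 then r 28 + (2 * m - r 27)
      else if a = off + 2 then m
      else if off + 3 + r 27 \<le> a \<and> a < off + 3 + 2 * m then r 28 + (a - (off + 3 + r 27)) else h a)"
  shows "\<exists>xs ys. (m, xs, {ys}) \<in> EdgeTriangleDetection \<and> length ys = m \<and>
    (\<forall>a<B. h' (off + a) = snd (init_state xs) a) \<and>
    (\<forall>i<length es. ys ! i =
      (if covered ((\<lambda>e. {f e, g e}) ` set es) (f (es ! i)) (g (es ! i)) then 1 else 0))"
proof -
  define ps where "ps = map (\<lambda>e. (f e, g e)) es"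
  define ks where "ks = endpoints f g es"
  define v0 where "v0 = card (set ks)"
  define \<phi> where "\<phi> = (\<lambda>k. h (off + B + k) - 1)"
  have lenps: "length ps = length es" unfolding ps_def by simp
  have img_ps: "unordered ` set ps = (\<lambda>e. {f e, g e}) ` set es"
    unfolding ps_def set_map image_image by simp
  have ks_ps: "ks = concat (map (\<lambda>(u, v). [u, v]) ps)" unfolding ks_def ps_def by (rule endpoints_eq)
  have set_ks: "set ks = \<Union> (unordered ` set ps)" unfolding ks_ps by (rule set_concat_map_pair)
  note num' = num[unfolded numbering_def, folded ks_def v0_def]
  have r27: "r 27 = 2 * length es" and r28: "r 28 = v0" using num' ks_def by auto
  have img: "(\<lambda>k. h (off + B + k)) ` set ks = {1..v0}" and
    inj: "inj_on (\<lambda>k. h (off + B + k)) (set ks)" using num' by auto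
  have pos: "h (off + B + k) \<ge> 1" if "k \<in> set ks" for k
    using imageI[OF that, of "\<lambda>k. h (off + B + k)"] img by simp
  have inj': "inj_on \<phi> (set ks)"
  proof (rule inj_onI)
    fix x y assume xy: "x \<in> set ks" "y \<in> set ks" "\<phi> x = \<phi> y"
    then have "h (off + B + x) = h (off + B + y)" using pos[of x] pos[of y] unfolding \<phi>_def by simp
    then show "x = y" using inj_onD[OF inj _ xy(1,2)] by simp
  qed
  have img': "\<phi> ` set ks = {..<v0}"
  proof -
    have "\<phi> ` set ks = (\<lambda>x. x - 1) ` (\<lambda>k. h (off + B + k)) ` set ks"
      unfolding \<phi>_def image_image by simp
    also have "\<dots> = (\<lambda>x. x - 1) ` {1..v0}" unfolding img by simp
    also have "\<dots> = {..<v0}"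
    proof (intro set_eqI iffI)
      fix x assume "x \<in> {..<v0}"
      then have "Suc x \<in> {1..v0}" "x = Suc x - 1" by auto
      then show "x \<in> (\<lambda>x. x - 1) ` {1..v0}" by (metis imageI)
    qed auto
    finally show ?thesis .
  qed
  let ?n = "v0 + 2 * (m - length ps)"
  let ?xs = "encode_graph ?n (padded_edges \<phi> ps v0 m)"
  have xs: "?xs = ?n # m # map \<phi> ks @ [v0..<?n]"
    unfolding ks_ps using len lenps by (subst encode_padded_edges) simp_all
  have "\<exists>ys. (m, ?xs, {ys}) \<in> EdgeTriangleDetection \<and> length ys = m \<and>
    (\<forall>i<length ps. ys ! i = (if covered (unordered ` set ps) (fst (ps ! i)) (snd (ps ! i)) then 1 else 0))"
  proof (rule padded_instance)
    show "distinct (map unordered ps)" using dist unfolding ps_def by (simp add: comp_def)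
    show "a \<noteq> b" if "(a, b) \<in> set ps" for a b using that loopfree unfolding ps_def by auto
    show "inj_on \<phi> (\<Union> (unordered ` set ps))" using inj' unfolding set_ks .
    show "\<phi> ` \<Union> (unordered ` set ps) = {..<v0}" using img' unfolding set_ks .
    show "length ps \<le> m" using len lenps by simp
  qed
  then obtain ys where ys: "(m, ?xs, {ys}) \<in> EdgeTriangleDetection" "length ys = m"
    "\<And>i. i < length ps \<Longrightarrow>
      ys ! i = (if covered (unordered ` set ps) (fst (ps ! i)) (snd (ps ! i)) then 1 else 0)"
    by blast
  have len_ks: "length ks = 2 * length es" unfolding ks_def by simp
  have len_xs: "length ?xs = 2 * m + 2" unfolding xs using len lenps len_ks by simp
  have "h' (off + a) = snd (init_state ?xs) a" if a: "a < B" for a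
  proof -
    consider "a = 0" | "a = 1" | "a = 2" | i where "a = 3 + i" "i < length ks"
      | i where "a = 3 + i" "length ks \<le> i" "i < 2 * m" | "2 * m + 3 \<le> a"
    proof -
      have "a = 0 \<or> a = 1 \<or> a = 2 \<or> a = 3 + (a - 3)" by linarith
      then show thesis using that by (metis add.commute leI not_less add_le_cancel_left)
    qed
    then show ?thesis
    proof cases
      case 1
      then show ?thesis using h' len_xs by (simp add: snd_init_state)
    next
      case 2
      then have "snd (init_state ?xs) a = ?n" using len_xs by (simp add: snd_init_state) (simp add: xs)
      moreover have "h' (off + a) = v0 + (2 * m - 2 * length ps)" using 2 h' r27 r28 lenps by simp
      ultimately show ?thesis by (simp add: right_diff_distrib')
    next
      case 3
      then have "snd (init_state ?xs) a = m"
        using len_xs by (simp add: snd_init_state) (simp add: xs)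
      then show ?thesis using 3 h' by simp
    next
      case (4 i)
      have "h' (off + a) = h (off + 3 + i)" using 4 h' r27 len_ks by (simp add: add.assoc)
      moreover have "Suc (h (off + 3 + i)) = h (off + B + ks ! i)" using 4 num' by blast
      then have "h (off + 3 + i) = \<phi> (ks ! i)" unfolding \<phi>_def by simp
      moreover have "snd (init_state ?xs) a = (length ?xs # ?xs) ! a"
        using 4 len_xs len_ks len by (simp add: snd_init_state)
      moreover have "(length ?xs # ?xs) ! a = map \<phi> ks ! i"
        using 4 by (simp only: xs) (simp add: nth_append numeral_3_eq_3)
      ultimately show ?thesis using 4 by simp
    next
      case (5 i)
      have "h' (off + a) = v0 + (i - length ks)"
        using 5 h' r27 r28 len_ks by (simp add: add.assoc)
      moreover have "snd (init_state ?xs) a = (length ?xs # ?xs) ! a"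
        using 5 len_xs by (simp add: snd_init_state)
      moreover have "(length ?xs # ?xs) ! a = [v0..<?n] ! (i - length ks)"
        using 5 by (simp only: xs) (simp add: nth_append numeral_3_eq_3)
      moreover have "v0 + (i - length ks) < ?n" using 5 len_ks lenps len by linarith
      ultimately show ?thesis by simp
    next
      case 6
      have "h' (off + a) = h (off + a)" using 6 h' by simp
      also have "\<dots> = 0" using num' a 6 len_ks len by simp
      finally show ?thesis using 6 len_xs by (simp add: snd_init_state)
    qed
  qed
  moreover have "ys ! i = (if covered ((\<lambda>e. {f e, g e}) ` set es) (f (es ! i)) (g (es ! i)) then 1 else 0)"
    if "i < length es" for i
    using ys(3)[of i] that lenps unfolding img_ps by (simp add: ps_def)
  ultimately show ?thesis using ys(1,2) by blast
qed

section \<open>Reading the answers of one call\<close>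

lemma selected_nth:
  assumes "j < N" "j div s \<in> chunks k"
  shows "length (selected s j k) < length (selected s N k)"
    "selected s N k ! length (selected s j k) = j"
proof -
  have "[0..<N] = [0..<j] @ j # [Suc j..<N]"
    using upt_add_eq_append[of 0 j "N - j"] assms(1) by (simp add: upt_conv_Cons)
  then have "selected s N k = selected s j k @ j # filter (\<lambda>e. e div s \<in> chunks k) [Suc j..<N]"
    using assms(2) unfolding selected_def by simp
  then show "length (selected s j k) < length (selected s N k)"
    "selected s N k ! length (selected s j k) = j" by simp_all
qed

text \<open>The position of an edge in the call is the number of selected edges before it. Repeating
  the scan with a counter recovers this position, so no list of the selected edges is stored.
  Results are only ever set to 1, which forms the disjunction over all calls.\<close>

definition collect_prog :: prog where
  "collect_prog = For 26 19 (if_selected (Op 27 Add 27 1 ;; Op 31 Add 16 27 ;; Load 32 31 ;;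
     Branch (Equal 32 1) (Op 31 Add 13 26 ;; Store 31 1) Skip))"

lemma writes_collect_prog: "writes collect_prog = {26, 27, 30, 31, 32}"
  unfolding collect_prog_def writes_For writes_if_selected by auto

context ram
begin

lemma runs_collect_prog:
  assumes c: "const_regs r" and N: "r 19 = N" "N \<le> 4 * m" and ch: "{r 23, r 24, r 25} = chunks k"
    and off: "r 16 = off" "b0 \<le> off" "off + 2 * B \<le> 2 ^ w" and cnt: "r 27 = 0"
    and bits: "\<And>i. i < length (selected (m div 3) N k) \<Longrightarrow>
      h (off + Suc i) = (if C (selected (m div 3) N k ! i) then 1 else 0)"
  shows "runs w collect_prog r h (N * 13 + 2)
    (\<lambda>r' h'. h' = (\<lambda>a. if bR \<le> a \<and> a < bR + N \<and> a - bR \<in> set (selected (m div 3) N k) \<and> C (a - bR)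
      then 1 else h a))"
proof -
  let ?body = "Op 27 Add 27 1 ;; Op 31 Add 16 27 ;; Load 32 31 ;; Branch (Equal 32 1) (Op 31 Add 13 26
    ;; Store 31 1) Skip"
  let ?sel = "\<lambda>j. selected (m div 3) j k"
  define G where "G = (\<lambda>j a. if bR \<le> a \<and> a < bR + j \<and> a - bR \<in> set (?sel N) \<and> C (a - bR) then 1 else h a)"
  let ?I = "\<lambda>j r' h'. r' 27 = length (?sel j) \<and> h' = G j"
  note cD = const_regsD[OF c]
  have Nw: "N < 2 ^ w" using N(2) B_large off(3) by linarith
  have high: "G j (off + a) = h (off + a)" if "j \<le> N" for j a
    using that bases off N(2) B_large unfolding G_def by auto
  have mem_iff: "j \<in> set (?sel N) \<longleftrightarrow> j div (m div 3) \<in> chunks k" if "j < N" for j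
    using that unfolding selected_def by simp
  have "runs w collect_prog r h (N * 13 + 2) (?I (r 19))"
    unfolding collect_prog_def
  proof (rule runs_For[where T = 11])
    show "?I 0 (r(26 := 0)) h" using cnt unfolding G_def by (simp add: selected_def fun_eq_iff)
  next
    fix j r' h' assume j: "j < r 19" "r' 26 = j" and
      fr: "\<forall>x. x \<notin> insert 26 (writes (if_selected ?body)) \<longrightarrow> r' x = r x"
      and I: "?I j r' h'"
    have fr': "r' x = r x" if "x \<notin> {26, 27, 30, 31, 32}" for x
      using fr that by (auto simp: writes_if_selected)
    have c': "const_regs r'" by (rule const_regs_frame[OF c, of "{26, 27, 30, 31, 32}"]) (use fr' in auto)
    note cD' = const_regsD[OF c']
    have jN: "j < N" using j N by simp
    have o: "r' 16 = off" using fr' off by simp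
    have jw: "bR + j < 2 ^ w" "j div (m div 3) < 2 ^ w"
      using jN bases B_large N div_le_dividend[of j "m div 3"] by linarith+
    have sets: "{r' 23, r' 24, r' 25} = chunks k" using ch fr' by simp
    have G_Suc: "(G j)(bR + j := 1) = G (Suc j)" if "j \<in> set (?sel N)" "C j"
    proof
      fix a
      have "a = bR + j \<or> a \<noteq> bR + j \<and> (bR \<le> a \<and> a < bR + Suc j \<longleftrightarrow> bR \<le> a \<and> a < bR + j)" by auto
      then show "((G j)(bR + j := 1)) a = G (Suc j) a" using that unfolding G_def by auto
    qed
    have G_Suc': "G j = G (Suc j)" if "j \<notin> set (?sel N) \<or> \<not> C j"
    proof
      fix a
      have "a = bR + j \<or> a \<noteq> bR + j \<and> (bR \<le> a \<and> a < bR + Suc j \<longleftrightarrow> bR \<le> a \<and> a < bR + j)" by auto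
      then show "G j a = G (Suc j) a" using that unfolding G_def by auto
    qed
    show "runs w (if_selected ?body) r' h' 11
        (\<lambda>r'' h''. ?I (Suc j) (r''(26 := Suc j)) h'')"
    proof (rule runs_mono[OF runs_if_selected[where T = 7]])
      show "r' 26 div r' 7 < 2 ^ w" using j(2) cD' jw by simp
    next
      assume "r' 26 div r' 7 \<in> {r' 23, r' 24, r' 25}"
      then have sel: "j div (m div 3) \<in> chunks k" using sets j(2) cD' by simp
      let ?r = "r'(30 := r' 26 div r' 7)"
      let ?l = "length (?sel j)"
      note nth = selected_nth[OF jN sel]
      have jmem: "j \<in> set (?sel N)" using mem_iff jN sel by simp
      have lw: "off + Suc ?l < 2 ^ w" "Suc ?l < 2 ^ w"
        using length_selected_le[of j k] off B_large by linarith+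
      have w1: "Suc 0 < 2 ^ w" using lw by linarith
      have bit: "G j (off + Suc ?l) = (if C j then 1 else 0)"
        using high[of j "Suc ?l"] bits[OF nth(1)] nth(2) jN by simp
      have sS: "length (?sel (Suc j)) = Suc ?l" using sel by (simp add: selected_Suc)
      show "runs w ?body ?r h' 7
          (\<lambda>r'' h''. ?I (Suc j) (r''(26 := Suc j)) h'')"
      proof (cases "C j")
        case True
        then show ?thesis using bit lw jw w1 cD' o I j(2) G_Suc[OF jmem True] sS
          by (intro runs_wp) (simp_all del: fun_upd_apply add: fun_upd_same fun_upd_other)
      next
        case False
        then show ?thesis using bit lw jw cD' o I j(2) G_Suc' sS
          by (intro runs_wp) simp_all
      qed
    next
      assume "r' 26 div r' 7 \<notin> {r' 23, r' 24, r' 25}"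
      then have "j div (m div 3) \<notin> chunks k" using sets j(2) cD' by simp
      then have "?sel (Suc j) = ?sel j" "G j = G (Suc j)"
        using G_Suc' mem_iff[OF jN] by (simp_all add: selected_Suc)
      then show "?I (Suc j) ((r'(30 := r' 26 div r' 7))(26 := Suc j)) h'"
        using I by simp
    qed simp_all
  qed (use cD N Nw in \<open>simp_all add: writes_if_selected\<close>)
  then show ?thesis by (rule runs_mono) (use N in \<open>simp_all add: G_def\<close>)
qed

end

text \<open>Since \<open>m\<close> is fixed, \<open>F\<close> is a single number bounding the time
  of every call. The bound \<open>2 ^ wl <= B\<close> says that one region holds every cell the
  detection program can address.\<close>

locale edge_detector = ram +
  fixes p :: prog and wl R F :: nat
  assumes regs_p: "regs p \<subseteq> {..<R}" and wl: "2 ^ wl \<le> B"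
    and detects: "\<And>xs ys. (m, xs, {ys}) \<in> EdgeTriangleDetection \<Longrightarrow>
      \<exists>t s. exec wl p (init_state xs) t s \<and> t \<le> F \<and> has_output s ys"
begin

definition prelude :: prog where
  "prelude = Op 23 Mod 20 21 ;; Op 24 Div 20 21 ;; Op 25 Div 24 21 ;; Op 24 Mod 24 21 ;;
    Op 32 Add 16 6 ;; Const 27 0 ;; Const 28 0"

text \<open>The offset advances by \<open>2 * B\<close> at the end: \<open>B\<close> cells of
  simulated memory and \<open>B\<close> cells for the numbering table, both abandoned after the
  call.\<close>

definition call_prog :: prog where
  "call_prog = prelude ;; build_prog ;; pad_prog ;; zero_regs R ;; embed p ;; Const 27 0 ;;
     collect_prog ;; Op 16 Add 16 6 ;; Op 16 Add 16 6"

lemma writes_call_prog: "x \<notin> {16, 23, 24, 25, 26, 27, 28, 30, 31, 32, 33, 34, 40} \<Longrightarrow> x < 50 \<Longrightarrow> x \<notin> writes call_prog"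
  unfolding call_prog_def prelude_def
  by (simp add: writes_build_prog writes_pad_prog writes_zero_regs writes_embed writes_collect_prog)

definition hits :: "(nat \<Rightarrow> nat) \<Rightarrow> (nat \<Rightarrow> nat) \<Rightarrow> nat \<Rightarrow> nat \<Rightarrow> nat \<Rightarrow> bool" where
  "hits f g N k e \<longleftrightarrow> e \<in> set (selected (m div 3) N k) \<and>
     covered ((\<lambda>e. {f e, g e}) ` set (selected (m div 3) N k)) (f e) (g e)"

lemma runs_prelude:
  assumes "r 20 = k" "r 21 = c" "r 16 = off" "r 6 = B"
    and "k mod c < 2 ^ w" "k div c < 2 ^ w" "k div c mod c < 2 ^ w" "k div c div c < 2 ^ w"
      "off + B < 2 ^ w"
  shows "runs w prelude r h 7 (\<lambda>r' h'. r' 23 = k mod c \<and> r' 24 = k div c mod c \<and>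
    r' 25 = k div c div c \<and> r' 32 = off + B \<and> r' 27 = 0 \<and> r' 28 = 0 \<and> h' = h)"
  unfolding prelude_def by (rule runs_wp) (simp_all add: assms)

lemma chunks_regs:
  assumes "k < 8000"
  shows "{k mod 20, k div 20 mod 20, k div 20 div 20} = chunks k"
  unfolding chunks_def by (simp add: div_mult2_eq[symmetric])

text \<open>Nothing is claimed about the cells from \<open>off\<close> to
  \<open>off + 2 * B\<close>, which contain what the call left behind. Zeros from
  \<open>off + 2 * B\<close> on are the precondition of the next call.\<close>

lemma runs_call_prog:
  assumes c: "const_regs r" and N: "r 19 = N" "N \<le> 4 * m" and k: "r 20 = k" "k < 8000"
    and off: "r 16 = off" "b0 \<le> off" "off + 2 * B < 2 ^ w" and z: "\<And>a. off \<le> a \<Longrightarrow> h a = 0"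
    and f: "\<And>e. e < N \<Longrightarrow> h (bK + e) = f e \<and> f e < B"
    and g: "\<And>e. e < N \<Longrightarrow> h (bL + e) = g e \<and> g e < B"
    and loopfree: "\<And>e. e < N \<Longrightarrow> f e \<noteq> g e" and inj: "inj_on (\<lambda>e. {f e, g e}) {..<N}"
  shows "runs w call_prog r h (250 * m + 2 * F + R + 50) (\<lambda>r' h'. r' 16 = off + 2 * B \<and>
    (\<forall>a \<ge> off + 2 * B. h' a = 0) \<and>
    (\<forall>a < off. h' a = (if bR \<le> a \<and> a < bR + N \<and> hits f g N k (a - bR) then 1 else h a)))"
proof -
  note cD = const_regsD[OF c]
  let ?sel = "selected (m div 3) N k"
  let ?C = "\<lambda>e. covered ((\<lambda>e. {f e, g e}) ` set ?sel) (f e) (g e)"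
  have kw: "k mod 20 < 2 ^ w" "k div 20 < 2 ^ w" "k div 20 mod 20 < 2 ^ w" "k div 20 div 20 < 2 ^ w"
      "off + B < 2 ^ w" "off + B + B < 2 ^ w" "0 < B"
    using k(2) B_large off(3) m3 mod_less_eq_dividend[of k 20] div_le_dividend[of k 20]
      mod_less_eq_dividend[of "k div 20" 20] div_le_dividend[of "k div 20" 20] by linarith+
  have off': "off + 2 * B \<le> 2 ^ w" using off(3) by simp
  have sel_sub: "set ?sel \<subseteq> {..<N}" unfolding selected_def by auto
  have dist: "distinct (map (\<lambda>e. {f e, g e}) ?sel)"
    by (subst distinct_map) (use inj_on_subset[OF inj sel_sub] in \<open>simp add: selected_def\<close>)
  let ?Q1 = "\<lambda>r' h'. r' 23 = k mod 20 \<and> r' 24 = k div 20 mod 20 \<and> r' 25 = k div 20 div 20 \<and>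
    r' 32 = off + B \<and> r' 27 = 0 \<and> r' 28 = 0 \<and> h' = h"
  have 1: "runs w prelude r h 7 ?Q1"
    by (rule runs_prelude[OF k(1) cD(18) off(1) cD(8) kw(1-5)])
  show ?thesis
    unfolding call_prog_def
  proof (rule runs_Seq[OF 1])
    fix r1 h1 assume Q1: "?Q1 r1 h1" and fr: "\<forall>x. x \<notin> writes prelude \<longrightarrow> r1 x = r x"
    have fr1: "r1 x = r x" if "x \<notin> {23, 24, 25, 27, 28, 32}" for x
      using fr that unfolding prelude_def by simp
    have c1: "const_regs r1" by (rule const_regs_frame[OF c, of "{23, 24, 25, 27, 28, 32}"]) (use fr1 in auto)
    have h1: "h1 = h" using Q1 by simp
    have 2: "runs w build_prog r1 h1 (N * 40 + 2) (numbering B off (endpoints f g ?sel) h)"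
      unfolding h1
      by (rule runs_build_prog[OF c1, where off = off])
        (use Q1 fr1 N off off' z f g chunks_regs[OF k(2)] in simp_all)
    show "runs w (build_prog ;; pad_prog ;; zero_regs R ;; embed p ;; Const 27 0 ;;
       collect_prog ;; Op 16 Add 16 6 ;; Op 16 Add 16 6) r1 h1 (250 * m + 2 * F + R + 43)
       (\<lambda>r' h'. r' 16 = off + 2 * B \<and> (\<forall>a \<ge> off + 2 * B. h' a = 0) \<and>
        (\<forall>a < off. h' a = (if bR \<le> a \<and> a < bR + N \<and> hits f g N k (a - bR) then 1 else h a)))"
      (is "runs w _ _ _ _ ?Q")
    proof (rule runs_Seq[OF 2])
      fix r2 h2 assume num: "numbering B off (endpoints f g ?sel) h r2 h2"
        and fr: "\<forall>x. x \<notin> writes build_prog \<longrightarrow> r2 x = r1 x"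
      have fr2: "r2 x = r1 x" if "x \<notin> {26, 27, 28, 30, 31, 33, 34}" for x
        using fr that unfolding writes_build_prog by simp
      have c2: "const_regs r2" by (rule const_regs_frame[OF c1, of "{26, 27, 28, 30, 31, 33, 34}"]) (use fr2 in auto)
      have r27: "r2 27 = 2 * length ?sel" "r2 28 \<le> 2 * length ?sel"
        using num card_length[of "endpoints f g ?sel"] unfolding numbering_def by simp_all
      have r27': "r2 27 \<le> 2 * m" "r2 28 \<le> 2 * m" using r27 length_selected_le[of N k] by linarith+
      have o2: "r2 16 = off" using fr2 fr1 off by simp
      let ?h3 = "\<lambda>a. if a = off then 2 * m + 2 else if a = off + 1 then r2 28 + (2 * m - r2 27)
          else if a = off + 2 then m
          else if off + 3 + r2 27 \<le> a \<and> a < off + 3 + 2 * m then r2 28 + (a - (off + 3 + r2 27)) else h2 a"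
      have 3: "runs w pad_prog r2 h2 (m * 20 + 10) (\<lambda>r' h'. h' = ?h3)"
        by (rule runs_pad_prog[OF c2 o2 off' refl r27'(1) refl r27'(2)])
      have "\<exists>xs ys. (m, xs, {ys}) \<in> EdgeTriangleDetection \<and> length ys = m \<and>
          (\<forall>a<B. ?h3 (off + a) = snd (init_state xs) a) \<and>
          (\<forall>i<length ?sel. ys ! i = (if ?C (?sel ! i) then 1 else 0))"
        by (rule instance_in_memory[OF num length_selected_le _ dist _ refl])
          (use B_large loopfree sel_sub in auto)
      then obtain xs ys where xs: "(m, xs, {ys}) \<in> EdgeTriangleDetection" "length ys = m"
        "\<forall>a<B. ?h3 (off + a) = snd (init_state xs) a"
        "\<forall>i<length ?sel. ys ! i = (if ?C (?sel ! i) then 1 else 0)" by blast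
      have h2_out: "h2 a = h a" if "a < off \<or> off + 2 * B \<le> a" for a
        using num that unfolding numbering_def by blast
      have h3_out: "?h3 a = h a" if "a < off \<or> off + 2 * B \<le> a" for a
        using h2_out[OF that] that B_large m3 by auto
      show "runs w (pad_prog ;; zero_regs R ;; embed p ;; Const 27 0 ;;
         collect_prog ;; Op 16 Add 16 6 ;; Op 16 Add 16 6) r2 h2 (80 * m + 2 * F + R + 30) ?Q"
      proof (rule runs_Seq[OF 3])
        fix r3 h3 assume h3: "h3 = ?h3" and fr: "\<forall>x. x \<notin> writes pad_prog \<longrightarrow> r3 x = r2 x"
        have fr3: "r3 x = r2 x" if "x \<notin> {27, 28, 34}" for x
          using fr that unfolding writes_pad_prog by simp
        have xs3: "\<forall>a<B. h3 (off + a) = snd (init_state xs) a" using xs(3) h3 by simp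
        have h3_out': "h3 a = h a" if "a < off \<or> off + 2 * B \<le> a" for a
          using h3_out[OF that] h3 by simp
        show "runs w (zero_regs R ;; embed p ;; Const 27 0 ;;
           collect_prog ;; Op 16 Add 16 6 ;; Op 16 Add 16 6) r3 h3 (52 * m + 2 * F + R + 15) ?Q"
        proof (rule runs_Seq[OF runs_zero_regs])
          fix r4 h4 assume Q4: "h4 = h3 \<and> (\<forall>x<R. r4 (x + 50) = 0)"
            and fr: "\<forall>x. x \<notin> writes (zero_regs R) \<longrightarrow> r4 x = r3 x"
          have fr4: "r4 x = r3 x" if "x < 50" for x using fr writes_zero_regs that by blast
          have o4: "r4 16 = off" using fr4 fr3 o2 by simp
          have sim: "simulates wl R B off (init_state xs) r4 h4"
            unfolding simulates_def using Q4 o4 xs3 by (simp add: init_state_def)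
          obtain t s where s: "exec wl p (init_state xs) t s" "t \<le> F" "has_output s ys"
            using detects[OF xs(1)] by blast
          have offB: "off + B \<le> 2 ^ w" using off(3) by linarith
          note emb = embed_simulates[OF s(1) regs_p wl offB sim]
          show "runs w (embed p ;; Const 27 0 ;;
             collect_prog ;; Op 16 Add 16 6 ;; Op 16 Add 16 6) r4 h4 (52 * m + 2 * F + 14) ?Q"
          proof (rule runs_Seq[OF emb])
            fix r5 h5 assume Q5: "simulates wl R B off s r5 h5 \<and>
                (\<forall>a. a < off \<or> off + B \<le> a \<longrightarrow> h5 a = h4 a)"
              and fr: "\<forall>x. x \<notin> writes (embed p) \<longrightarrow> r5 x = r4 x"
            have fr5: "r5 x = r4 x" if "x < 50" "x \<noteq> 40" for x using fr writes_embed that by blast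
            have frall: "r5 x = r x" if "x < 50" "x \<notin> {23, 24, 25, 26, 27, 28, 30, 31, 32, 33, 34, 40}" for x
              using that by (simp add: fr5 fr4 fr3 fr2 fr1)
            have c5: "const_regs r5"
              by (rule const_regs_frame[OF c, of "{23, 24, 25, 26, 27, 28, 30, 31, 32, 33, 34, 40} \<union> {50..}"])
                (use frall in auto)
            have ch5: "{r5 23, r5 24, r5 25} = chunks k"
              using chunks_regs[OF k(2)] Q1 by (simp add: fr5 fr4 fr3 fr2)
            have bits5: "h5 (off + Suc i) = (if ?C (?sel ! i) then 1 else 0)" if i: "i < length ?sel" for i
            proof -
              have im: "i < m" "Suc i < B" using i length_selected_le[of N k] B_large by linarith+
              have "h5 (off + Suc i) = snd s (Suc i)" using Q5 im unfolding simulates_def by blast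
              also have "\<dots> = ys ! i" using s(3) im xs(2) unfolding has_output_def by auto
              finally show ?thesis using xs(4) i by simp
            qed
            have h5_out: "h5 a = h a" if "a < off \<or> off + 2 * B \<le> a" for a
              using Q5 Q4 h3_out'[OF that] that by auto
            show "runs w (Const 27 0 ;; collect_prog ;; Op 16 Add 16 6 ;; Op 16 Add 16 6) r5 h5
               (52 * m + 14) ?Q"
            proof (rule runs_Seq)
              show "runs w (Const 27 0) r5 h5 1 (\<lambda>r' h'. r' = r5(27 := 0) \<and> h' = h5)"
                by (rule runs_wp) simp_all
            next
              fix r6 h6 assume "r6 = r5(27 := 0) \<and> h6 = h5"
              then have r6: "r6 = r5(27 := 0)" "h6 = h5" by auto
              let ?h7 = "\<lambda>a. if bR \<le> a \<and> a < bR + N \<and> a - bR \<in> set ?sel \<and> ?C (a - bR) then 1 else h5 a"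
              have c6: "const_regs (r5(27 := 0))"
                by (rule const_regs_frame[OF c5, of "{27}"]) auto
              have 7: "runs w collect_prog r6 h6 (N * 13 + 2) (\<lambda>r' h'. h' = ?h7)"
                unfolding r6
                by (rule runs_collect_prog[OF c6, where off = off])
                  (use N off off' bits5 ch5 in \<open>simp_all add: frall\<close>)
              show "runs w (collect_prog ;; Op 16 Add 16 6 ;; Op 16 Add 16 6) r6 h6 (52 * m + 13) ?Q"
              proof (rule runs_Seq[OF 7])
                fix r7 h7 assume h7: "h7 = ?h7" and fr: "\<forall>x. x \<notin> writes collect_prog \<longrightarrow> r7 x = r6 x"
                have r7: "r7 16 = off" "r7 6 = B"
                  using fr unfolding writes_collect_prog r6 using frall off cD by simp_all
                have low: "\<forall>a < off. h7 a =
                    (if bR \<le> a \<and> a < bR + N \<and> hits f g N k (a - bR) then 1 else h a)"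
                  unfolding hits_def h7 using h5_out by simp
                have high: "\<forall>a \<ge> off + 2 * B. h7 a = 0"
                proof (intro allI impI)
                  fix a assume a: "off + 2 * B \<le> a"
                  then have "\<not> a < bR + N" using bases off N(2) B_large by linarith
                  then show "h7 a = 0" unfolding h7 using h5_out[of a] a z[of a] by simp
                qed
                show "runs w (Op 16 Add 16 6 ;; Op 16 Add 16 6) r7 h7 2 ?Q"
                  by (rule runs_wp) (use r7 kw low high in simp_all)
              qed (use N in linarith)
            qed linarith
          qed (use s in linarith)
        qed linarith
      qed linarith
    qed (use N in linarith)
  qed linarith
qed

text \<open>Unlike the call regions, the result array is reused in every round, so it is reset
  before results accumulate. The 8000 calls consume \<open>16000 * B\<close> cells.\<close>

definition detect_prog :: prog where
  "detect_prog = For 26 19 (Op 31 Add 13 26 ;; Store 31 0) ;; For 20 22 call_prog"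

lemma writes_detect_prog:
  "x \<notin> {16, 20, 23, 24, 25, 26, 27, 28, 30, 31, 32, 33, 34, 40} \<Longrightarrow> x < 50 \<Longrightarrow> x \<notin> writes detect_prog"
  unfolding detect_prog_def by (simp add: writes_call_prog)

lemma runs_detect_prog:
  assumes c: "const_regs r" and N: "r 19 = N" "N \<le> 4 * m"
    and off: "r 16 = off" "b0 \<le> off" "off + 16000 * B < 2 ^ w" and z: "\<And>a. off \<le> a \<Longrightarrow> h a = 0"
    and f: "\<And>e. e < N \<Longrightarrow> h (bK + e) = f e \<and> f e < B"
    and g: "\<And>e. e < N \<Longrightarrow> h (bL + e) = g e \<and> g e < B"
    and loopfree: "\<And>e. e < N \<Longrightarrow> f e \<noteq> g e" and inj: "inj_on (\<lambda>e. {f e, g e}) {..<N}"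
  shows "runs w detect_prog r h (8000 * (251 * m + 2 * F + R + 60)) (\<lambda>r' h'.
    r' 16 = off + 16000 * B \<and> (\<forall>a \<ge> off + 16000 * B. h' a = 0) \<and>
    (\<forall>a < b0. h' a = (if bR \<le> a \<and> a < bR + N then
       (if covered ((\<lambda>e. {f e, g e}) ` {..<N}) (f (a - bR)) (g (a - bR)) then 1 else 0) else h a)))"
proof -
  note cD = const_regsD[OF c]
  have NB: "N < B" "bR + B \<le> b0" using N(2) B_large bases by linarith+
  have Nw: "N < 2 ^ w" "(8000::nat) < 2 ^ w" using N(2) B_large off(3) by linarith+
  let ?h1 = "\<lambda>j a. if bR \<le> a \<and> a < bR + j then 0 else h a"
  have 1: "runs w (For 26 19 (Op 31 Add 13 26 ;; Store 31 0)) r h (N * 4 + 2) (\<lambda>r' h'. h' = ?h1 (r 19))"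
  proof (rule runs_For[where T = 2])
    fix j r' h' assume j: "j < r 19" "r' 26 = j" and
      fr: "\<forall>x. x \<notin> insert 26 (writes (Op 31 Add 13 26 ;; Store 31 0)) \<longrightarrow> r' x = r x"
      and I: "h' = ?h1 j"
    have jw: "bR + j < 2 ^ w" using j N NB bases by linarith
    have eq: "(?h1 j)(bR + j := 0) = ?h1 (Suc j)" by (auto simp: fun_eq_iff)
    have r': "r' 13 = bR" "r' 0 = 0" using fr cD by simp_all
    show "runs w (Op 31 Add 13 26 ;; Store 31 0) r' h' 2
        (\<lambda>r'' h''. h'' = ?h1 (Suc j))"
      by (rule runs_wp) (use j r' I jw eq in \<open>simp_all del: fun_upd_apply add: fun_upd_same fun_upd_other\<close>)
  qed (use cD N Nw in \<open>simp_all add: fun_eq_iff\<close>)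
  let ?J = "\<lambda>k r' h'. r' 16 = off + 2 * B * k \<and> (\<forall>a \<ge> off + 2 * B * k. h' a = 0) \<and>
    (\<forall>a < b0. h' a = (if bR \<le> a \<and> a < bR + N then
       (if \<exists>i<k. hits f g N i (a - bR) then 1 else 0) else h a))"
  show ?thesis
    unfolding detect_prog_def
  proof (rule runs_Seq[OF 1])
    fix r1 h1 assume h1: "h1 = ?h1 (r 19)" and
      fr: "\<forall>x. x \<notin> writes (For 26 19 (Op 31 Add 13 26 ;; Store 31 0)) \<longrightarrow> r1 x = r x"
    have fr1: "r1 x = r x" if "x \<notin> {26, 31}" for x using fr that by simp
    have c1: "const_regs r1" by (rule const_regs_frame[OF c, of "{26, 31}"]) (use fr1 in auto)
    note c1D = const_regsD[OF c1]
    have "runs w (For 20 22 call_prog) r1 h1 (8000 * (250 * m + 2 * F + R + 52) + 2) (?J (r1 22))"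
    proof (rule runs_For[where T = "250 * m + 2 * F + R + 50"])
      show "?J 0 (r1(20 := 0)) h1"
        using fr1 off N z h1 NB by (simp add: trans_le_add1 not_less)
    next
      fix k r2 h2 assume k: "k < r1 22" "r2 20 = k" and
        fr: "\<forall>x. x \<notin> insert 20 (writes call_prog) \<longrightarrow> r2 x = r1 x" and J: "?J k r2 h2"
      let ?W = "{16, 20, 23, 24, 25, 26, 27, 28, 30, 31, 32, 33, 34, 40}"
      have fr2: "r2 x = r1 x" if "x \<notin> ?W" "x < 50" for x
        using fr that writes_call_prog[of x] by simp
      have c2: "const_regs r2" by (rule const_regs_frame[OF c1, of "?W \<union> {50..}"]) (use fr2 in auto)
      have k8: "k < 8000" using k c1D by simp
      have "2 * B * (k + 1) \<le> 2 * B * 8000" using k8 by (intro mult_le_mono2) simp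
      moreover have "2 * B * (k + 1) = 2 * B * k + 2 * B" by simp
      ultimately have offk: "off + 2 * B * k + 2 * B < 2 ^ w" using off(3) by linarith
      have low: "h2 a = h a" if "a < b0" "\<not> (bR \<le> a \<and> a < bR + N)" for a
      proof -
        have "h2 a = (if bR \<le> a \<and> a < bR + N then
          (if \<exists>i<k. hits f g N i (a - bR) then 1 else 0) else h a)" using J that(1) by blast
        then show ?thesis unfolding if_not_P[OF that(2)] .
      qed
      have fe: "h2 (bK + e) = f e \<and> f e < B" if "e < N" for e
        using low[of "bK + e"] f[OF that] that NB bases by simp
      have ge: "h2 (bL + e) = g e \<and> g e < B" if "e < N" for e
        using low[of "bL + e"] g[OF that] that NB bases by simp
      have N2: "r2 19 = N" using fr2 fr1 N by simp
      have "runs w call_prog r2 h2 (250 * m + 2 * F + R + 50) (\<lambda>r' h'. r' 16 = off + 2 * B * k + 2 * B \<and>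
        (\<forall>a \<ge> off + 2 * B * k + 2 * B. h' a = 0) \<and>
        (\<forall>a < off + 2 * B * k. h' a = (if bR \<le> a \<and> a < bR + N \<and> hits f g N k (a - bR) then 1 else h2 a)))"
        by (rule runs_call_prog[OF c2 N2 N(2) k(2) k8 _ _ offk _ fe ge loopfree inj])
          (use J off in auto)
      then show "runs w call_prog r2 h2 (250 * m + 2 * F + R + 50) (\<lambda>r'' h''. ?J (Suc k) (r''(20 := Suc k)) h'')"
      proof (rule runs_mono)
        fix r3 h3 :: "nat \<Rightarrow> nat"
        assume Q: "r3 16 = off + 2 * B * k + 2 * B \<and>
          (\<forall>a \<ge> off + 2 * B * k + 2 * B. h3 a = 0) \<and>
          (\<forall>a < off + 2 * B * k. h3 a = (if bR \<le> a \<and> a < bR + N \<and> hits f g N k (a - bR) then 1 else h2 a))"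
        have eq: "off + 2 * B * Suc k = off + 2 * B * k + 2 * B" by simp
        have ex: "(\<exists>i<Suc k. hits f g N i e) \<longleftrightarrow> hits f g N k e \<or> (\<exists>i<k. hits f g N i e)" for e
          using less_Suc_eq by auto
        show "?J (Suc k) (r3(20 := Suc k)) h3"
        proof (intro conjI allI impI)
          show "(r3(20 := Suc k)) 16 = off + 2 * B * Suc k" using Q eq by simp
          show "h3 a = 0" if "off + 2 * B * Suc k \<le> a" for a using Q that unfolding eq by blast
          fix a assume a: "a < b0"
          then have "h3 a = (if bR \<le> a \<and> a < bR + N \<and> hits f g N k (a - bR) then 1 else h2 a)"
            using Q off(2) by simp
          moreover have "h2 a = (if bR \<le> a \<and> a < bR + N then
            (if \<exists>i<k. hits f g N i (a - bR) then 1 else 0) else h a)" using J a by blast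
          ultimately show "h3 a = (if bR \<le> a \<and> a < bR + N then
            (if \<exists>i<Suc k. hits f g N i (a - bR) then 1 else 0) else h a)"
            unfolding ex by (auto split: if_splits)
        qed
      qed simp
    qed (use c1D Nw in \<open>simp_all add: writes_call_prog\<close>)
    then show "runs w (For 20 22 call_prog) r1 h1 (8000 * (250 * m + 2 * F + R + 52) + 2) (\<lambda>r' h'.
    r' 16 = off + 16000 * B \<and> (\<forall>a \<ge> off + 16000 * B. h' a = 0) \<and>
    (\<forall>a < b0. h' a = (if bR \<le> a \<and> a < bR + N then
       (if covered ((\<lambda>e. {f e, g e}) ` {..<N}) (f (a - bR)) (g (a - bR)) then 1 else 0) else h a)))"
    proof (rule runs_mono)
      fix r' h' assume J: "?J (r1 22) r' h'"
      have "covered ((\<lambda>e. {f e, g e}) ` {..<N}) (f e) (g e) \<longleftrightarrow> (\<exists>i<8000. hits f g N i e)"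
        if "e < N" for e
        unfolding hits_def by (rule covered_iff_ex_selected[OF m3 N(2) that])
      then have "covered ((\<lambda>e. {f e, g e}) ` {..<N}) (f (a - bR)) (g (a - bR)) \<longleftrightarrow>
          (\<exists>i<8000. hits f g N i (a - bR))" if "bR \<le> a \<and> a < bR + N" for a
        using that by (simp add: less_diff_conv2)
      then show "r' 16 = off + 16000 * B \<and> (\<forall>a \<ge> off + 16000 * B. h' a = 0) \<and>
    (\<forall>a < b0. h' a = (if bR \<le> a \<and> a < bR + N then
       (if covered ((\<lambda>e. {f e, g e}) ` {..<N}) (f (a - bR)) (g (a - bR)) then 1 else 0) else h a))"
        using J c1D by simp
    qed simp
  qed (use N in simp)
qed

end

section \<open>Refining candidates\<close>

text \<open>
  The residue of \<open>c\<close> modulo 3 separates the three sides of a tripartite graph. The first two sides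
  contain pairs of a vertex \<open>x\<close> and a residue \<open>i < S\<close>, the third side contains the possible largest
  vertices of triangles.
\<close>

definition key :: "nat \<Rightarrow> nat \<Rightarrow> nat \<Rightarrow> nat \<Rightarrow> nat" where
  "key S x i c = 3 * (x * S + i) + c"

lemma key_mod: "c < 3 \<Longrightarrow> key S x i c mod 3 = c"
  unfolding key_def by (simp only: mod_mult_self4) simp

text \<open>An apex carries no residue, so it is the same vertex for the copies of edges on both
  other sides. This is what lets edges into different sides meet.\<close>

definition apex_key :: "nat \<Rightarrow> nat" where
  "apex_key x = 3 * x + 2"

lemma apex_key_mod: "apex_key x mod 3 = 2"
  unfolding apex_key_def by (simp only: mod_mult_self4) simp

lemma apex_key_inject: "apex_key x = apex_key y \<longleftrightarrow> x = y"
  unfolding apex_key_def by simp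

lemma key_inject:
  assumes "i < S" "i' < S"
  shows "key S x i c = key S x' i' c \<longleftrightarrow> x = x' \<and> i = i'"
proof
  assume "key S x i c = key S x' i' c"
  then have eq: "x * S + i = x' * S + i'" unfolding key_def by simp
  have "(x * S + i) div S = x" "(x' * S + i') div S = x'" using assms by simp_all
  then have "x = x'" using eq by simp
  then show "x = x' \<and> i = i'" using eq by simp
qed simp

text \<open>A pair of a vertex below \<open>2 * m\<close> and a residue below \<open>4 * m\<close>
  is coded below \<open>8 * m ^ 2\<close>, and tripling stays far below \<open>100 * m ^ 2\<close>.
  Intermediate products are included because an overflow anywhere makes the run fail.\<close>

lemma key_less:
  assumes "x < 2 * m" "i < 4 * m" "c \<le> 2" "m \<ge> (3::nat)"
  shows "key (4 * m) x i c < 100 * (m * m)" "x * (4 * m) < 100 * (m * m)" "x * (4 * m) + i < 100 * (m * m)"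
    "3 * (x * (4 * m) + i) < 100 * (m * m)"
proof -
  have "(x + 1) * (4 * m) \<le> (2 * m) * (4 * m)" using assms by (intro mult_le_mono1) simp
  then have 1: "x * (4 * m) + 4 * m \<le> 8 * (m * m)" by (simp add: algebra_simps)
  then have "3 * (x * (4 * m)) + 12 * m \<le> 24 * (m * m)" by linarith
  moreover have "0 < m * m" using assms(4) by simp
  ultimately show "key (4 * m) x i c < 100 * (m * m)" "x * (4 * m) < 100 * (m * m)"
    "x * (4 * m) + i < 100 * (m * m)" "3 * (x * (4 * m) + i) < 100 * (m * m)"
    unfolding key_def distrib_left using 1 assms by linarith+
qed

text \<open>
  The number \<open>j + m * i\<close> stands for the \<open>j\<close>-th edge, with endpoints \<open>u j < v j\<close>, and the residue \<open>i\<close>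
  modulo \<open>d\<close>. It closes if some triangle consists of this edge and a larger vertex congruent to \<open>i\<close>.
\<close>

definition closes :: "nat \<Rightarrow> (nat \<Rightarrow> nat) \<Rightarrow> (nat \<Rightarrow> nat) \<Rightarrow> nat \<Rightarrow> nat \<Rightarrow> bool" where
  "closes m u v d c \<longleftrightarrow> (\<exists>j1<m. \<exists>j2<m. u j1 = u (c mod m) \<and> u j2 = v (c mod m) \<and> v j1 = v j2 \<and>
     v j1 mod d = c div m)"

text \<open>The tripartite test graph of one round. It is instantiated with the doubled modulus as
  \<open>d\<close> and with the unfiltered refinements as \<open>xs\<close>.\<close>

locale items =
  fixes m n :: nat and u v :: "nat \<Rightarrow> nat" and d :: nat and xs :: "nat list"
  assumes edges: "\<And>j. j < m \<Longrightarrow> u j < v j \<and> v j < n"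
    and inj_edges: "inj_on (\<lambda>j. (u j, v j)) {..<m}"
    and d: "0 < d" "d \<le> 4 * m" and distinct_xs: "distinct xs" and xs_less: "\<And>c. c \<in> set xs \<Longrightarrow> c < m * d"
begin

abbreviation "S \<equiv> 4 * m"

text \<open>Items 0 to \<open>m - 1\<close> are the copies of edges at the first side, the next
  \<open>m\<close> those at the second side, and the rest are the queries, which join the first two
  sides. The multiplier \<open>S\<close> is independent of \<open>d\<close>, so one bound on keys
  serves all rounds.\<close>

definition fst_key :: "nat \<Rightarrow> nat" where
  "fst_key e = (if e < m then key S (u e) (v e mod d) 0
     else if e < 2 * m then key S (u (e - m)) (v (e - m) mod d) 1
     else key S (u (xs ! (e - 2 * m) mod m)) (xs ! (e - 2 * m) div m) 0)"

definition snd_key :: "nat \<Rightarrow> nat" where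
  "snd_key e = (if e < m then apex_key (v e)
     else if e < 2 * m then apex_key (v (e - m))
     else key S (v (xs ! (e - 2 * m) mod m)) (xs ! (e - 2 * m) div m) 1)"

lemma mod_d: "x mod d < S"
  using d mod_less_divisor[of d x] by linarith

lemma code_div: "c \<in> set xs \<Longrightarrow> c div m < S"
  using xs_less[of c] d by (metis less_le_trans less_mult_imp_div_less mult.commute)

lemma item_cases:
  assumes "e < 2 * m + length xs"
  obtains (fst) j where "j < m" "e = j" "fst_key e = key S (u j) (v j mod d) 0" "snd_key e = apex_key (v j)"
  | (snd) j where "j < m" "e = m + j" "fst_key e = key S (u j) (v j mod d) 1" "snd_key e = apex_key (v j)"
  | (query) q where "q < length xs" "e = 2 * m + q" "fst_key e = key S (u (xs ! q mod m)) (xs ! q div m) 0"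
      "snd_key e = key S (v (xs ! q mod m)) (xs ! q div m) 1"
proof -
  consider "e < m" | "m \<le> e" "e < 2 * m" | "2 * m \<le> e" by linarith
  then show thesis
  proof cases
    case 1
    then show ?thesis using fst[of e] by (simp add: fst_key_def snd_key_def)
  next
    case 2
    then show ?thesis using snd[of "e - m"] by (simp add: fst_key_def snd_key_def)
  next
    case 3
    then show ?thesis using query[of "e - 2 * m"] assms by (simp add: fst_key_def snd_key_def)
  qed
qed

lemma keys_distinct: "e < 2 * m + length xs \<Longrightarrow> fst_key e mod 3 \<noteq> snd_key e mod 3"
  by (erule item_cases) (simp_all add: key_mod apex_key_mod)

lemma code_eq: "c mod m = c' mod m \<Longrightarrow> c div m = c' div m \<Longrightarrow> c = (c'::nat)"
  by (metis div_mult_mod_eq)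

lemma code_mod: "c \<in> set xs \<Longrightarrow> c mod m < m"
  using xs_less[of c] by (metis mod_less_divisor mult_eq_0_iff neq0_conv not_less_zero)

lemma inj_edgesD: "j < m \<Longrightarrow> j' < m \<Longrightarrow> u j = u j' \<Longrightarrow> v j = v j' \<Longrightarrow> j = j'"
  using inj_edges by (auto dest: inj_onD)

text \<open>An encoded graph must list every edge once. The residues of the two keys reveal the kind
  of an item; within a kind, the keys determine the endpoints and the residue, hence the edge or the
  query.\<close>

lemma items_inj: "inj_on (\<lambda>e. {fst_key e, snd_key e}) {..<2 * m + length xs}"
proof (rule inj_onI)
  fix e e' assume e: "e \<in> {..<2 * m + length xs}" and e': "e' \<in> {..<2 * m + length xs}"
    and "{fst_key e, snd_key e} = {fst_key e', snd_key e'}"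
  then consider (same) "fst_key e = fst_key e'" "snd_key e = snd_key e'"
    | (swap) "fst_key e = snd_key e'" "snd_key e = fst_key e'"
    unfolding doubleton_eq_iff by blast
  then show "e = e'"
  proof cases
    case same
    have m1: "fst_key e mod 3 = fst_key e' mod 3" "snd_key e mod 3 = snd_key e' mod 3" using same by simp_all
    from e have "e < 2 * m + length xs" by simp
    then show ?thesis
    proof (cases rule: item_cases)
      case e1: (fst j)
      from e' have "e' < 2 * m + length xs" by simp
      then show ?thesis
      proof (cases rule: item_cases)
        case (fst j')
        then show ?thesis using e1 same key_inject[OF mod_d mod_d] inj_edgesD by (simp add: apex_key_inject)
      next
        case (snd j')
        then show ?thesis using e1 m1 by (simp add: key_mod)
      next
        case (query q)
        then show ?thesis using e1 m1(2) apex_key_mod by (simp add: key_mod)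
      qed
    next
      case e1: (snd j)
      from e' have "e' < 2 * m + length xs" by simp
      then show ?thesis
      proof (cases rule: item_cases)
        case (fst j')
        then show ?thesis using e1 m1 by (simp add: key_mod)
      next
        case (snd j')
        then show ?thesis using e1 same key_inject[OF mod_d mod_d] inj_edgesD by (simp add: apex_key_inject)
      next
        case (query q)
        then show ?thesis using e1 m1(1) by (simp add: key_mod)
      qed
    next
      case e1: (query q)
      from e' have "e' < 2 * m + length xs" by simp
      then show ?thesis
      proof (cases rule: item_cases)
        case (fst j')
        then show ?thesis using e1 m1(2) apex_key_mod by (simp add: key_mod)
      next
        case (snd j')
        then show ?thesis using e1 m1(1) by (simp add: key_mod)
      next
        case q': (query q')
        have mem: "xs ! q \<in> set xs" "xs ! q' \<in> set xs" using e1 q' by simp_all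
        note cd = code_div[OF mem(1)] code_div[OF mem(2)]
        have "u (xs ! q mod m) = u (xs ! q' mod m)" "xs ! q div m = xs ! q' div m"
          "v (xs ! q mod m) = v (xs ! q' mod m)"
          using same e1 q' key_inject[OF cd] by simp_all
        then have "xs ! q = xs ! q'" using inj_edgesD[OF code_mod[OF mem(1)] code_mod[OF mem(2)]] code_eq by blast
        then show ?thesis using distinct_xs e1 q' by (simp add: nth_eq_iff_index_eq)
      qed
    qed
  next
    case swap
    have m1: "fst_key e mod 3 = snd_key e' mod 3" "snd_key e mod 3 = fst_key e' mod 3" using swap by simp_all
    from e have "e < 2 * m + length xs" by simp
    moreover from e' have "e' < 2 * m + length xs" by simp
    \<comment> \<open>Every item lists its sides in increasing order of residues, which a swap would
      reverse.\<close>
    ultimately have "fst_key e mod 3 < snd_key e mod 3" "fst_key e' mod 3 < snd_key e' mod 3"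
      by (auto elim!: item_cases simp: key_mod apex_key_mod)
    then show ?thesis using m1 by simp
  qed
qed

text \<open>A first-side vertex is adjacent to apexes, through copies of edges, and to second-side
  vertices, through queries. The latter are excluded as common neighbours when this is combined with
  the analogous fact for the second side.\<close>

lemma neighbour_fst:
  assumes e: "e < 2 * m + length xs" and eq: "{key S x i 0, c} = {fst_key e, snd_key e}" and i: "i < S"
  shows "(\<exists>j<m. u j = x \<and> v j mod d = i \<and> c = apex_key (v j)) \<or> c mod 3 = 1"
proof -
  have ne: "key S x i 0 mod 3 = 0" by (simp add: key_mod)
  show ?thesis using e
  proof (cases rule: item_cases)
    case (fst j)
    have "key S x i 0 \<noteq> snd_key e" using ne apex_key_mod[of "v j"] unfolding fst(3,4) by fastforce
    then have "key S x i 0 = fst_key e" "c = snd_key e" using eq unfolding doubleton_eq_iff by blast+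
    then show ?thesis using fst key_inject[OF i mod_d] by auto
  next
    case (snd j)
    have "key S x i 0 \<noteq> snd_key e" using ne apex_key_mod[of "v j"] unfolding snd(3,4) by fastforce
    moreover have "key S x i 0 \<noteq> fst_key e"
      using ne key_mod[of 1 S "u j" "v j mod d"] unfolding snd(3,4) by fastforce
    ultimately show ?thesis using eq unfolding doubleton_eq_iff by blast
  next
    case (query q)
    have "key S x i 0 \<noteq> snd_key e"
      using ne key_mod[of 1 S "v (xs ! q mod m)" "xs ! q div m"] unfolding query(3,4) by fastforce
    then have "c = snd_key e" using eq unfolding doubleton_eq_iff by blast
    then show ?thesis unfolding query(3,4) by (simp add: key_mod)
  qed
qed

lemma neighbour_snd:
  assumes e: "e < 2 * m + length xs" and eq: "{key S x i 1, c} = {fst_key e, snd_key e}" and i: "i < S"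
  shows "(\<exists>j<m. u j = x \<and> v j mod d = i \<and> c = apex_key (v j)) \<or> c mod 3 = 0"
proof -
  have ne: "key S x i 1 mod 3 = 1" by (simp add: key_mod)
  show ?thesis using e
  proof (cases rule: item_cases)
    case (fst j)
    have "key S x i 1 \<noteq> snd_key e" using ne apex_key_mod[of "v j"] unfolding fst(3,4) by fastforce
    moreover have "key S x i 1 \<noteq> fst_key e"
      using ne key_mod[of 0 S "u j" "v j mod d"] unfolding fst(3,4) by fastforce
    ultimately show ?thesis using eq unfolding doubleton_eq_iff by blast
  next
    case (snd j)
    have "key S x i 1 \<noteq> snd_key e" using ne apex_key_mod[of "v j"] unfolding snd(3,4) by fastforce
    then have "key S x i 1 = fst_key e" "c = snd_key e" using eq unfolding doubleton_eq_iff by blast+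
    then show ?thesis using snd key_inject[OF i mod_d] by auto
  next
    case (query q)
    have "key S x i 1 \<noteq> fst_key e"
      using ne key_mod[of 0 S "u (xs ! q mod m)" "xs ! q div m"] unfolding query(3,4) by fastforce
    then have "c = fst_key e" using eq unfolding doubleton_eq_iff by blast
    then show ?thesis unfolding query(3,4) by (simp add: key_mod)
  qed
qed

lemma covered_query:
  assumes q: "q < length xs"
  shows "covered ((\<lambda>e. {fst_key e, snd_key e}) ` {..<2 * m + length xs})
      (fst_key (2 * m + q)) (snd_key (2 * m + q)) \<longleftrightarrow> closes m u v d (xs ! q)"
proof -
  let ?c = "xs ! q" and ?E = "(\<lambda>e. {fst_key e, snd_key e}) ` {..<2 * m + length xs}"
  have fk: "fst_key (2 * m + q) = key S (u (?c mod m)) (?c div m) 0"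
    "snd_key (2 * m + q) = key S (v (?c mod m)) (?c div m) 1"
    by (simp_all add: fst_key_def snd_key_def)
  have i: "?c div m < S" using code_div q by simp
  show ?thesis unfolding fk
  proof
    assume "covered ?E (key S (u (?c mod m)) (?c div m) 0) (key S (v (?c mod m)) (?c div m) 1)"
    then obtain z e1 e2 where
      1: "e1 < 2 * m + length xs" "{key S (u (?c mod m)) (?c div m) 0, z} = {fst_key e1, snd_key e1}" and
      2: "e2 < 2 * m + length xs" "{key S (v (?c mod m)) (?c div m) 1, z} = {fst_key e2, snd_key e2}"
      unfolding covered_def by auto
    \<comment> \<open>The alternatives \<open>z mod 3 = 1\<close> and \<open>z mod 3 = 0\<close>
      contradict each other and the residue 2 of an apex, so \<open>z\<close> is an apex for both
      edges.\<close>
    from neighbour_fst[OF 1 i] neighbour_snd[OF 2 i] apex_key_mod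
    obtain j1 j2 where "j1 < m" "u j1 = u (?c mod m)" "v j1 mod d = ?c div m" "z = apex_key (v j1)"
      "j2 < m" "u j2 = v (?c mod m)" "z = apex_key (v j2)"
      by (metis one_neq_zero numeral_eq_one_iff semiring_norm(85) zero_neq_numeral)
    then show "closes m u v d ?c" unfolding closes_def using apex_key_inject by metis
  next
    assume "closes m u v d ?c"
    then obtain j1 j2 where j: "j1 < m" "j2 < m" "u j1 = u (?c mod m)" "u j2 = v (?c mod m)"
      "v j1 = v j2" "v j1 mod d = ?c div m" unfolding closes_def by blast
    have "{key S (u (?c mod m)) (?c div m) 0, apex_key (v j1)} = {fst_key j1, snd_key j1}"
      using j by (simp add: fst_key_def snd_key_def)
    then have a: "{key S (u (?c mod m)) (?c div m) 0, apex_key (v j1)} \<in> ?E" using j(1) by (intro image_eqI[of _ _ j1]) simp_all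
    have "{key S (v (?c mod m)) (?c div m) 1, apex_key (v j1)} = {fst_key (m + j2), snd_key (m + j2)}"
      using j by (simp add: fst_key_def snd_key_def)
    then have b: "{key S (v (?c mod m)) (?c div m) 1, apex_key (v j1)} \<in> ?E" using j(2) by (intro image_eqI[of _ _ "m + j2"]) simp_all
    show "covered ?E (key S (u (?c mod m)) (?c div m) 0) (key S (v (?c mod m)) (?c div m) 1)"
      unfolding covered_def using a b by blast
  qed
qed

lemma keys_less:
  assumes "e < 2 * m + length xs" "n \<le> 2 * m" "m \<ge> 3"
  shows "fst_key e < 100 * (m * m)" "snd_key e < 100 * (m * m)"
proof -
  have mm: "3 * m \<le> m * m" using assms(3) by simp
  have u: "u j < 2 * m" "v j < 2 * m" if "j < m" for j using edges[OF that] assms(2) by linarith+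
  note kl = key_less[OF u(1) mod_d _ assms(3)]
  have "fst_key e < 100 * (m * m) \<and> snd_key e < 100 * (m * m)"
    using assms(1)
  proof (cases rule: item_cases)
    case (fst j)
    show ?thesis using kl(1)[of j 0 "v j"] fst(1) u(2)[of j] mm assms(3) unfolding fst(3,4) apex_key_def by linarith
  next
    case (snd j)
    show ?thesis using kl(1)[of j 1 "v j"] snd(1) u(2)[of j] mm assms(3) unfolding snd(3,4) apex_key_def by linarith
  next
    case (query q)
    have mem: "xs ! q \<in> set xs" using query by simp
    show ?thesis
      using query key_less(1)[OF u(1)[OF code_mod[OF mem]] code_div[OF mem], of 0]
        key_less(1)[OF u(2)[OF code_mod[OF mem]] code_div[OF mem], of 1] assms(3) by simp
  qed
  then show "fst_key e < 100 * (m * m)" "snd_key e < 100 * (m * m)" by auto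
qed

end

section \<open>The programs of one doubling of the modulus\<close>

definition expand_prog :: prog where
  "expand_prog = Op 42 Mul 4 17 ;; Op 41 Add 18 18 ;;
     For 26 18 (Op 31 Add 14 26 ;; Load 31 31 ;; Op 32 Add 15 26 ;; Store 32 31 ;;
       Op 31 Add 31 42 ;; Op 32 Add 32 18 ;; Store 32 31)"

definition edge_items_prog :: prog where
  "edge_items_prog = Op 17 Add 17 17 ;;
     For 26 4 (Op 31 Add 9 26 ;; Load 31 31 ;; Op 32 Add 10 26 ;; Load 32 32 ;; Op 33 Mod 32 17 ;;
       Op 34 Mul 31 8 ;; Op 34 Add 34 33 ;; Op 34 Mul 3 34 ;; Op 35 Mul 3 32 ;; Op 35 Add 35 2 ;;
       Op 36 Add 11 26 ;; Store 36 34 ;; Op 36 Add 36 4 ;; Op 34 Add 34 1 ;; Store 36 34 ;;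
       Op 36 Add 12 26 ;; Store 36 35 ;; Op 36 Add 36 4 ;; Store 36 35)"

definition query_items_prog :: prog where
  "query_items_prog =
     For 26 41 (Op 31 Add 15 26 ;; Load 31 31 ;; Op 32 Mod 31 4 ;; Op 33 Div 31 4 ;;
       Op 34 Add 9 32 ;; Load 34 34 ;; Op 34 Mul 34 8 ;; Op 34 Add 34 33 ;; Op 34 Mul 3 34 ;;
       Op 35 Add 10 32 ;; Load 35 35 ;; Op 35 Mul 35 8 ;; Op 35 Add 35 33 ;; Op 35 Mul 3 35 ;;
       Op 35 Add 35 1 ;;
       Op 36 Add 11 43 ;; Op 36 Add 36 26 ;; Store 36 34 ;;
       Op 36 Add 12 43 ;; Op 36 Add 36 26 ;; Store 36 35)"

text \<open>Results of queries start at position \<open>2 * m\<close>, behind those of the edge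
  copies, which are ignored. The comparison of registers 18 and 4 stops storing after
  \<open>m\<close> survivors and so implements \<open>take m\<close>.\<close>

definition filter_prog :: prog where
  "filter_prog = Const 18 0 ;;
     For 26 41 (Op 31 Add 13 43 ;; Op 31 Add 31 26 ;; Load 31 31 ;;
       Branch (Equal 31 1) (Branch (Less 18 4)
         (Op 31 Add 15 26 ;; Load 31 31 ;; Op 32 Add 14 18 ;; Store 32 31 ;; Op 18 Add 18 1) Skip) Skip)"

lemma writes_level_parts:
  "writes expand_prog = {26, 31, 32, 41, 42}"
  "writes edge_items_prog = {17, 26, 31, 32, 33, 34, 35, 36}"
  "writes query_items_prog = {26, 31, 32, 33, 34, 35, 36}"
  "writes filter_prog = {18, 26, 31, 32}"
  unfolding expand_prog_def edge_items_prog_def query_items_prog_def filter_prog_def by auto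

lemma nth_append_map:
  "q < length cs \<Longrightarrow> (cs @ map f cs) ! q = cs ! q"
  "q < length cs \<Longrightarrow> (cs @ map f cs) ! (length cs + q) = f (cs ! q)"
  by (simp_all add: nth_append)

context ram
begin

lemma runs_expand_prog:
  assumes c: "const_regs r" and cs: "r 18 = length cs" "length cs \<le> m" and d: "r 17 = d"
    and less: "\<And>c. c \<in> set cs \<Longrightarrow> c < m * d" "2 * (m * d) < 2 ^ w"
    and h: "\<And>q. q < length cs \<Longrightarrow> h (bC + q) = cs ! q"
  shows "runs w expand_prog r h (m * 9 + 10) (\<lambda>r' h'. r' 41 = 2 * length cs \<and>
    (\<forall>q<2 * length cs. h' (bE + q) = (cs @ map (\<lambda>c. c + m * d) cs) ! q) \<and>
    (\<forall>a. a < bE \<or> bE + B \<le> a \<longrightarrow> h' a = h a))"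
proof -
  let ?post = "\<lambda>r' h'. r' 41 = 2 * length cs \<and> (\<forall>q<2 * length cs. h' (bE + q) = (cs
    @ map (\<lambda>c. c + m * d) cs) ! q) \<and> (\<forall>a. a < bE \<or> bE + B \<le> a
    \<longrightarrow> h' a = h a)"
  let ?body = "Op 31 Add 14 26 ;; Load 31 31 ;; Op 32 Add 15 26 ;; Store 32 31 ;; Op 31 Add 31 42 ;; Op
    32 Add 32 18 ;; Store 32 31"
  note cD = const_regsD[OF c]
  let ?n = "length cs"
  let ?I = "\<lambda>k r' h'. r' 41 = 2 * ?n \<and> (\<forall>q<k. h' (bE + q) = cs ! q \<and> h' (bE + ?n + q) = cs ! q + m * d) \<and>
    (\<forall>a. a < bE \<or> bE + B \<le> a \<longrightarrow> h' a = h a)"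
  have nB: "4 * ?n + 10 < B" "?n < B" "B \<le> 2 ^ w" "bE + B \<le> 2 ^ w" "bC + B \<le> bE" "?n + ?n < 2 ^ w" "m * d < 2 ^ w"
    using cs B_large bases less(2) by linarith+
  show ?thesis
    unfolding expand_prog_def
  proof (rule runs_Seq)
    show "runs w (Op 42 Mul 4 17) r h 1 (\<lambda>r' h'. r' = r(42 := m * d) \<and> h' = h)"
      by (rule runs_wp) (use cD d nB in simp_all)
  next
    fix r1 h1 assume "r1 = r(42 := m * d) \<and> h1 = h"
    then have r1: "r1 = r(42 := m * d)" "h1 = h" by auto
    show "runs w (Op 41 Add 18 18 ;; For 26 18 ?body) r1 h1 (m * 9 + 9) ?post"
    proof (rule runs_Seq)
      show "runs w (Op 41 Add 18 18) r1 h1 1 (\<lambda>r' h'. r' = r(42 := m * d, 41 := ?n + ?n) \<and> h' = h)"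
        by (rule runs_wp) (use r1 cD cs nB in simp_all)
    next
      fix r2 h2 assume "r2 = r(42 := m * d, 41 := ?n + ?n) \<and> h2 = h"
      then have r2: "r2 = r(42 := m * d, 41 := ?n + ?n)" "h2 = h" by auto
      have r2D: "r2 1 = 1" "r2 14 = bC" "r2 15 = bE" "r2 42 = m * d" "r2 18 = ?n" "r2 41 = 2 * ?n" using r2 cD cs by simp_all
      have "runs w (For 26 18 ?body) r2 h2 (m * 9 + 8) (?I (r2 18))"
      proof (rule runs_For[where T = 7])
        show "?I 0 (r2(26 := 0)) h2" using r2D r2 by simp
      next
        fix k r' h' assume k: "k < r2 18" "r' 26 = k" and
          fr: "\<forall>x. x \<notin> insert 26 (writes ?body) \<longrightarrow> r' x = r2 x" and I: "?I k r' h'"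
        have fr': "r' 14 = bC" "r' 15 = bE" "r' 42 = m * d" "r' 18 = ?n" "r' 41 = 2 * ?n" using fr r2D by simp_all
        have kn: "k < ?n" using k r2D by simp
        have ld: "h' (bC + k) = cs ! k" using I h[OF kn] kn nB by simp
        have lt: "cs ! k < m * d" using less(1) kn by simp
        have ws: "bC + k < 2 ^ w" "cs ! k < 2 ^ w" "bE + k < 2 ^ w" "cs ! k + m * d < 2 ^ w" "bE + k + ?n < 2 ^ w"
          using nB kn lt less(2) by linarith+
        have "runs w ?body r' h' 7
          (\<lambda>r'' h''. r'' 41 = 2 * ?n \<and> h'' = h'(bE + k := cs ! k, bE + k + ?n := cs ! k + m * d))"
          by (rule runs_wp) (use fr' k ld ws in \<open>simp_all del: fun_upd_apply add: fun_upd_same fun_upd_other\<close>)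
        then show "runs w ?body r' h' 7 (\<lambda>r'' h''. ?I (Suc k) (r''(26 := Suc k)) h'')"
        proof (rule runs_mono)
          fix r'' h'' :: "nat \<Rightarrow> nat"
          assume Q: "r'' 41 = 2 * ?n \<and> h'' = h'(bE + k := cs ! k, bE + k + ?n := cs ! k + m * d)"
          show "?I (Suc k) (r''(26 := Suc k)) h''"
          proof (intro conjI allI impI)
            fix q assume "q < Suc k"
            then show "h'' (bE + q) = cs ! q" "h'' (bE + ?n + q) = cs ! q + m * d"
              using Q I kn by (auto simp: less_Suc_eq)
          next
            fix a assume "a < bE \<or> bE + B \<le> a"
            moreover have "bE + k + ?n < bE + B" using kn nB by linarith
            ultimately show "h'' a = h a" using Q I by auto
          qed (use Q in simp)
        qed simp
      qed (use r2D nB cs in auto)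
      then show "runs w (For 26 18 ?body) r2 h2 (m * 9 + 8)
        ?post"
      proof (rule runs_mono)
        fix r' h' :: "nat \<Rightarrow> nat" assume I: "?I (r2 18) r' h'"
        have "h' (bE + q) = (cs @ map (\<lambda>c. c + m * d) cs) ! q" if q: "q < 2 * ?n" for q
        proof (cases "q < ?n")
          case True
          then show ?thesis using I r2D by (simp add: nth_append_map)
        next
          case False
          define p where "p = q - ?n"
          have p: "p < ?n" "q = ?n + p" using False q unfolding p_def by linarith+
          have "h' (bE + ?n + p) = cs ! p + m * d" using I r2D p by simp
          then show ?thesis unfolding p(2) nth_append_map(2)[OF p(1)] by (simp add: add.assoc)
        qed
        then show "r' 41 = 2 * length cs \<and>
          (\<forall>q<2 * length cs. h' (bE + q) = (cs @ map (\<lambda>c. c + m * d) cs) ! q) \<and>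
          (\<forall>a. a < bE \<or> bE + B \<le> a \<longrightarrow> h' a = h a)" using I by blast
      qed simp
    qed simp
  qed simp
qed

lemma runs_edge_items_prog:
  assumes c: "const_regs r" and d: "r 17 = d" "2 * d \<le> 4 * m" "0 < d"
    and uv: "\<And>j. j < m \<Longrightarrow> h (bU + j) = u j \<and> h (bV + j) = v j \<and> u j < 2 * m \<and> v j < 2 * m"
  shows "runs w edge_items_prog r h (m * 21 + 3) (\<lambda>r' h'. r' 17 = 2 * d \<and>
    (\<forall>j<m. h' (bK + j) = key (4 * m) (u j) (v j mod (2 * d)) 0 \<and>
       h' (bK + j + m) = key (4 * m) (u j) (v j mod (2 * d)) 1 \<and>
       h' (bL + j) = apex_key (v j) \<and> h' (bL + j + m) = apex_key (v j)) \<and>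
    (\<forall>a. a < bK \<or> bL + B \<le> a \<longrightarrow> h' a = h a))"
proof -
  note cD = const_regsD[OF c]
  let ?k = "\<lambda>j. key (4 * m) (u j) (v j mod (2 * d))"
  let ?I = "\<lambda>k r' h'. r' 17 = 2 * d \<and> (\<forall>j<k. h' (bK + j) = ?k j 0 \<and> h' (bK + j + m) = ?k j 1 \<and>
       h' (bL + j) = apex_key (v j) \<and> h' (bL + j + m) = apex_key (v j)) \<and>
    (\<forall>a. a < bK \<or> bL + B \<le> a \<longrightarrow> h' a = h a)"
  let ?body = "Op 31 Add 9 26 ;; Load 31 31 ;; Op 32 Add 10 26 ;; Load 32 32 ;; Op 33 Mod 32 17 ;;
       Op 34 Mul 31 8 ;; Op 34 Add 34 33 ;; Op 34 Mul 3 34 ;; Op 35 Mul 3 32 ;; Op 35 Add 35 2 ;;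
       Op 36 Add 11 26 ;; Store 36 34 ;; Op 36 Add 36 4 ;; Op 34 Add 34 1 ;; Store 36 34 ;;
       Op 36 Add 12 26 ;; Store 36 35 ;; Op 36 Add 36 4 ;; Store 36 35"
  have mB: "2 * m < B" "bU + B \<le> bV" "bV + B \<le> bK" "bK + B \<le> bL" "bL + B \<le> 2 ^ w" "m < 2 ^ w"
    "4 * m < 2 ^ w" "100 * (m * m) < 2 ^ w" "d + d < 2 ^ w"
    using B_large B_square bases d(2) m3 by linarith+
  show ?thesis
    unfolding edge_items_prog_def
  proof (rule runs_Seq)
    show "runs w (Op 17 Add 17 17) r h 1 (\<lambda>r' h'. r' = r(17 := 2 * d) \<and> h' = h)"
      by (rule runs_wp) (use d mB in \<open>simp_all add: mult_2\<close>)
  next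
    fix r1 h1 assume "r1 = r(17 := 2 * d) \<and> h1 = h"
    then have r1: "r1 = r(17 := 2 * d)" "h1 = h" by auto
    have r1D: "r1 (Suc 0) = 1" "r1 2 = 2" "r1 3 = 3" "r1 4 = m" "r1 8 = 4 * m" "r1 9 = bU" "r1 10 = bV" "r1 11 = bK" "r1 12 = bL"
      "r1 17 = 2 * d" "r1 1 = 1" using r1 cD by simp_all
    have "runs w (For 26 4 ?body) r1 h1 (m * 21 + 2) (?I (r1 4))"
    proof (rule runs_For[where T = 19])
      show "?I 0 (r1(26 := 0)) h1" using r1D r1 by simp
    next
      fix k r' h' assume k: "k < r1 4" "r' 26 = k" and
        fr: "\<forall>x. x \<notin> insert 26 (writes ?body) \<longrightarrow> r' x = r1 x" and I: "?I k r' h'"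
      have fr': "r' (Suc 0) = 1" "r' 2 = 2" "r' 3 = 3" "r' 4 = m" "r' 8 = 4 * m" "r' 9 = bU" "r' 10 = bV" "r' 11 = bK"
        "r' 12 = bL" "r' 17 = 2 * d" "r' 1 = 1" using fr r1D by simp_all
      have km: "k < m" using k r1D by simp
      have lo: "bU + k < bK" "bV + k < bK" using km mB by linarith+
      have ld: "h' (bU + k) = u k" "h' (bV + k) = v k"
        using I uv[OF km] lo by auto
      have mod: "v k mod (2 * d) < 4 * m" using mod_less_divisor[of "2 * d" "v k"] d by linarith
      have uvk: "u k < 2 * m" "v k < 2 * m" using uv[OF km] by auto
      note kl = key_less[OF uvk(1) mod _ m3]
      have key0: "3 * (u k * (4 * m) + v k mod (2 * d)) = ?k k 0" "Suc (?k k 0) = ?k k 1"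
        unfolding key_def by simp_all
      have apex: "3 * v k + 2 = apex_key (v k)" unfolding apex_key_def by simp
      have ws: "bU + k < 2 ^ w" "bV + k < 2 ^ w" "u k < 2 ^ w" "v k < 2 ^ w" "v k mod (2 * d) < 2 ^ w"
        "u k * (4 * m) < 2 ^ w" "u k * (4 * m) + v k mod (2 * d) < 2 ^ w"
        "?k k 0 < 2 ^ w" "?k k 1 < 2 ^ w" "3 * v k < 2 ^ w" "apex_key (v k) < 2 ^ w"
        "bK + k < 2 ^ w" "bK + k + m < 2 ^ w" "bL + k < 2 ^ w" "bL + k + m < 2 ^ w"
        using kl(1)[of 0] kl(1)[of 1] kl(2-4)[of 0] uvk mod km mB lo B_large bases unfolding apex_key_def by linarith+
      have "runs w ?body r' h' 19 (\<lambda>r'' h''. r'' 17 = 2 * d \<and>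
          h'' = h'(bK + k := ?k k 0, bK + k + m := ?k k 1, bL + k := apex_key (v k), bL + k + m := apex_key (v k)))"
        by (rule runs_wp) (use fr' k(2) ld ws key0 apex in
          \<open>simp_all del: fun_upd_apply add_2_eq_Suc' One_nat_def add: fun_upd_same fun_upd_other Suc_eq_plus1[symmetric]\<close>)
      then show "runs w ?body r' h' 19 (\<lambda>r'' h''. ?I (Suc k) (r''(26 := Suc k)) h'')"
      proof (rule runs_mono)
        fix r'' h'' :: "nat \<Rightarrow> nat"
        assume Q: "r'' 17 = 2 * d \<and>
          h'' = h'(bK + k := ?k k 0, bK + k + m := ?k k 1, bL + k := apex_key (v k), bL + k + m := apex_key (v k))"
        have sep: "bK + k + m < bL" "bL + k + m < bL + B" using mB km by linarith+
        show "?I (Suc k) (r''(26 := Suc k)) h''"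
        proof (intro conjI allI impI)
          fix j assume "j < Suc k"
          then have "j < k \<or> j = k" by auto
          then show "h'' (bK + j) = ?k j 0" "h'' (bK + j + m) = ?k j 1"
            "h'' (bL + j) = apex_key (v j)" "h'' (bL + j + m) = apex_key (v j)"
            using Q I km sep by auto
        next
          fix a assume "a < bK \<or> bL + B \<le> a"
          then show "h'' a = h a" using Q I sep by auto
        qed (use Q in simp)
      qed simp
    qed (use r1D mB in auto)
    then show "runs w (For 26 4 ?body) r1 h1 (m * 21 + 2) (\<lambda>r' h'. r' 17 = 2 * d \<and>
      (\<forall>j<m. h' (bK + j) = ?k j 0 \<and> h' (bK + j + m) = ?k j 1 \<and>
       h' (bL + j) = apex_key (v j) \<and> h' (bL + j + m) = apex_key (v j)) \<and>
      (\<forall>a. a < bK \<or> bL + B \<le> a \<longrightarrow> h' a = h a))" using r1D by simp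
  qed simp
qed

lemma runs_query_items_prog:
  assumes c: "const_regs r" and E: "r 41 = length E" "length E \<le> 2 * m"
    and less: "\<And>c. c \<in> set E \<Longrightarrow> c < m * (4 * m)"
    and uv: "\<And>j. j < m \<Longrightarrow> h (bU + j) = u j \<and> h (bV + j) = v j \<and> u j < 2 * m \<and> v j < 2 * m"
    and hE: "\<And>q. q < length E \<Longrightarrow> h (bE + q) = E ! q"
  shows "runs w query_items_prog r h (m * 46 + 2) (\<lambda>r' h'.
    (\<forall>q<length E. h' (bK + 2 * m + q) = key (4 * m) (u (E ! q mod m)) (E ! q div m) 0 \<and>
       h' (bL + 2 * m + q) = key (4 * m) (v (E ! q mod m)) (E ! q div m) 1) \<and>
    (\<forall>e<2 * m. h' (bK + e) = h (bK + e) \<and> h' (bL + e) = h (bL + e)) \<and>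
    (\<forall>a. a < bK \<or> bL + B \<le> a \<longrightarrow> h' a = h a))"
proof -
  note cD = const_regsD[OF c]
  let ?k0 = "\<lambda>q. key (4 * m) (u (E ! q mod m)) (E ! q div m) 0"
  let ?k1 = "\<lambda>q. key (4 * m) (v (E ! q mod m)) (E ! q div m) 1"
  let ?I = "\<lambda>k r' h'. (\<forall>q<k. h' (bK + 2 * m + q) = ?k0 q \<and> h' (bL + 2 * m + q) = ?k1 q) \<and>
    (\<forall>e<2 * m. h' (bK + e) = h (bK + e) \<and> h' (bL + e) = h (bL + e)) \<and>
    (\<forall>a. a < bK \<or> bL + B \<le> a \<longrightarrow> h' a = h a)"
  let ?body = "Op 31 Add 15 26 ;; Load 31 31 ;; Op 32 Mod 31 4 ;; Op 33 Div 31 4 ;;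
       Op 34 Add 9 32 ;; Load 34 34 ;; Op 34 Mul 34 8 ;; Op 34 Add 34 33 ;; Op 34 Mul 3 34 ;;
       Op 35 Add 10 32 ;; Load 35 35 ;; Op 35 Mul 35 8 ;; Op 35 Add 35 33 ;; Op 35 Mul 3 35 ;;
       Op 35 Add 35 1 ;;
       Op 36 Add 11 43 ;; Op 36 Add 36 26 ;; Store 36 34 ;;
       Op 36 Add 12 43 ;; Op 36 Add 36 26 ;; Store 36 35"
  have mB: "4 * m < B" "bU + B \<le> bV" "bV + B \<le> bK" "bK + B \<le> bL" "bL + B \<le> bE" "bE + B \<le> 2 ^ w" "m < 2 ^ w"
    "100 * (m * m) < 2 ^ w"
    using B_large B_square bases m3 by linarith+
  have "runs w (For 26 41 ?body) r h (length E * 23 + 2) (?I (r 41))"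
  proof (rule runs_For[where T = 21])
    show "?I 0 (r(26 := 0)) h" by simp
  next
    fix k r' h' assume k: "k < r 41" "r' 26 = k" and
      fr: "\<forall>x. x \<notin> insert 26 (writes ?body) \<longrightarrow> r' x = r x" and I: "?I k r' h'"
    have fr': "r' (Suc 0) = 1" "r' 3 = 3" "r' 4 = m" "r' 8 = 4 * m" "r' 9 = bU" "r' 10 = bV" "r' 11 = bK"
      "r' 12 = bL" "r' 15 = bE" "r' 43 = 2 * m" "r' 1 = 1" using fr cD by simp_all
    have kn: "k < length E" "k < 2 * m" using k E by simp_all
    have Ek: "E ! k \<in> set E" using kn by simp
    have mm: "m > 0" using m3 by simp
    define j i where "j = E ! k mod m" and "i = E ! k div m"
    have j: "j < m" unfolding j_def using mm by simp
    have i: "i < 4 * m" unfolding i_def using less[OF Ek] by (simp add: less_mult_imp_div_less mult.commute)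
    have "bE + k < bE + B" using kn mB by linarith
    then have "h' (bE + k) = h (bE + k)" using I mB by auto
    then have ldE: "h' (bE + k) = E ! k" using hE[OF kn(1)] by simp
    have lo: "bU + j < bK" "bV + j < bK" using j mB by linarith+
    have ld: "h' (bU + j) = u j" "h' (bV + j) = v j" using I uv[OF j] lo by auto
    have uvj: "u j < 2 * m" "v j < 2 * m" using uv[OF j] by auto
    note kl = key_less[OF uvj(1) i _ m3] and kl' = key_less[OF uvj(2) i _ m3]
    have keys: "3 * (u j * (4 * m) + i) = key (4 * m) (u j) i 0" "Suc (3 * (v j * (4 * m) + i)) = key (4 * m) (v j) i 1"
      unfolding key_def by simp_all
    have "m * (4 * m) \<le> 100 * (m * m)" by simp
    then have ws: "bE + k < 2 ^ w" "E ! k < 2 ^ w" "j < 2 ^ w" "i < 2 ^ w" "bU + j < 2 ^ w" "bV + j < 2 ^ w"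
      "u j < 2 ^ w" "v j < 2 ^ w" "u j * (4 * m) < 2 ^ w" "u j * (4 * m) + i < 2 ^ w"
      "v j * (4 * m) < 2 ^ w" "v j * (4 * m) + i < 2 ^ w" "3 * (v j * (4 * m) + i) < 2 ^ w"
      "key (4 * m) (u j) i 0 < 2 ^ w" "key (4 * m) (v j) i 1 < 2 ^ w"
      "bK + 2 * m < 2 ^ w" "bK + 2 * m + k < 2 ^ w" "bL + 2 * m < 2 ^ w" "bL + 2 * m + k < 2 ^ w"
      using kl(1-4)[of 0] kl'(1)[of 1] kl'(2-4)[of 0] less[OF Ek] i j uvj kn mB lo by linarith+
    have "runs w ?body r' h' 21 (\<lambda>r'' h''.
        h'' = h'(bK + 2 * m + k := key (4 * m) (u j) i 0, bL + 2 * m + k := key (4 * m) (v j) i 1))"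
      by (rule runs_wp) (use fr' k(2) ldE ld ws keys in
        \<open>simp_all del: fun_upd_apply add_2_eq_Suc' One_nat_def add: fun_upd_same fun_upd_other Suc_eq_plus1[symmetric]
          j_def[symmetric] i_def[symmetric]\<close>)
    then show "runs w ?body r' h' 21 (\<lambda>r'' h''. ?I (Suc k) (r''(26 := Suc k)) h'')"
    proof (rule runs_mono)
      fix r'' h'' :: "nat \<Rightarrow> nat"
      assume Q: "h'' = h'(bK + 2 * m + k := key (4 * m) (u j) i 0, bL + 2 * m + k := key (4 * m) (v j) i 1)"
      have sep: "bK + 2 * m + k < bL" "bL + 2 * m + k < bL + B" using mB kn by linarith+
      show "?I (Suc k) (r''(26 := Suc k)) h''"
      proof (intro conjI allI impI)
        fix q assume "q < Suc k"
        then have "q < k \<or> q = k" by auto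
        then show "h'' (bK + 2 * m + q) = ?k0 q" "h'' (bL + 2 * m + q) = ?k1 q"
          using Q I kn sep unfolding j_def i_def by auto
      next
        fix e assume "e < 2 * m"
        then show "h'' (bK + e) = h (bK + e)" "h'' (bL + e) = h (bL + e)"
          using Q I sep by auto
      next
        fix a assume "a < bK \<or> bL + B \<le> a"
        then show "h'' a = h a" using Q I sep by auto
      qed
    qed simp
  qed (use cD E mB in auto)
  then show ?thesis unfolding query_items_prog_def
    by (rule runs_mono) (use E in simp_all)
qed

lemma take_snoc: "take m (xs @ [x]) = (if length (take m xs) < m then take m xs @ [x] else take m xs)"
  by (auto simp: take_append)

lemma runs_filter_prog:
  assumes c: "const_regs r" and E: "r 41 = length E" "length E \<le> 2 * m"
    and less: "\<And>c. c \<in> set E \<Longrightarrow> c < 2 ^ w"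
    and hE: "\<And>q. q < length E \<Longrightarrow> h (bE + q) = E ! q"
    and hR: "\<And>q. q < length E \<Longrightarrow> h (bR + 2 * m + q) = (if P (E ! q) then 1 else 0)"
  shows "runs w filter_prog r h (m * 24 + 3) (\<lambda>r' h'. r' 18 = length (take m (filter P E)) \<and>
    (\<forall>q<length (take m (filter P E)). h' (bC + q) = take m (filter P E) ! q) \<and>
    (\<forall>a. a < bC \<or> bC + B \<le> a \<longrightarrow> h' a = h a))"
proof -
  note cD = const_regsD[OF c]
  let ?L = "\<lambda>k. take m (filter P (take k E))"
  let ?I = "\<lambda>k r' h'. r' 18 = length (?L k) \<and> (\<forall>q<length (?L k). h' (bC + q) = ?L k ! q) \<and>
    (\<forall>a. a < bC \<or> bC + B \<le> a \<longrightarrow> h' a = h a)"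
  let ?body = "Op 31 Add 13 43 ;; Op 31 Add 31 26 ;; Load 31 31 ;;
       Branch (Equal 31 1) (Branch (Less 18 4)
         (Op 31 Add 15 26 ;; Load 31 31 ;; Op 32 Add 14 18 ;; Store 32 31 ;; Op 18 Add 18 1) Skip) Skip"
  have mB: "4 * m < B" "bR + B \<le> bC" "bC + B \<le> bE" "bE + B \<le> 2 ^ w" "m < 2 ^ w" "2 * m < 2 ^ w"
    using B_large bases by linarith+
  show ?thesis unfolding filter_prog_def
  proof (rule runs_Seq)
    show "runs w (Const 18 0) r h 1 (\<lambda>r' h'. r' = r(18 := 0) \<and> h' = h)"
      by (rule runs_wp) simp_all
  next
    fix r1 h1 assume "r1 = r(18 := 0) \<and> h1 = h"
    then have r1: "r1 = r(18 := 0)" "h1 = h" by auto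
    have r1D: "r1 (Suc 0) = 1" "r1 4 = m" "r1 13 = bR" "r1 14 = bC" "r1 15 = bE" "r1 43 = 2 * m" "r1 41 = length E"
      "r1 18 = 0" "r1 1 = 1" using r1 cD E by simp_all
    have "runs w (For 26 41 ?body) r1 h1 (length E * 12 + 2) (?I (r1 41))"
    proof (rule runs_For[where T = 10])
      show "?I 0 (r1(26 := 0)) h1" using r1D r1 by simp
    next
      fix k r' h' assume k: "k < r1 41" "r' 26 = k" and
        fr: "\<forall>x. x \<notin> insert 26 (writes ?body) \<longrightarrow> r' x = r1 x" and I: "?I k r' h'"
      have fr': "r' (Suc 0) = 1" "r' 4 = m" "r' 13 = bR" "r' 14 = bC" "r' 15 = bE" "r' 43 = 2 * m"
        using fr r1D by simp_all
      have kn: "k < length E" "k < 2 * m" using k r1D E by simp_all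
      have sepR: "bR + 2 * m + k < bC" "bE + k < bE + B" using kn mB by linarith+
      have ldR: "h' (bR + 2 * m + k) = (if P (E ! k) then 1 else 0)" using I hR[OF kn(1)] sepR by auto
      have ldE: "h' (bE + k) = E ! k" using I hE[OF kn(1)] mB by auto
      have Ew: "E ! k < 2 ^ w" using less kn by simp
      have lenL: "length (?L k) \<le> m" by simp
      have tk: "take (Suc k) E = take k E @ [E ! k]" using kn by (simp add: take_Suc_conv_app_nth)
      have LS: "?L (Suc k) = (if P (E ! k) \<and> length (?L k) < m then ?L k @ [E ! k] else ?L k)"
        unfolding tk filter_append using take_snoc[of "filter P (take k E)" "E ! k"]
        by (cases "P (E ! k)") (simp_all del: length_take take_append)
      have ws: "bR + 2 * m < 2 ^ w" "bR + 2 * m + k < 2 ^ w" "bE + k < 2 ^ w" "bC + length (?L k) < 2 ^ w"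
        "Suc (length (?L k)) < 2 ^ w" "Suc 0 < 2 ^ w"
        using kn mB lenL m3 by linarith+
      have r18: "r' 18 = length (?L k)" using I by blast
      show "runs w ?body r' h' 10 (\<lambda>r'' h''. ?I (Suc k) (r''(26 := Suc k)) h'')"
      proof (cases "P (E ! k) \<and> length (?L k) < m")
        case True
        then have LS': "?L (Suc k) = ?L k @ [E ! k]" using LS by simp
        define l where "l = length (?L k)"
        have l: "l < m" using True l_def by simp
        have "runs w ?body r' h' 10 (\<lambda>r'' h''. r'' 18 = Suc l \<and> h'' = h'(bC + l := E ! k))"
          by (rule runs_wp) (use fr' k(2) ldR ldE ws Ew True l r18[folded l_def] ws(4,5)[folded l_def] in
            \<open>simp_all del: fun_upd_apply length_take add: fun_upd_same fun_upd_other\<close>)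
        then show ?thesis
        proof (rule runs_mono)
          fix r'' h'' :: "nat \<Rightarrow> nat" assume Q: "r'' 18 = Suc l \<and> h'' = h'(bC + l := E ! k)"
          show "?I (Suc k) (r''(26 := Suc k)) h''"
          proof (intro conjI allI impI)
            show "(r''(26 := Suc k)) 18 = length (?L (Suc k))" using Q LS' l_def by simp
            fix q assume "q < length (?L (Suc k))"
            then have "q < l \<or> q = l" unfolding LS' l_def length_append by auto
            then show "h'' (bC + q) = ?L (Suc k) ! q"
            proof
              assume q: "q < l"
              then have "h'' (bC + q) = h' (bC + q)" using Q by simp
              also have "\<dots> = ?L k ! q" using I q l_def by blast
              finally show ?thesis unfolding LS' using q l_def by (simp only: nth_append if_True)
            next
              assume "q = l"
              then show ?thesis unfolding LS' using Q l_def by (simp only: nth_append_length fun_upd_same)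
            qed
          next
            fix a assume "a < bC \<or> bC + B \<le> a"
            then show "h'' a = h a" using Q I l mB by auto
          qed
        qed simp
      next
        case False
        then have LS': "?L (Suc k) = ?L k" using LS by simp
        define l where "l = length (?L k)"
        have "runs w ?body r' h' 10 (\<lambda>r'' h''. r'' 18 = l \<and> h'' = h')"
          by (rule runs_wp) (use fr' k(2) ldR ws(1,2,3,6) False[folded l_def] r18[folded l_def] in
            \<open>simp_all del: fun_upd_apply length_take add: fun_upd_same fun_upd_other\<close>)
        then show ?thesis
          by (rule runs_mono) (use I LS' l_def in simp_all)
      qed
    qed (use r1D mB E in auto)
    then show "runs w (For 26 41 ?body) r1 h1 (m * 24 + 2) (\<lambda>r' h'. r' 18 = length (take m (filter P E)) \<and>
      (\<forall>q<length (take m (filter P E)). h' (bC + q) = take m (filter P E) ! q) \<and>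
      (\<forall>a. a < bC \<or> bC + B \<le> a \<longrightarrow> h' a = h a))"
      by (rule runs_mono) (use r1D E in simp_all)
  qed simp
qed

end

text \<open>The order matters: \<open>expand_prog\<close> needs the old modulus in register 17, and
  \<open>edge_items_prog\<close> doubles it before computing residues.\<close>

definition (in edge_detector) level_prog :: prog where
  "level_prog = expand_prog ;; edge_items_prog ;; query_items_prog ;; Op 19 Add 43 41 ;; detect_prog ;;
     filter_prog"

text \<open>Adding \<open>m * d\<close> to \<open>j + m * i\<close> keeps the edge \<open>j\<close>
  and turns the residue \<open>i\<close> into \<open>i + d\<close>.\<close>

definition next_level :: "nat \<Rightarrow> (nat \<Rightarrow> nat) \<Rightarrow> (nat \<Rightarrow> nat) \<Rightarrow> nat \<Rightarrow> nat list \<Rightarrow> nat list" where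
  "next_level m u v d cs = take m (filter (closes m u v (2 * d)) (cs @ map (\<lambda>c. c + m * d) cs))"

context edge_detector
begin

lemma writes_level_prog:
  "x \<notin> {16, 17, 18, 19, 20, 23, 24, 25, 26, 27, 28, 30, 31, 32, 33, 34, 35, 36, 40, 41, 42} \<Longrightarrow> x < 50 \<Longrightarrow>
    x \<notin> writes level_prog"
  unfolding level_prog_def by (simp add: writes_level_parts writes_detect_prog)

text \<open>The coefficients are those of the 8000 calls,
  \<open>8000 * (251 * m + 2 * F + R + 60)\<close>, plus \<open>1000 * m + 1000\<close> for the
  linear work of the other four programs.\<close>

lemma runs_level_prog:
  assumes c: "const_regs r" and dr: "r 17 = d" "0 < d" "2 * d \<le> 4 * m"
    and cs: "r 18 = length cs" "length cs \<le> m" "distinct cs" "\<And>c. c \<in> set cs \<Longrightarrow> c < m * d"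
    and hC: "\<And>q. q < length cs \<Longrightarrow> h (bC + q) = cs ! q"
    and uv: "\<And>j. j < m \<Longrightarrow> h (bU + j) = u j \<and> h (bV + j) = v j"
    and edges: "\<And>j. j < m \<Longrightarrow> u j < v j \<and> v j < n" and inj: "inj_on (\<lambda>j. (u j, v j)) {..<m}"
    and off: "r 16 = off" "b0 \<le> off" "off + 16000 * B < 2 ^ w" and z: "\<And>a. off \<le> a \<Longrightarrow> h a = 0"
  shows "runs w level_prog r h (2009000 * m + 16000 * F + 8000 * R + 481000) (\<lambda>r' h'. r' 17 = 2 * d \<and>
    r' 16 = off + 16000 * B \<and> r' 18 = length (next_level m u v d cs) \<and>
    (\<forall>q<length (next_level m u v d cs). h' (bC + q) = next_level m u v d cs ! q) \<and>
    (\<forall>j<m. h' (bU + j) = u j \<and> h' (bV + j) = v j) \<and> (\<forall>a \<ge> off + 16000 * B. h' a = 0))"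
    (is "runs _ _ _ _ _ ?Q")
proof -
  define E where "E = cs @ map (\<lambda>c. c + m * d) cs"
  have lenE: "length E = 2 * length cs" "length E \<le> 2 * m" using cs(2) unfolding E_def by simp_all
  have lessE: "c < m * (2 * d)" if "c \<in> set E" for c
  proof -
    have "c < m * d + m * d" using that cs(4) unfolding E_def by fastforce
    then show ?thesis by simp
  qed
  have distE: "distinct E"
    unfolding E_def distinct_append distinct_map
    using cs(3,4) by (auto simp: inj_on_def dest: cs(4))
  interpret items m n u v "2 * d" E
    by unfold_locales (use edges inj dr distE lessE in auto)
  let ?N = "2 * m + length E"
  have md: "m * d \<le> m * (2 * m)" "m * (2 * d) \<le> m * (4 * m)"
    using dr by (intro mult_le_mono2; simp)+
  have mm: "m * (4 * m) \<le> 4 * (m * m)" "m * (2 * m) \<le> 2 * (m * m)" by simp_all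
  have bnd: "2 * (m * d) < 2 ^ w" "100 * (m * m) \<le> B" "B < 2 ^ w" "m * (4 * m) < 2 ^ w" "2 * m + length E < 2 ^ w"
    using md mm B_square B_large off(3) m3 lenE by linarith+
  have uv2: "h (bU + j) = u j \<and> h (bV + j) = v j \<and> u j < 2 * m \<and> v j < 2 * m" if "j < m" for j
    using uv[OF that] edges[OF that] n_le by auto
  have lowB: "bU + m < bK" "bV + m < bK" "bK \<le> bE" "m < B" "2 * m + length E < B"
    using bases B_large lenE by linarith+
  have 1: "runs w expand_prog r h (m * 9 + 10) (\<lambda>r' h'. r' 41 = 2 * length cs \<and>
    (\<forall>q<2 * length cs. h' (bE + q) = E ! q) \<and> (\<forall>a. a < bE \<or> bE + B \<le> a \<longrightarrow> h' a = h a))"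
    unfolding E_def by (rule runs_expand_prog[OF c cs(1,2) dr(1) cs(4) bnd(1) hC])
  show ?thesis
    unfolding level_prog_def
  proof (rule runs_Seq[OF 1])
    fix r1 h1 assume Q1: "r1 41 = 2 * length cs \<and>
        (\<forall>q<2 * length cs. h1 (bE + q) = E ! q) \<and> (\<forall>a. a < bE \<or> bE + B \<le> a \<longrightarrow> h1 a = h a)"
      and fr: "\<forall>x. x \<notin> writes expand_prog \<longrightarrow> r1 x = r x"
    have fr1: "r1 x = r x" if "x \<notin> {26, 31, 32, 41, 42}" for x
      using fr that unfolding writes_level_parts by simp
    have c1: "const_regs r1" by (rule const_regs_frame[OF c, of "{26, 31, 32, 41, 42}"]) (use fr1 in auto)
    have uv1: "h1 (bU + j) = u j \<and> h1 (bV + j) = v j \<and> u j < 2 * m \<and> v j < 2 * m" if "j < m" for j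
    proof -
      have "bU + j < bE" "bV + j < bE" using that lowB by linarith+
      then show ?thesis using Q1 uv2[OF that] by simp
    qed
    have d1: "r1 17 = d" using fr1 dr by simp
    note 2 = runs_edge_items_prog[OF c1 d1 dr(3) dr(2) uv1]
    show "runs w (edge_items_prog ;; query_items_prog ;; Op 19 Add 43 41 ;; detect_prog ;;
       filter_prog) r1 h1 (2008991 * m + 16000 * F + 8000 * R + 480990) ?Q"
    proof (rule runs_Seq[OF 2])
      fix r2 h2 assume Q2: "r2 17 = 2 * d \<and>
        (\<forall>j<m. h2 (bK + j) = key (4 * m) (u j) (v j mod (2 * d)) 0 \<and>
           h2 (bK + j + m) = key (4 * m) (u j) (v j mod (2 * d)) 1 \<and>
           h2 (bL + j) = apex_key (v j) \<and> h2 (bL + j + m) = apex_key (v j)) \<and>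
        (\<forall>a. a < bK \<or> bL + B \<le> a \<longrightarrow> h2 a = h1 a)"
        and fr: "\<forall>x. x \<notin> writes edge_items_prog \<longrightarrow> r2 x = r1 x"
      have fr2: "r2 x = r1 x" if "x \<notin> {17, 26, 31, 32, 33, 34, 35, 36}" for x
        using fr that unfolding writes_level_parts by simp
      have c2: "const_regs r2"
        by (rule const_regs_frame[OF c1, of "{17, 26, 31, 32, 33, 34, 35, 36}"]) (use fr2 in auto)
      have uv2': "h2 (bU + j) = u j \<and> h2 (bV + j) = v j \<and> u j < 2 * m \<and> v j < 2 * m" if "j < m" for j
      proof -
        have "bU + j < bK" "bV + j < bK" using that lowB by linarith+
        then show ?thesis using Q2 uv1[OF that] by simp
      qed
      have E2: "r2 41 = length E" using fr2 Q1 lenE by simp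
      have less2: "c < m * (4 * m)" if "c \<in> set E" for c using lessE[OF that] md by linarith
      have hE2: "h2 (bE + q) = E ! q" if "q < length E" for q
      proof -
        have "bL + B \<le> bE + q" using bases by linarith
        then show ?thesis using Q2 Q1 that lenE by simp
      qed
      note 3 = runs_query_items_prog[OF c2 E2 lenE(2) less2 uv2' hE2]
      show "runs w (query_items_prog ;; Op 19 Add 43 41 ;; detect_prog ;; filter_prog) r2 h2
         (2008970 * m + 16000 * F + 8000 * R + 480980) ?Q"
      proof (rule runs_Seq[OF 3])
        fix r3 h3 assume Q3: "(\<forall>q<length E. h3 (bK + 2 * m + q) = key (4 * m) (u (E ! q mod m)) (E ! q div m) 0 \<and>
           h3 (bL + 2 * m + q) = key (4 * m) (v (E ! q mod m)) (E ! q div m) 1) \<and>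
          (\<forall>e<2 * m. h3 (bK + e) = h2 (bK + e) \<and> h3 (bL + e) = h2 (bL + e)) \<and>
          (\<forall>a. a < bK \<or> bL + B \<le> a \<longrightarrow> h3 a = h2 a)"
          and fr: "\<forall>x. x \<notin> writes query_items_prog \<longrightarrow> r3 x = r2 x"
        have fr3: "r3 x = r2 x" if "x \<notin> {26, 31, 32, 33, 34, 35, 36}" for x
          using fr that unfolding writes_level_parts by simp
        have c3: "const_regs r3"
          by (rule const_regs_frame[OF c2, of "{26, 31, 32, 33, 34, 35, 36}"]) (use fr3 in auto)
        note c3D = const_regsD[OF c3]
        have E3: "r3 41 = length E" using fr3 E2 by simp
        have keys3: "h3 (bK + e) = fst_key e \<and> h3 (bL + e) = snd_key e" if "e < ?N" for e
          using that
        proof (cases rule: item_cases)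
          case (fst j)
          then have "h3 (bK + j) = h2 (bK + j) \<and> h3 (bL + j) = h2 (bL + j)" using Q3 by simp
          then show ?thesis using Q2 fst by metis
        next
          case (snd j)
          then have "m + j < 2 * m" by simp
          then have "h3 (bK + (m + j)) = h2 (bK + (m + j)) \<and> h3 (bL + (m + j)) = h2 (bL + (m + j))"
            using Q3 by blast
          moreover have "bK + (m + j) = bK + j + m" "bL + (m + j) = bL + j + m" by simp_all
          ultimately have "h3 (bK + (m + j)) = h2 (bK + j + m) \<and> h3 (bL + (m + j)) = h2 (bL + j + m)"
            by metis
          then show ?thesis using Q2 snd by metis
        next
          case (query q)
          then show ?thesis using Q3 by (metis add.assoc)
        qed
        have keysB: "fst_key e < B \<and> snd_key e < B" if "e < ?N" for e
          using keys_less[OF that n_le m3] bnd(2) by linarith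
        have z3: "h3 a = 0" if "off \<le> a" for a
        proof -
          have "bL + B \<le> a" "bE + B \<le> a" using bases off(2) that by linarith+
          then show ?thesis using Q3 Q2 Q1 z[OF that] by simp
        qed
        show "runs w (Op 19 Add 43 41 ;; detect_prog ;; filter_prog) r3 h3
           (2008924 * m + 16000 * F + 8000 * R + 480970) ?Q"
        proof (rule runs_Seq)
          show "runs w (Op 19 Add 43 41) r3 h3 1 (\<lambda>r' h'. r' = r3(19 := ?N) \<and> h' = h3)"
            by (rule runs_wp) (use c3D E3 bnd in simp_all)
        next
          fix r4 h4 assume "r4 = r3(19 := ?N) \<and> h4 = h3"
          then have r4: "r4 = r3(19 := ?N)" "h4 = h3" by auto
          have c4: "const_regs (r3(19 := ?N))"
            by (rule const_regs_frame[OF c3, of "{19}"]) auto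
          have r3o: "r3 16 = off" using fr3 fr2 fr1 off by simp
          let ?cov = "\<lambda>e. covered ((\<lambda>e. {fst_key e, snd_key e}) ` {..<?N}) (fst_key e) (snd_key e)"
          have 5: "runs w detect_prog r4 h4 (8000 * (251 * m + 2 * F + R + 60)) (\<lambda>r' h'.
            r' 16 = off + 16000 * B \<and> (\<forall>a \<ge> off + 16000 * B. h' a = 0) \<and>
            (\<forall>a < b0. h' a = (if bR \<le> a \<and> a < bR + ?N then
               (if ?cov (a - bR) then 1 else 0) else h3 a)))"
            unfolding r4
          proof (rule runs_detect_prog[OF c4 _ _ _ off(2,3) z3 _ _ _ items_inj])
            show "fst_key e \<noteq> snd_key e" if "e < ?N" for e using keys_distinct[OF that] by metis
          qed (use keys3 keysB lenE r3o in auto)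
          show "runs w (detect_prog ;; filter_prog) r4 h4 (2008924 * m + 16000 * F + 8000 * R + 480960) ?Q"
          proof (rule runs_Seq[OF 5])
            fix r5 h5 assume Q5: "r5 16 = off + 16000 * B \<and> (\<forall>a \<ge> off + 16000 * B. h5 a = 0) \<and>
              (\<forall>a < b0. h5 a = (if bR \<le> a \<and> a < bR + ?N then (if ?cov (a - bR) then 1 else 0) else h3 a))"
              and fr: "\<forall>x. x \<notin> writes detect_prog \<longrightarrow> r5 x = r4 x"
            have fr5: "r5 x = r3 x"
              if "x \<notin> {16, 19, 20, 23, 24, 25, 26, 27, 28, 30, 31, 32, 33, 34, 40}" "x < 50" for x
              using fr that r4 by (simp add: writes_detect_prog)
            have c5: "const_regs r5"
              by (rule const_regs_frame[OF c3, of "{16, 19, 20, 23, 24, 25, 26, 27, 28, 30, 31, 32, 33, 34, 40} \<union> {50..}"])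
                (use fr5 in auto)
            have E5: "r5 41 = length E" using fr5 E3 by simp
            have h5: "h5 a = h3 a" if "a < b0" "a < bR \<or> bC \<le> a" for a
            proof -
              have "\<not> (bR \<le> a \<and> a < bR + ?N)" using that lowB bases by linarith
              moreover have "h5 a = (if bR \<le> a \<and> a < bR + ?N then (if ?cov (a - bR) then 1 else 0) else h3 a)"
                using Q5 that by blast
              ultimately show ?thesis by (simp only: if_False)
            qed
            have hE5: "h5 (bE + q) = E ! q" if "q < length E" for q
            proof -
              have "bE + q < b0" "bC \<le> bE + q" "bL + B \<le> bE + q" using that lenE lowB bases by linarith+
              then show ?thesis using h5 Q3 hE2[OF that] by simp
            qed
            have hR5: "h5 (bR + 2 * m + q) = (if closes m u v (2 * d) (E ! q) then 1 else 0)"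
              if q: "q < length E" for q
            proof -
              have b: "bR + 2 * m + q < b0" using that lenE lowB bases by linarith
              then have "h5 (bR + 2 * m + q) = (if ?cov (2 * m + q) then 1 else 0)"
                using Q5 q by simp
              then show ?thesis unfolding covered_query[OF q] .
            qed
            have lessw: "c < 2 ^ w" if "c \<in> set E" for c using less2[OF that] bnd by linarith
            have 6: "runs w filter_prog r5 h5 (m * 24 + 3) (\<lambda>r' h'. r' 18 = length (next_level m u v d cs) \<and>
              (\<forall>q<length (next_level m u v d cs). h' (bC + q) = next_level m u v d cs ! q) \<and>
              (\<forall>a. a < bC \<or> bC + B \<le> a \<longrightarrow> h' a = h5 a))"
              unfolding next_level_def E_def[symmetric]
              by (rule runs_filter_prog[OF c5 E5 lenE(2) lessw hE5 hR5])
            show "runs w filter_prog r5 h5 (m * 24 + 3) ?Q"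
            proof (rule runs_mono[OF 6])
              fix r6 h6 assume Q6: "r6 18 = length (next_level m u v d cs) \<and>
                (\<forall>q<length (next_level m u v d cs). h6 (bC + q) = next_level m u v d cs ! q) \<and>
                (\<forall>a. a < bC \<or> bC + B \<le> a \<longrightarrow> h6 a = h5 a)"
                and fr: "\<forall>x. x \<notin> writes filter_prog \<longrightarrow> r6 x = r5 x"
              have "r6 17 = 2 * d" "r6 16 = off + 16000 * B"
                using fr Q5 fr5 fr3 Q2 unfolding writes_level_parts by simp_all
              moreover have "h6 (bU + j) = u j \<and> h6 (bV + j) = v j" if "j < m" for j
              proof -
                have "bU + j < bC" "bV + j < bC" "bU + j < bR" "bV + j < bR" "bU + j < b0" "bV + j < b0"
                  "bU + j < bK" "bV + j < bK"
                  using that lowB bases by linarith+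
                then show ?thesis using Q6 h5 Q3 uv2'[OF that] by simp
              qed
              moreover have "h6 a = 0" if a: "off + 16000 * B \<le> a" for a
              proof -
                have "bC + B \<le> a" using a bases off(2) by linarith
                then show ?thesis using Q6 Q5 a by simp
              qed
              ultimately show "?Q r6 h6" using Q6 by blast
            qed (simp_all add: algebra_simps)
          qed (simp_all add: algebra_simps)
        qed (simp_all add: algebra_simps)
      qed (simp_all add: algebra_simps)
    qed (simp_all add: algebra_simps)
  qed (simp_all add: algebra_simps)
qed

end

section \<open>Refinement and truncation of candidate lists\<close>

text \<open>
  Truncation is harmless: each of \<open>m\<close> closing candidates keeps a closing refinement, so their number
  never drops below \<open>m\<close> again. For \<open>d = 1\<close> the list of all edges need not consist of closing ones.
\<close>

definition candidates :: "nat \<Rightarrow> (nat \<Rightarrow> nat) \<Rightarrow> (nat \<Rightarrow> nat) \<Rightarrow> nat \<Rightarrow> nat list \<Rightarrow> bool" where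
  "candidates m u v d cs \<longleftrightarrow> distinct cs \<and> length cs \<le> m \<and> (\<forall>c \<in> set cs. c < m * d) \<and>
     ({c. closes m u v d c} \<subseteq> set cs \<or> length cs = m \<and> set cs \<subseteq> {c. closes m u v d c}) \<and>
     (d > 1 \<longrightarrow> set cs \<subseteq> {c. closes m u v d c})"

lemma closesI:
  "j1 < m \<Longrightarrow> j2 < m \<Longrightarrow> u j1 = u (c mod m) \<Longrightarrow> u j2 = v (c mod m) \<Longrightarrow> v j1 = v j2 \<Longrightarrow>
    v j1 mod d = c div m \<Longrightarrow> closes m u v d c"
  unfolding closes_def by blast

lemma closes_less:
  assumes "closes m u v d c" "0 < d" "0 < m"
  shows "c < m * d"
proof -
  have "c div m < d" using assms mod_less_divisor[of d] unfolding closes_def by metis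
  then show ?thesis using assms(3) by (simp add: div_less_iff_less_mult mult.commute)
qed

lemma candidates_start:
  assumes "0 < m"
  shows "candidates m u v 1 [0..<m]"
  unfolding candidates_def using closes_less[of m u v 1] assms by auto

lemma filter_pairs_length:
  "(\<And>c. c \<in> set cs \<Longrightarrow> P c \<or> P (f c)) \<Longrightarrow> length cs \<le> length (filter P (cs @ map f cs))"
  by (induction cs) fastforce+

text \<open>The residue of the apex modulo \<open>2 * d\<close> determines its residue modulo
  \<open>d\<close>, so the same triangle witnesses the parent. A complete list for \<open>d\<close>
  thus refines to a complete list for \<open>2 * d\<close>.\<close>

lemma closes_parent:
  assumes c: "closes m u v (2 * d) c" and d: "0 < d" and m: "0 < m"
  shows "closes m u v d c \<or> (\<exists>c'. c = c' + m * d \<and> closes m u v d c')"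
proof -
  obtain j1 j2 where j: "j1 < m" "j2 < m" "u j1 = u (c mod m)" "u j2 = v (c mod m)" "v j1 = v j2"
    "v j1 mod (2 * d) = c div m" using c unfolding closes_def by blast
  have modd: "v j1 mod d = c div m mod d"
    unfolding j(6)[symmetric] by (simp add: mod_mod_cancel)
  have lt: "c div m < 2 * d" using j(6) d mod_less_divisor[of "2 * d" "v j1"] by linarith
  show ?thesis
  proof (cases "c div m < d")
    case True
    then have "v j1 mod d = c div m" using modd by simp
    then have "closes m u v d c" using j by (intro closesI[of j1 m j2])
    then show ?thesis ..
  next
    case False
    define c' where "c' = c - m * d"
    have "m * d \<le> m * (c div m)" using False by simp
    also have "\<dots> \<le> c" by simp
    finally have c': "c = c' + m * d" unfolding c'_def by simp
    have div: "c div m = c' div m + d" "c mod m = c' mod m" unfolding c' using m by simp_all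
    have "c' div m < d" using div lt by linarith
    then have "v j1 mod d = c' div m" using modd div by simp
    then have "closes m u v d c'" using j div by (intro closesI[of j1 m j2]) simp_all
    then show ?thesis using c' by blast
  qed
qed

text \<open>The residue of the witnessing apex modulo \<open>2 * d\<close> is either
  \<open>i\<close> or \<open>i + d\<close>, so one refinement closes with the same triangle. Even a
  truncated list therefore loses no entry.\<close>

lemma closes_child:
  assumes c: "closes m u v d c" and d: "0 < d" and m: "0 < m"
  shows "closes m u v (2 * d) c \<or> closes m u v (2 * d) (c + m * d)"
proof -
  obtain j1 j2 where j: "j1 < m" "j2 < m" "u j1 = u (c mod m)" "u j2 = v (c mod m)" "v j1 = v j2"
    "v j1 mod d = c div m" using c unfolding closes_def by blast
  have "v j1 mod (2 * d) = v j1 mod d \<or> v j1 mod (2 * d) = v j1 mod d + d"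
  proof -
    have lt: "v j1 mod (2 * d) < 2 * d" using d by simp
    have eq: "v j1 mod d = v j1 mod (2 * d) mod d" by (simp add: mod_mod_cancel)
    show ?thesis
    proof (cases "v j1 mod (2 * d) < d")
      case True
      then show ?thesis using eq by simp
    next
      case False
      then have "v j1 mod (2 * d) mod d = v j1 mod (2 * d) - d"
        using lt le_mod_geq[of d "v j1 mod (2 * d)"] by simp
      then show ?thesis using eq False by simp
    qed
  qed
  then show ?thesis
  proof
    assume "v j1 mod (2 * d) = v j1 mod d"
    then have "closes m u v (2 * d) c" using j by (intro closesI[of j1 m j2]) simp_all
    then show ?thesis ..
  next
    assume *: "v j1 mod (2 * d) = v j1 mod d + d"
    have "(c + m * d) div m = c div m + d" "(c + m * d) mod m = c mod m" using m by simp_all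
    then have "closes m u v (2 * d) (c + m * d)" using j * by (intro closesI[of j1 m j2]) simp_all
    then show ?thesis ..
  qed
qed

lemma candidates_next_level:
  assumes cs: "candidates m u v d cs" and d: "0 < d" and m: "0 < m"
  shows "candidates m u v (2 * d) (next_level m u v d cs)"
proof -
  let ?E = "cs @ map (\<lambda>c. c + m * d) cs"
  let ?F = "filter (closes m u v (2 * d)) ?E"
  have dist: "distinct ?F"
    unfolding distinct_append distinct_map using cs unfolding candidates_def
    by (intro distinct_filter) (force simp: distinct_map inj_on_def)
  have sub: "set (take m ?F) \<subseteq> {c. closes m u v (2 * d) c}" using set_take_subset[of m ?F] by auto
  have "{c. closes m u v (2 * d) c} \<subseteq> set (take m ?F) \<or> length (take m ?F) = m"
  proof (cases "{c. closes m u v d c} \<subseteq> set cs")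
    case True
    have "{c. closes m u v (2 * d) c} \<subseteq> set ?F"
    proof
      fix c assume c: "c \<in> {c. closes m u v (2 * d) c}"
      then have "c \<in> set ?E" using closes_parent[OF _ d m, of u v c] True by auto
      then show "c \<in> set ?F" using c by simp
    qed
    then show ?thesis by (cases "length ?F \<le> m") auto
  next
    case False
    then have "length cs = m" "set cs \<subseteq> {c. closes m u v d c}" using cs unfolding candidates_def by auto
    then have "m \<le> length ?F"
      using filter_pairs_length[of cs "closes m u v (2 * d)" "\<lambda>c. c + m * d"] closes_child[OF _ d m, of u v]
      by blast
    then have "length (take m ?F) = m" by (simp only: length_take min_absorb2)
    then show ?thesis ..
  qed
  moreover have "c < m * (2 * d)" if "c \<in> set (take m ?F)" for c
    using closes_less[of m u v "2 * d" c] sub that d m by auto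
  moreover have "distinct (take m ?F)" using dist by (rule distinct_take)
  moreover have "length (take m ?F) \<le> m" by (simp only: length_take min.cobounded2)
  ultimately show ?thesis
    unfolding candidates_def next_level_def using sub by blast
qed

text \<open>Once \<open>n <= d\<close>, the residue is the apex itself, and closing codes correspond
  bijectively to triangles. The assumption \<open>1 < d\<close> rules out the initial list, whose
  entries need not close.\<close>

lemma correct_listing_candidates:
  assumes G: "graph V E" and pres: "presents n es V E" and m: "length es = m" "0 < m"
    and uv: "\<And>j. j < m \<Longrightarrow> u j < v j \<and> {u j, v j} = unordered (es ! j)"
    and cs: "candidates m u v d cs" and d: "n \<le> d" "1 < d"
  shows "correct_listing V E m (map (\<lambda>c. (u (c mod m), v (c mod m), c div m)) cs)"
proof -
  define f where "f = (\<lambda>c. {u (c mod m), v (c mod m), c div m})"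
  let ?C = "{c. closes m u v d c}"
  have E: "E = (\<lambda>j. {u j, v j}) ` {..<m}"
  proof -
    have "E = (\<lambda>j. unordered (es ! j)) ` {..<m}"
    proof -
      have "set es = (!) es ` {..<m}" using m by (auto simp: set_conv_nth)
      then show ?thesis using pres unfolding presents_def by (simp add: image_image)
    qed
    also have "\<dots> = (\<lambda>j. {u j, v j}) ` {..<m}" by (rule image_cong) (use uv in auto)
    finally show ?thesis .
  qed
  have vn: "v j < n" if "j < m" for j
  proof -
    have "{u j, v j} \<in> E" unfolding E using that by blast
    then show ?thesis using G pres unfolding graph_def presents_def by blast
  qed
  have closesD: "c mod m < m \<and> u (c mod m) < v (c mod m) \<and> v (c mod m) < c div m \<and> c div m < n \<and>
      {u (c mod m), c div m} \<in> E \<and> {v (c mod m), c div m} \<in> E \<and> {u (c mod m), v (c mod m)} \<in> E"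
    if c: "c \<in> ?C" for c
  proof -
    obtain j1 j2 where j: "j1 < m" "j2 < m" "u j1 = u (c mod m)" "u j2 = v (c mod m)" "v j1 = v j2"
      "v j1 mod d = c div m" using c unfolding closes_def by blast
    \<comment> \<open>Reduction modulo \<open>d\<close> does nothing here, because
      \<open>v j1 < n <= d\<close>.\<close>
    have v: "v j1 = c div m" using j(6) vn[OF j(1)] d by simp
    have cm: "c mod m < m" using m by simp
    have "{u j1, v j1} \<in> E" "{u j2, v j2} \<in> E" "{u (c mod m), v (c mod m)} \<in> E"
      unfolding E using j(1,2) cm by blast+
    then show ?thesis using j v cm uv[OF cm] uv[OF j(2)] vn[OF j(1)] by auto
  qed
  have tri: "f c \<in> triangles V E" if "c \<in> ?C" for c
  proof -
    note * = closesD[OF that]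
    have sub: "f c \<subseteq> V" unfolding f_def using * G unfolding graph_def by blast
    have com: "{c div m, u (c mod m)} \<in> E" "{c div m, v (c mod m)} \<in> E" "{v (c mod m), u (c mod m)} \<in> E"
      using * by (simp_all add: insert_commute)
    have "card (f c) = 3" unfolding f_def using * by auto
    then show ?thesis using sub * com unfolding triangles_def f_def by simp
  qed
  have inj: "inj_on f ?C"
  proof (rule inj_onI)
    fix c c' assume c: "c \<in> ?C" and c': "c' \<in> ?C" and eq: "f c = f c'"
    note o = closesD[OF c] and o' = closesD[OF c']
    \<comment> \<open>The vertex set determines the code: its extremes are the smaller endpoint and
      the apex, what remains is the larger endpoint, and the two endpoints identify the
      edge.\<close>
    have mn: "Min (f c) = u (c mod m)" "Min (f c') = u (c' mod m)" "Max (f c) = c div m" "Max (f c') = c' div m"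
      unfolding f_def using o o' by (auto intro!: Min_eqI Max_eqI)
    then have uc: "u (c mod m) = u (c' mod m)" "c div m = c' div m" using eq by simp_all
    have "f c - {u (c mod m), c div m} = {v (c mod m)}" "f c' - {u (c' mod m), c' div m} = {v (c' mod m)}"
      unfolding f_def using o o' by auto
    then have vc: "v (c mod m) = v (c' mod m)" using eq uc by simp
    have "c mod m < length es" "c' mod m < length es" using o o' m by auto
    moreover have "map unordered es ! (c mod m) = map unordered es ! (c' mod m)"
      using calculation uv[of "c mod m"] uv[of "c' mod m"] uc vc m by simp
    moreover have "distinct (map unordered es)" using pres unfolding presents_def by simp
    ultimately have "c mod m = c' mod m" by (simp add: nth_eq_iff_index_eq del: nth_map)
    then show "c = c'" using uc(2) by (metis div_mult_mod_eq)
  qed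
  have edgeD: "\<exists>j<m. u j = a \<and> v j = b" if "{a, b} \<in> E" "a < b" for a b
  proof -
    obtain j where j: "j < m" "{a, b} = {u j, v j}" using \<open>{a, b} \<in> E\<close> unfolding E by blast
    have "u j < v j" using uv[OF j(1)] by blast
    then have "u j = a \<and> v j = b" using j(2) that(2) by (auto simp: doubleton_eq_iff)
    then show ?thesis using j(1) by blast
  qed
  have surj: "T \<in> f ` ?C" if T: "T \<in> triangles V E" for T
  proof -
    have T3: "card T = 3" "\<And>x y. x \<in> T \<Longrightarrow> y \<in> T \<Longrightarrow> x \<noteq> y \<Longrightarrow> {x, y} \<in> E"
      using T unfolding triangles_def by auto
    obtain a b c where abc: "T = {a, b, c}" "a < b" "b < c"
    proof -
      obtain x y z where xyz: "T = {x, y, z}" "x \<noteq> y" "x \<noteq> z" "y \<noteq> z"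
        using T3(1) by (auto simp: card_3_iff)
      have perm: "T = {x, z, y}" "T = {y, x, z}" "T = {y, z, x}" "T = {z, x, y}" "T = {z, y, x}"
        using xyz(1) by auto
      consider "x < y" "y < z" | "x < z" "z < y" | "y < x" "x < z" | "y < z" "z < x"
        | "z < x" "x < y" | "z < y" "y < x"
        using xyz(2-4) by linarith
      then show thesis
      proof cases
        case 1
        then show ?thesis by (rule that[OF xyz(1)])
      next
        case 2
        then show ?thesis by (rule that[OF perm(1)])
      next
        case 3
        then show ?thesis by (rule that[OF perm(2)])
      next
        case 4
        then show ?thesis by (rule that[OF perm(3)])
      next
        case 5
        then show ?thesis by (rule that[OF perm(4)])
      next
        case 6
        then show ?thesis by (rule that[OF perm(5)])
      qed
    qed
    then have edges: "{a, b} \<in> E" "{a, c} \<in> E" "{b, c} \<in> E" using T3(2) by auto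
    obtain j where j: "j < m" "u j = a" "v j = b" using edgeD[OF edges(1) abc(2)] by blast
    obtain j1 where j1: "j1 < m" "u j1 = a" "v j1 = c" using edgeD[OF edges(2)] abc by auto
    obtain j2 where j2: "j2 < m" "u j2 = b" "v j2 = c" using edgeD[OF edges(3)] abc by auto
    define code where "code = j + m * c"
    have code: "code mod m = j" "code div m = c" unfolding code_def using j(1) by simp_all
    have "c < d" using vn[OF j1(1)] j1 d by simp
    then have "closes m u v d code" using j j1 j2 code by (intro closesI[of j1 m j2]) simp_all
    moreover have "f code = T" unfolding f_def code using j abc by simp
    ultimately show ?thesis by blast
  qed
  have img: "f ` ?C = triangles V E" using tri surj by blast
  have finV: "finite (triangles V E)"
    by (rule finite_subset[of _ "Pow V"]) (use G in \<open>auto simp: triangles_def graph_def\<close>)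
  have finC: "finite ?C" using finite_imageD[OF _ inj] img finV by simp
  have card: "card (triangles V E) = card ?C" using card_image[OF inj] img by simp
  have cs': "distinct cs" "length cs \<le> m" "set cs \<subseteq> ?C" "?C \<subseteq> set cs \<or> length cs = m"
    using cs d(2) unfolding candidates_def by auto
  have lenC: "length cs \<le> card ?C" using card_mono[OF finC cs'(3)] distinct_card[OF cs'(1)] by simp
  let ?ts = "map f cs"
  have "distinct ?ts" using cs'(1,3) inj by (simp add: distinct_map inj_on_subset)
  \<comment> \<open>With fewer than \<open>m\<close> triangles the list cannot have length
    \<open>m\<close>, since its entries are distinct closing codes; so it is complete.\<close>
  moreover have "set ?ts = triangles V E" if "card (triangles V E) < m"
  proof -
    have "?C \<subseteq> set cs" using cs'(4) lenC that card by auto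
    then have "set cs = ?C" using cs'(3) by blast
    then show ?thesis using img by simp
  qed
  moreover have "length ?ts = m \<and> set ?ts \<subseteq> triangles V E" if "\<not> card (triangles V E) < m"
  proof
    show "length ?ts = m"
    proof (cases "length cs = m")
      case False
      then have "set cs = ?C" using cs'(3,4) by auto
      then have "card ?C = length cs" using distinct_card[OF cs'(1)] by simp
      then show ?thesis using cs'(2) that card by simp
    qed simp
    show "set ?ts \<subseteq> triangles V E" using cs'(3) img by auto
  qed
  moreover have "map (\<lambda>(a, b, c). {a, b, c}) (map (\<lambda>c. (u (c mod m), v (c mod m), c div m)) cs) = ?ts"
    unfolding f_def by simp
  ultimately show ?thesis unfolding correct_listing_def Let_def by presburger
qed

section \<open>The listing program\<close>

text \<open>The edge list starts at cell 4, after the length, \<open>t\<close>, \<open>n\<close> and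
  \<open>m\<close>. The initial candidate for edge \<open>j\<close> is \<open>j\<close> itself, that
  is \<open>j + m * 0\<close>, because 0 is the only residue modulo 1.\<close>

definition copy_prog :: prog where
  "copy_prog = For 26 4 (Op 31 Add 26 26 ;; Op 31 Add 31 2 ;; Op 31 Add 31 2 ;; Load 32 31 ;;
     Op 31 Add 31 1 ;; Load 33 31 ;;
     Branch (Less 32 33) Skip (Op 34 Add 32 0 ;; Op 32 Add 33 0 ;; Op 33 Add 34 0) ;;
     Op 31 Add 9 26 ;; Store 31 32 ;; Op 31 Add 10 26 ;; Store 31 33 ;; Op 31 Add 14 26 ;; Store 31 26)"

lemma writes_copy_prog: "writes copy_prog = {26, 31, 32, 33, 34}"
  unfolding copy_prog_def by auto

text \<open>The output overwrites the input, which is harmless because everything it needs was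
  copied to arrays from \<open>B\<close> on. Its length is read off the write address at the end,
  one less than the next free cell.\<close>

definition output_prog :: prog where
  "output_prog = Const 27 1 ;;
     For 26 18 (Op 31 Add 14 26 ;; Load 31 31 ;; Op 32 Mod 31 4 ;; Op 33 Div 31 4 ;;
       Op 34 Add 9 32 ;; Load 34 34 ;; Store 27 34 ;; Op 27 Add 27 1 ;;
       Op 34 Add 10 32 ;; Load 34 34 ;; Store 27 34 ;; Op 27 Add 27 1 ;;
       Store 27 33 ;; Op 27 Add 27 1) ;;
     Op 27 Sub 27 1 ;; Store 0 27"

lemma nth_Cons3_concat:
  "k < length L \<Longrightarrow> concat (map (\<lambda>(a, b, c). [a, b, c]) L) ! (3 * k) = fst (L ! k) \<and>
    concat (map (\<lambda>(a, b, c). [a, b, c]) L) ! (3 * k + 1) = fst (snd (L ! k)) \<and>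
    concat (map (\<lambda>(a, b, c). [a, b, c]) L) ! (3 * k + 2) = snd (snd (L ! k))"
proof (induction L arbitrary: k)
  case (Cons x L)
  obtain a b c where x: "x = (a, b, c)" by (cases x)
  show ?case
  proof (cases k)
    case 0
    then show ?thesis using x by (simp add: numeral_2_eq_2)
  next
    case (Suc k')
    have idx: "3 * Suc k' = Suc (Suc (Suc (3 * k')))" "3 * Suc k' + 1 = Suc (Suc (Suc (3 * k' + 1)))"
      "3 * Suc k' + 2 = Suc (Suc (Suc (3 * k' + 2)))" by simp_all
    show ?thesis using Cons.IH[of k'] Cons.prems Suc x unfolding Suc idx by simp
  qed
qed simp

lemma length_concat_triples: "length (concat (map (\<lambda>(a, b, c). [a, b, c]) L)) = 3 * length L"
  by (induction L) auto

context ram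
begin

lemma runs_copy_prog:
  assumes c: "const_regs r"
    and h: "\<And>j. j < m \<Longrightarrow> h (4 + 2 * j) = fst (es ! j) \<and> h (5 + 2 * j) = snd (es ! j) \<and>
      fst (es ! j) < 2 * m \<and> snd (es ! j) < 2 * m"
  shows "runs w copy_prog r h (m * 18 + 2) (\<lambda>r' h'.
    (\<forall>j<m. h' (bU + j) = min (fst (es ! j)) (snd (es ! j)) \<and>
       h' (bV + j) = max (fst (es ! j)) (snd (es ! j)) \<and> h' (bC + j) = j) \<and>
    (\<forall>a \<ge> b0. h' a = h a))"
proof -
  note cD = const_regsD[OF c]
  let ?I = "\<lambda>k r' h'. (\<forall>j<k. h' (bU + j) = min (fst (es ! j)) (snd (es ! j)) \<and>
       h' (bV + j) = max (fst (es ! j)) (snd (es ! j)) \<and> h' (bC + j) = j) \<and>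
    (\<forall>a. a < B \<or> b0 \<le> a \<longrightarrow> h' a = h a)"
  let ?body = "Op 31 Add 26 26 ;; Op 31 Add 31 2 ;; Op 31 Add 31 2 ;; Load 32 31 ;;
     Op 31 Add 31 1 ;; Load 33 31 ;;
     Branch (Less 32 33) Skip (Op 34 Add 32 0 ;; Op 32 Add 33 0 ;; Op 33 Add 34 0) ;;
     Op 31 Add 9 26 ;; Store 31 32 ;; Op 31 Add 10 26 ;; Store 31 33 ;; Op 31 Add 14 26 ;; Store 31 26"
  have mB: "4 * m + 100 < B" "B \<le> bU" "bU + B \<le> bV" "bV + B \<le> bC" "bC + B \<le> b0" "b0 \<le> 2 ^ w" "m < 2 ^ w"
    using B_large bases by linarith+
  have "runs w (For 26 4 ?body) r h (m * 18 + 2) (?I (r 4))"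
  proof (rule runs_For[where T = 16])
    fix k r' h' assume k: "k < r 4" "r' 26 = k" and
      fr: "\<forall>x. x \<notin> insert 26 (writes ?body) \<longrightarrow> r' x = r x" and I: "?I k r' h'"
    have fr': "r' 0 = 0" "r' (Suc 0) = 1" "r' 1 = 1" "r' 2 = 2" "r' 9 = bU" "r' 10 = bV" "r' 14 = bC"
      using fr cD by simp_all
    have km: "k < m" using k cD by simp
    define x y where "x = fst (es ! k)" and "y = snd (es ! k)"
    have lt: "4 + 2 * k < B" "5 + 2 * k < B" using km mB by linarith+
    have ld: "h' (4 + 2 * k) = x" "h' (5 + 2 * k) = y" "x < 2 * m" "y < 2 * m"
      using I h[OF km] lt unfolding x_def y_def by auto
    have idx: "4 + 2 * k = Suc (Suc (Suc (Suc (k + k))))" "5 + 2 * k = Suc (Suc (Suc (Suc (Suc (k + k)))))"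
      by simp_all
    have ld': "h' (Suc (Suc (Suc (Suc (k + k))))) = x" "h' (Suc (Suc (Suc (Suc (Suc (k + k)))))) = y"
      using ld(1,2) unfolding idx by simp_all
    have ws: "k + k < 2 ^ w" "Suc (Suc (k + k)) < 2 ^ w" "Suc (Suc (Suc (Suc (k + k)))) < 2 ^ w"
      "Suc (Suc (Suc (Suc (Suc (k + k))))) < 2 ^ w" "x < 2 ^ w" "y < 2 ^ w"
      "bU + k < 2 ^ w" "bV + k < 2 ^ w" "bC + k < 2 ^ w"
      using km mB ld by linarith+
    have "runs w ?body r' h' 16 (\<lambda>r'' h''. h'' = h'(bU + k := min x y, bV + k := max x y, bC + k := k))"
    proof (cases "x < y")
      case True
      then have mm: "min x y = x" "max x y = y" by simp_all
      show ?thesis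
        unfolding mm by (rule runs_wp)
          (simp_all add: ld' ws True k(2) fr' del: fun_upd_apply add: fun_upd_same fun_upd_other)
    next
      case False
      then have mm: "min x y = y" "max x y = x" by simp_all
      show ?thesis
        unfolding mm by (rule runs_wp)
          (simp_all add: ld' ws False k(2) fr' del: fun_upd_apply add: fun_upd_same fun_upd_other)
    qed
    then show "runs w ?body r' h' 16 (\<lambda>r'' h''. ?I (Suc k) (r''(26 := Suc k)) h'')"
    proof (rule runs_mono)
      fix r'' h'' :: "nat \<Rightarrow> nat" assume Q: "h'' = h'(bU + k := min x y, bV + k := max x y, bC + k := k)"
      show "?I (Suc k) (r''(26 := Suc k)) h''"
      proof (intro conjI allI impI)
        fix j assume "j < Suc k"
        then have "j < k \<or> j = k" by auto
        then show "h'' (bU + j) = min (fst (es ! j)) (snd (es ! j))"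
          "h'' (bV + j) = max (fst (es ! j)) (snd (es ! j))" "h'' (bC + j) = j"
          using Q I km mB unfolding x_def y_def by auto
      next
        fix a assume "a < B \<or> b0 \<le> a"
        then show "h'' a = h a" using Q I km mB by auto
      qed
    qed simp
  qed (use cD mB in auto)
  then show ?thesis unfolding copy_prog_def
    by (rule runs_mono) (use cD in simp_all)
qed

lemma runs_output_prog:
  assumes c: "const_regs r" and cs: "r 18 = length cs" "length cs \<le> m"
    and less: "\<And>c. c \<in> set cs \<Longrightarrow> c < 2 ^ w"
    and h: "\<And>q. q < length cs \<Longrightarrow> h (bC + q) = cs ! q"
    and uv: "\<And>j. j < m \<Longrightarrow> h (bU + j) = u j \<and> h (bV + j) = v j \<and> u j < 2 * m \<and> v j < 2 * m"
  shows "runs w output_prog r h (m * 16 + 5) (\<lambda>r' h'.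
    has_output (r', h') (concat (map (\<lambda>(a, b, c). [a, b, c])
      (map (\<lambda>c. (u (c mod m), v (c mod m), c div m)) cs))))"
proof -
  note cD = const_regsD[OF c]
  let ?L = "map (\<lambda>c. (u (c mod m), v (c mod m), c div m)) cs"
  let ?out = "concat (map (\<lambda>(a, b, c). [a, b, c]) ?L)"
  let ?I = "\<lambda>k r' h'. r' 27 = 3 * k + 1 \<and> (\<forall>i<3 * k. h' (Suc i) = ?out ! i) \<and>
    (\<forall>a. B \<le> a \<longrightarrow> h' a = h a)"
  let ?body = "Op 31 Add 14 26 ;; Load 31 31 ;; Op 32 Mod 31 4 ;; Op 33 Div 31 4 ;;
       Op 34 Add 9 32 ;; Load 34 34 ;; Store 27 34 ;; Op 27 Add 27 1 ;;
       Op 34 Add 10 32 ;; Load 34 34 ;; Store 27 34 ;; Op 27 Add 27 1 ;;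
       Store 27 33 ;; Op 27 Add 27 1"
  have mB: "4 * m + 100 < B" "B \<le> bU" "bU + B \<le> bV" "bV + B \<le> bC" "bC + B \<le> 2 ^ w" "m < 2 ^ w" "m > 0"
    using B_large bases m3 by linarith+
  have w1: "(1::nat) < 2 ^ w" using mB by linarith
  show ?thesis unfolding output_prog_def
  proof (rule runs_Seq)
    show "runs w (Const 27 1) r h 1 (\<lambda>r' h'. r' = r(27 := 1) \<and> h' = h)"
      by (rule runs_wp) (use w1 in simp_all)
  next
    fix r1 h1 assume "r1 = r(27 := 1) \<and> h1 = h"
    then have r1: "r1 = r(27 := 1)" "h1 = h" by auto
    have r1D: "r1 0 = 0" "r1 (Suc 0) = 1" "r1 1 = 1" "r1 4 = m" "r1 9 = bU" "r1 10 = bV" "r1 14 = bC" "r1 18 = length cs"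
      "r1 27 = 1" using r1 cD cs by simp_all
    have loop: "runs w (For 26 18 ?body) r1 h1 (m * 16 + 2) (?I (r1 18))"
    proof (rule runs_For[where T = 14])
      show "?I 0 (r1(26 := 0)) h1" using r1D r1 by simp
    next
      fix k r' h' assume k: "k < r1 18" "r' 26 = k" and
        fr: "\<forall>x. x \<notin> insert 26 (writes ?body) \<longrightarrow> r' x = r1 x" and I: "?I k r' h'"
      have fr': "r' (Suc 0) = 1" "r' 1 = 1" "r' 4 = m" "r' 9 = bU" "r' 10 = bV" "r' 14 = bC"
        using fr r1D by simp_all
      have kn: "k < length cs" "k < m" using k r1D cs by simp_all
      define j i where "j = cs ! k mod m" and "i = cs ! k div m"
      have j: "j < m" unfolding j_def using mB by simp
      have ck: "cs ! k < 2 ^ w" using less kn by simp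
      have ldC: "h' (bC + k) = cs ! k" using I h[OF kn(1)] mB by simp
      have ld: "h' (bU + j) = u j" "h' (bV + j) = v j" using I uv[OF j] mB by simp_all
      have uvj: "u j < 2 * m" "v j < 2 * m" using uv[OF j] by auto
      have r27: "r' 27 = 3 * k + 1" using I by blast
      have iw: "i < 2 ^ w" unfolding i_def using ck div_le_dividend[of "cs ! k" m] by linarith
      have ws: "bC + k < 2 ^ w" "j < 2 ^ w" "bU + j < 2 ^ w" "bV + j < 2 ^ w" "u j < 2 ^ w" "v j < 2 ^ w"
        "3 * k + 1 + 1 < 2 ^ w" "3 * k + 1 + 1 + 1 < 2 ^ w" "3 * k + 1 + 1 + 1 + 1 < 2 ^ w"
        using kn j mB uvj by linarith+
      have ld2: "(h'(3 * k + 1 := u j)) (bV + j) = v j" using ld kn mB by simp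
      have "runs w ?body r' h' 14 (\<lambda>r'' h''. r'' 27 = 3 * k + 1 + 1 + 1 + 1 \<and>
          h'' = h'(3 * k + 1 := u j, 3 * k + 1 + 1 := v j, 3 * k + 1 + 1 + 1 := i))"
        by (rule runs_wp) (use fr' k(2) ldC ld ld2 ws iw ck r27 in
          \<open>simp_all del: fun_upd_apply One_nat_def Suc_eq_plus1 add_Suc_right add_Suc add: fun_upd_same fun_upd_other
            j_def[symmetric] i_def[symmetric]\<close>)
      then show "runs w ?body r' h' 14 (\<lambda>r'' h''. ?I (Suc k) (r''(26 := Suc k)) h'')"
      proof (rule runs_mono)
        fix r'' h'' :: "nat \<Rightarrow> nat"
        assume Q: "r'' 27 = 3 * k + 1 + 1 + 1 + 1 \<and>
          h'' = h'(3 * k + 1 := u j, 3 * k + 1 + 1 := v j, 3 * k + 1 + 1 + 1 := i)"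
        have Lk: "k < length ?L" "?L ! k = (u j, v j, i)" using kn unfolding j_def i_def by simp_all
        note out = nth_Cons3_concat[OF Lk(1), unfolded Lk(2) fst_conv snd_conv]
        show "?I (Suc k) (r''(26 := Suc k)) h''"
        proof (intro conjI allI impI)
          show "(r''(26 := Suc k)) 27 = 3 * Suc k + 1" using Q by simp
        next
          fix a assume a: "a < 3 * Suc k"
          then have "a < 3 * k + 3" by simp
          then consider "a < 3 * k" | "a = 3 * k" | "a = 3 * k + 1" | "a = 3 * k + 2" by linarith
          then show "h'' (Suc a) = ?out ! a"
          proof cases
            case 1
            then have "h'' (Suc a) = h' (Suc a)" using Q by simp
            then show ?thesis using I 1 by simp
          next
            case 2
            then have "h'' (Suc a) = u j" using Q by simp
            then show ?thesis using out 2 by simp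
          next
            case 3
            then have "h'' (Suc a) = v j" using Q by simp
            then show ?thesis using out 3 by metis
          next
            case 4
            then have "h'' (Suc a) = i" using Q by simp
            then show ?thesis using out 4 by metis
          qed
        next
          fix a assume "B \<le> a"
          then show "h'' a = h a" using Q I kn mB by simp
        qed
      qed simp
    qed (use r1D mB cs in auto)
    show "runs w (For 26 18 ?body ;; Op 27 Sub 27 1 ;; Store 0 27) r1 h1 (m * 16 + 4)
        (\<lambda>r' h'. has_output (r', h') ?out)"
    proof (rule runs_Seq[OF loop])
      fix r2 h2 assume I: "?I (r1 18) r2 h2" and fr: "\<forall>x. x \<notin> writes (For 26 18 ?body) \<longrightarrow> r2 x = r1 x"
      have r2: "r2 0 = 0" "r2 (Suc 0) = 1" "r2 27 = 3 * length cs + 1" using fr r1D I by simp_all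
      have w3: "3 * length cs < 2 ^ w" using cs mB by linarith
      have out: "length ?out = 3 * length cs" unfolding length_concat_triples by simp
      have "runs w (Op 27 Sub 27 1 ;; Store 0 27) r2 h2 2 (\<lambda>r' h'. h' = h2(0 := 3 * length cs))"
        by (rule runs_wp) (use r2 w3 in simp_all)
      then show "runs w (Op 27 Sub 27 1 ;; Store 0 27) r2 h2 2 (\<lambda>r' h'. has_output (r', h') ?out)"
      proof (rule runs_mono)
        fix r' h' :: "nat \<Rightarrow> nat" assume h': "h' = h2(0 := 3 * length cs)"
        show "has_output (r', h') ?out"
          unfolding has_output_def
        proof (intro allI impI)
          fix a assume a: "a \<le> length ?out"
          show "snd (r', h') a = (length ?out # ?out) ! a"
          proof (cases a)
            case 0
            then show ?thesis using h' out by simp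
          next
            case (Suc a')
            then have "a' < 3 * length cs" using a out by linarith
            then have "h2 (Suc a') = ?out ! a'" using I r1D by simp
            then show ?thesis using h' Suc by simp
          qed
        qed
      qed simp
    qed simp
  qed simp
qed

end

section \<open>Doubling the modulus until every vertex is below it or the residues are exact\<close>

context edge_detector
begin

text \<open>The test fails as soon as the modulus reaches \<open>n\<close>, hence after at most
  \<open>K\<close> rounds. A round starts only with \<open>2 ^ k < n <= 2 * m\<close>, so the
  doubled modulus never exceeds the bound \<open>4 * m\<close> on which the keys rely.\<close>

lemma runs_levels:
  assumes c: "const_regs r" and d: "r 17 = 1" and r18: "r 18 = m" and off: "r 16 = b0"
    and K: "n \<le> 2 ^ K" "b0 + K * (16000 * B) < 2 ^ w"
    and hC: "\<And>q. q < m \<Longrightarrow> h (bC + q) = q"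
    and uv: "\<And>j. j < m \<Longrightarrow> h (bU + j) = u j \<and> h (bV + j) = v j"
    and edges: "\<And>j. j < m \<Longrightarrow> u j < v j \<and> v j < n" and inj: "inj_on (\<lambda>j. (u j, v j)) {..<m}"
    and n1: "1 < n"
    and z: "\<And>a. b0 \<le> a \<Longrightarrow> h a = 0"
  shows "runs w (Loop (Less 17 5) level_prog) r h (K * (2009000 * m + 16000 * F + 8000 * R + 481001) + 1)
    (\<lambda>r' h'. \<exists>d cs. n \<le> d \<and> 1 < d \<and> d \<le> 4 * m \<and> candidates m u v d cs \<and> r' 18 = length cs \<and>
      (\<forall>q<length cs. h' (bC + q) = cs ! q) \<and> (\<forall>j<m. h' (bU + j) = u j \<and> h' (bV + j) = v j))"
proof -
  let ?I = "\<lambda>k r' h'. const_regs r' \<and> r' 17 = 2 ^ k \<and> r' 16 = b0 + k * (16000 * B) \<and> 2 ^ k \<le> 4 * m \<and>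
    (\<exists>cs. candidates m u v (2 ^ k) cs \<and> r' 18 = length cs \<and> (\<forall>q<length cs. h' (bC + q) = cs ! q)) \<and>
    (\<forall>j<m. h' (bU + j) = u j \<and> h' (bV + j) = v j) \<and> (\<forall>a \<ge> b0 + k * (16000 * B). h' a = 0)"
  have m0: "0 < m" using m3 by simp
  have "runs w (Loop (Less 17 5) level_prog) r h (K * (2009000 * m + 16000 * F + 8000 * R + 481001) + 1)
     (\<lambda>r' h'. \<not> holds (Less 17 5) r' \<and> (\<exists>k \<le> K. ?I k r' h'))"
  proof (rule runs_Loop[where T = "2009000 * m + 16000 * F + 8000 * R + 481000"])
    show "?I 0 r h"
      using c d r18 off hC uv z m3 candidates_start[OF m0, of u v]
      by (auto intro!: exI[of _ "[0..<m]"])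
  next
    fix k r1 h1 assume I: "?I k r1 h1" and t: "holds (Less 17 5) r1"
    obtain cs where cs: "candidates m u v (2 ^ k) cs" "r1 18 = length cs"
      "\<forall>q<length cs. h1 (bC + q) = cs ! q" using I by blast
    have c1: "const_regs r1" using I by blast
    note c1D = const_regsD[OF c1]
    have lt: "2 ^ k < n" using t I c1D by simp
    have kK: "k < K"
    proof (rule ccontr)
      assume "\<not> k < K"
      then have "(2::nat) ^ K \<le> 2 ^ k" by (intro power_increasing) auto
      then show False using lt K(1) by linarith
    qed
    have off1: "r1 16 = b0 + k * (16000 * B)" using I by blast
    have "(k + 1) * (16000 * B) \<le> K * (16000 * B)" using kK by (intro mult_le_mono1) simp
    then have offK: "b0 + k * (16000 * B) + 16000 * B < 2 ^ w" using K(2) by simp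
    have csD: "distinct cs" "length cs \<le> m" "\<And>c. c \<in> set cs \<Longrightarrow> c < m * 2 ^ k"
      using cs(1) unfolding candidates_def by auto
    have d4: "2 * 2 ^ k \<le> 4 * m" using lt n_le by linarith
    have "runs w level_prog r1 h1 (2009000 * m + 16000 * F + 8000 * R + 481000) (\<lambda>r' h'. r' 17 = 2 * 2 ^ k \<and>
      r' 16 = b0 + k * (16000 * B) + 16000 * B \<and> r' 18 = length (next_level m u v (2 ^ k) cs) \<and>
      (\<forall>q<length (next_level m u v (2 ^ k) cs). h' (bC + q) = next_level m u v (2 ^ k) cs ! q) \<and>
      (\<forall>j<m. h' (bU + j) = u j \<and> h' (bV + j) = v j) \<and> (\<forall>a \<ge> b0 + k * (16000 * B) + 16000 * B. h' a = 0))"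
      by (rule runs_level_prog[OF c1 _ _ d4 cs(2) csD(2,1,3) _ _ edges inj off1 _ offK])
        (use I cs in auto)
    then have "runs w level_prog r1 h1 (2009000 * m + 16000 * F + 8000 * R + 481000) (?I (Suc k))"
    proof (rule runs_mono)
      fix r2 h2 assume Q: "r2 17 = 2 * 2 ^ k \<and>
        r2 16 = b0 + k * (16000 * B) + 16000 * B \<and> r2 18 = length (next_level m u v (2 ^ k) cs) \<and>
        (\<forall>q<length (next_level m u v (2 ^ k) cs). h2 (bC + q) = next_level m u v (2 ^ k) cs ! q) \<and>
        (\<forall>j<m. h2 (bU + j) = u j \<and> h2 (bV + j) = v j) \<and> (\<forall>a \<ge> b0 + k * (16000 * B) + 16000 * B. h2 a = 0)"
        and fr: "\<forall>x. x \<notin> writes level_prog \<longrightarrow> r2 x = r1 x"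
      have c2: "const_regs r2"
        by (rule const_regs_frame[OF c1 fr]) (intro ballI writes_level_prog, auto)
      have "candidates m u v (2 * 2 ^ k) (next_level m u v (2 ^ k) cs)"
        by (rule candidates_next_level[OF cs(1) _ m0]) simp
      moreover have eq: "2 ^ Suc k = 2 * (2::nat) ^ k"
        "b0 + Suc k * (16000 * B) = b0 + k * (16000 * B) + 16000 * B" by simp_all
      ultimately show "?I (Suc k) r2 h2" unfolding eq using Q c2 d4 by blast
    qed simp
    then show "k < K \<and> runs w level_prog r1 h1 (2009000 * m + 16000 * F + 8000 * R + 481000) (?I (Suc k))"
      using kK by blast
  qed simp
  then show ?thesis
  proof (rule runs_mono)
    fix r' h' assume "\<not> holds (Less 17 5) r' \<and> (\<exists>k \<le> K. ?I k r' h')"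
    then obtain k where nt: "\<not> holds (Less 17 5) r'" and I: "?I k r' h'" by blast
    then obtain cs where cs: "candidates m u v (2 ^ k) cs" "r' 18 = length cs"
      "\<forall>q<length cs. h' (bC + q) = cs ! q" by blast
    have "const_regs r'" using I by blast
    then have "r' 5 = n" by (simp add: const_regsD)
    then have "n \<le> 2 ^ k" using nt I by simp
    moreover then have "1 < (2::nat) ^ k" using n1 by linarith
    ultimately show "\<exists>d cs. n \<le> d \<and> 1 < d \<and> d \<le> 4 * m \<and> candidates m u v d cs \<and> r' 18 = length cs \<and>
      (\<forall>q<length cs. h' (bC + q) = cs ! q) \<and> (\<forall>j<m. h' (bU + j) = u j \<and> h' (bV + j) = v j)"
      using I cs by blast
  qed simp
qed

end

section \<open>Computing the memory layout\<close>

primrec power_prog :: "nat \<Rightarrow> prog" where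
  "power_prog 0 = Skip"
| "power_prog (Suc b) = power_prog b ;; Op 6 Mul 6 44"

lemma writes_power_prog: "x \<noteq> 6 \<Longrightarrow> x \<notin> writes (power_prog b)"
  by (induction b) simp_all

lemma runs_power_prog:
  "r 6 = 1 \<Longrightarrow> r 44 = P \<Longrightarrow> 0 < P \<Longrightarrow> P ^ b < 2 ^ w \<Longrightarrow>
    runs w (power_prog b) r h (b + 1) (\<lambda>r' h'. r' 6 = P ^ b \<and> h' = h)"
proof (induction b)
  case 0
  then show ?case by (intro runs_wp) simp_all
next
  case (Suc b)
  have "P ^ b \<le> P ^ Suc b" using Suc.prems by simp
  then have lt: "P ^ b < 2 ^ w" using Suc.prems by linarith
  show ?case unfolding power_prog.simps
  proof (rule runs_Seq[OF Suc.IH[OF Suc.prems(1-3) lt]])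
    fix r' h' assume Q: "r' 6 = P ^ b \<and> h' = h" and fr: "\<forall>x. x \<notin> writes (power_prog b) \<longrightarrow> r' x = r x"
    have "r' 44 = P" using fr writes_power_prog[of 44 b] Suc.prems(2) by simp
    then show "runs w (Op 6 Mul 6 44) r' h' 1 (\<lambda>r' h'. r' 6 = P ^ Suc b \<and> h' = h)"
      using Q Suc.prems by (intro runs_wp) (simp_all add: mult.commute)
  qed simp
qed

text \<open>Doubling register 44 until it reaches \<open>m + 2\<close> yields
  \<open>2 ^ bits m\<close> without computing a logarithm. Its power \<open>B\<close> is a fixed
  one, so \<open>power_prog\<close> is unrolled. The cells below \<open>B\<close> keep the input,
  and seven arrays of \<open>B\<close> cells follow before the call regions start at
  \<open>8 * B\<close>.\<close>

definition setup_prog :: "nat \<Rightarrow> prog" where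
  "setup_prog b = Const 44 1 ;; Op 45 Add 4 2 ;; Loop (Less 44 45) (Op 44 Add 44 44) ;;
     Const 6 1 ;; power_prog b ;;
     Const 21 20 ;; Const 22 8000 ;; Op 7 Div 4 3 ;; Op 43 Add 4 4 ;; Op 8 Add 43 43 ;;
     Op 9 Add 6 0 ;; Op 10 Add 9 6 ;; Op 11 Add 10 6 ;; Op 12 Add 11 6 ;; Op 13 Add 12 6 ;;
     Op 14 Add 13 6 ;; Op 15 Add 14 6 ;; Op 16 Add 15 6 ;; Const 17 1 ;; Op 18 Add 4 0"

lemma runs_setup_prog:
  assumes ram: "ram w m n B B (2 * B) (3 * B) (4 * B) (5 * B) (6 * B) (7 * B) (8 * B)"
    and r: "r 0 = 0" "r 1 = 1" "r 2 = 2" "r 3 = 3" "r 4 = m" "r 5 = n"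
    and L: "m + 2 \<le> 2 ^ L" "\<And>k. m + 2 \<le> 2 ^ k \<Longrightarrow> L \<le> k"
    and B: "B = (2 ^ L) ^ b" "9 * B < 2 ^ w" "10000 < B" "4 * m < B" "(2::nat) ^ L < 2 ^ w"
  shows "runs w (setup_prog b) r h (2 * L + b + 30) (\<lambda>r' h'. h' = h \<and>
    ram.const_regs m n B B (2 * B) (3 * B) (4 * B) (5 * B) (6 * B) (7 * B) r' \<and>
    r' 16 = 8 * B \<and> r' 17 = 1 \<and> r' 18 = m)"
    (is "runs _ _ _ _ _ ?Q")
proof -
  let ?tail = "Const 21 20 ;; Const 22 8000 ;; Op 7 Div 4 3 ;; Op 43 Add 4 4 ;; Op 8 Add 43 43 ;;
     Op 9 Add 6 0 ;; Op 10 Add 9 6 ;; Op 11 Add 10 6 ;; Op 12 Add 11 6 ;; Op 13 Add 12 6 ;;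
     Op 14 Add 13 6 ;; Op 15 Add 14 6 ;; Op 16 Add 15 6 ;; Const 17 1 ;; Op 18 Add 4 0"
  have w1: "Suc 0 < 2 ^ w" "m + 2 < 2 ^ w" "Suc (Suc m) < 2 ^ w" using B by linarith+
  show ?thesis unfolding setup_prog_def
  proof (rule runs_Seq)
    show "runs w (Const 44 1) r h 1 (\<lambda>r' h'. r' = r(44 := 1) \<and> h' = h)"
      by (rule runs_wp) (use w1 in simp_all)
  next
    fix r1 h1 assume "r1 = r(44 := 1) \<and> h1 = h"
    then have r1: "r1 = r(44 := 1)" "h1 = h" by auto
    show "runs w (Op 45 Add 4 2 ;; Loop (Less 44 45) (Op 44 Add 44 44) ;;
      Const 6 1 ;; power_prog b ;; ?tail) r1 h1 (2 * L + b + 29) ?Q"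
    proof (rule runs_Seq)
      show "runs w (Op 45 Add 4 2) r1 h1 1 (\<lambda>r' h'. r' = r(44 := 1, 45 := m + 2) \<and> h' = h)"
        by (rule runs_wp) (use w1 r r1 in simp_all)
    next
      fix r2 h2 assume "r2 = r(44 := 1, 45 := m + 2) \<and> h2 = h"
      then have r2: "r2 = r(44 := 1, 45 := m + 2)" "h2 = h" by auto
      let ?I = "\<lambda>k r' h'. r' 44 = 2 ^ k \<and> k \<le> L \<and> h' = h"
      have loop: "runs w (Loop (Less 44 45) (Op 44 Add 44 44)) r2 h2 (L * 2 + 1)
        (\<lambda>r' h'. \<not> holds (Less 44 45) r' \<and> (\<exists>k \<le> L. ?I k r' h'))"
      proof (rule runs_Loop[where T = 1])
        show "?I 0 r2 h2" using r2 by simp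
      next
        fix k r' h' assume I: "?I k r' h'" and t: "holds (Less 44 45) r'" and
          fr: "\<forall>x. x \<notin> writes (Op 44 Add 44 44) \<longrightarrow> r' x = r2 x"
        have "r' 45 = m + 2" using fr r2 by simp
        then have "2 ^ k < m + 2" using t I by simp
        then have "(2::nat) ^ k < 2 ^ L" using L(1) by linarith
        then have kL: "k < L" by simp
        have "(2::nat) ^ Suc k \<le> 2 ^ L" using kL by (intro power_increasing) auto
        then have "(2::nat) ^ k + 2 ^ k < 2 ^ w" using B(5) unfolding power_Suc mult_2 by (rule le_less_trans)
        then show "k < L \<and> runs w (Op 44 Add 44 44) r' h' 1 (?I (Suc k))"
          using kL I by (intro conjI runs_wp) (simp_all add: mult_2)
      qed simp
      show "runs w (Loop (Less 44 45) (Op 44 Add 44 44) ;;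
        Const 6 1 ;; power_prog b ;; ?tail) r2 h2 (2 * L + b + 28) ?Q"
      proof (rule runs_Seq[OF loop])
        fix r3 h3 assume post: "\<not> holds (Less 44 45) r3 \<and> (\<exists>k \<le> L. ?I k r3 h3)"
          and fr: "\<forall>x. x \<notin> writes (Loop (Less 44 45) (Op 44 Add 44 44)) \<longrightarrow> r3 x = r2 x"
        have fr3: "r3 x = r x" if "x \<noteq> 44" "x \<noteq> 45" for x using fr r2 that by simp
        obtain k where k: "k \<le> L" "r3 44 = 2 ^ k" "h3 = h" using post by blast
        have "r3 45 = m + 2" using fr r2 by simp
        then have "m + 2 \<le> 2 ^ k" using post k by simp
        then have "k = L" using L(2) k by fastforce
        then have r44: "r3 44 = 2 ^ L" using k by simp
        show "runs w (Const 6 1 ;; power_prog b ;; ?tail) r3 h3 (b + 17) ?Q"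
        proof (rule runs_Seq)
          show "runs w (Const 6 1) r3 h3 1 (\<lambda>r' h'. r' = r3(6 := 1) \<and> h' = h)"
            by (rule runs_wp) (use w1 k in simp_all)
        next
          fix r4 h4 assume "r4 = r3(6 := 1) \<and> h4 = h"
          then have r4: "r4 = r3(6 := 1)" "h4 = h" by auto
          have Bw: "((2::nat) ^ L) ^ b < 2 ^ w" using B by linarith
          have pow: "runs w (power_prog b) r4 h4 (b + 1) (\<lambda>r' h'. r' 6 = (2 ^ L) ^ b \<and> h' = h4)"
            by (rule runs_power_prog) (use r4 r44 Bw in simp_all)
          show "runs w (power_prog b ;; ?tail) r4 h4 (b + 16) ?Q"
          proof (rule runs_Seq[OF pow])
            fix r5 h5 assume Q5: "r5 6 = (2 ^ L) ^ b \<and> h5 = h4"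
              and fr: "\<forall>x. x \<notin> writes (power_prog b) \<longrightarrow> r5 x = r4 x"
            have fr5: "r5 x = r x" if "x \<noteq> 6" "x \<noteq> 44" "x \<noteq> 45" for x
              using fr writes_power_prog[OF that(1)] r4 fr3 that by simp
            have r5: "r5 6 = B" "r5 0 = 0" "r5 1 = 1" "r5 2 = 2" "r5 3 = 3" "r5 4 = m" "r5 5 = n"
              "r5 (Suc 0) = 1"
              using fr5 r Q5 B(1) by simp_all
            have sums: "B + B = 2 * B" "2 * B + B = 3 * B" "3 * B + B = 4 * B" "4 * B + B = 5 * B"
              "5 * B + B = 6 * B" "6 * B + B = 7 * B" "7 * B + B = 8 * B" "m + m = 2 * m"
              "2 * m + 2 * m = 4 * m" by simp_all
            have ws: "20 < (2::nat) ^ w" "8000 < (2::nat) ^ w" "m div 3 < 2 ^ w" "2 * m < 2 ^ w" "4 * m < 2 ^ w"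
              "B < 2 ^ w" "2 * B < 2 ^ w" "3 * B < 2 ^ w" "4 * B < 2 ^ w" "5 * B < 2 ^ w" "6 * B < 2 ^ w"
              "7 * B < 2 ^ w" "8 * B < 2 ^ w" "m < 2 ^ w"
              using B div_le_dividend[of m 3] by linarith+
            show "runs w ?tail r5 h5 15 ?Q"
              by (rule runs_wp) (simp_all add: r5 sums ws w1(1) Q5 r4 ram.const_regs_def[OF ram])
          qed simp
        qed simp
      qed simp
    qed simp
  qed simp
qed

lemma nth_concat_pair:
  "j < length es \<Longrightarrow> concat (map (\<lambda>(u, v). [u, v]) es) ! (2 * j) = fst (es ! j) \<and>
    concat (map (\<lambda>(u, v). [u, v]) es) ! Suc (2 * j) = snd (es ! j)"
proof (induction es arbitrary: j)
  case (Cons x es)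
  obtain a b where x: "x = (a, b)" by (cases x)
  show ?case
  proof (cases j)
    case 0
    then show ?thesis using x by simp
  next
    case (Suc j')
    then show ?thesis using Cons.IH[of j'] Cons.prems x by simp
  qed
qed simp

text \<open>Here the absence of isolated vertices in the given graph is used: it bounds
  \<open>n\<close>, and with it keys and number of rounds, in terms of \<open>m\<close>.\<close>

lemma card_vertices_le:
  assumes "graph V E" "no_isolated V E" "finite E"
  shows "card V \<le> 2 * card E"
proof -
  have "V \<subseteq> \<Union> E" using assms(2) unfolding no_isolated_def by blast
  moreover have fin: "finite (\<Union> E)"
    using assms(1,3) unfolding graph_def by (metis finite_Union rev_finite_subset)
  ultimately have "card V \<le> card (\<Union> E)" by (intro card_mono)
  also have "\<dots> \<le> (\<Sum>e\<in>E. card e)" by (rule card_Union_le_sum_card)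
  also have "\<dots> = 2 * card E" using assms(1) unfolding graph_def by simp
  finally show ?thesis .
qed

text \<open>With fewer than three edges there is no triangle, and \<open>m div 3\<close> would be 0.\<close>

definition listing_prog :: "nat \<Rightarrow> nat \<Rightarrow> prog \<Rightarrow> prog" where
  "listing_prog b R p = Const 1 1 ;; Const 2 2 ;; Const 3 3 ;; Load 4 3 ;; Load 5 2 ;;
     Branch (Less 4 3) (Store 0 0)
       (setup_prog b ;; copy_prog ;; Loop (Less 17 5) (edge_detector.level_prog p R) ;; output_prog)"

definition bits :: "nat \<Rightarrow> nat" where
  "bits m = nat \<lceil>log 2 (real m + 2)\<rceil>"

lemma le_two_power_bits: "m + 2 \<le> 2 ^ bits m"
proof -
  have "log 2 (real m + 2) \<le> real (bits m)" unfolding bits_def by linarith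
  then have "real m + 2 \<le> 2 powr real (bits m)" by (simp add: log_le_iff)
  then have "real (m + 2) \<le> real (2 ^ bits m)" by (simp add: powr_realpow)
  then show ?thesis by (simp only: of_nat_le_iff)
qed

lemma bits_le:
  assumes "m + 2 \<le> 2 ^ k"
  shows "bits m \<le> k"
proof -
  have "real (m + 2) \<le> real (2 ^ k)" using assms by (simp only: of_nat_le_iff)
  then have "real m + 2 \<le> 2 powr real k" by (simp add: powr_realpow)
  then have "log 2 (real m + 2) \<le> real k" by (simp add: log_le_iff)
  then show ?thesis unfolding bits_def by linarith
qed

lemma word_length_bits: "word_length c m = c * bits m"
  unfolding word_length_def bits_def ..


text \<open>Let \<open>P = 2 ^ bits m\<close>, so \<open>m + 2 <= P\<close> and
  \<open>P >= 8\<close>. In \<open>B = P ^ (c + 6)\<close>, the factor \<open>P ^ c\<close> is the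
  memory that the detection program can address, and \<open>P ^ 6\<close> covers keys of size
  \<open>100 * m ^ 2\<close> and the numerical constants. The remaining exponent of
  \<open>(c + 12)\<close> gives \<open>2 ^ w = B * P ^ 6\<close>, enough for \<open>L + 1\<close>
  rounds of \<open>16000 * B\<close> cells because
  \<open>16000 * (L + 1) + 8 < P ^ 6\<close>.\<close>

lemma layout_bounds:
  fixes m c :: nat
  assumes m: "3 \<le> m"
  defines "L \<equiv> bits m"
  defines "B \<equiv> (2 ^ L) ^ (c + 6)" and "w \<equiv> (c + 12) * L"
  shows "100 * m + 8000 \<le> B" "100 * (m * m) \<le> B" "2 ^ (c * L) \<le> B" "10000 < B" "4 * m < B"
    "8 * B + (L + 1) * (16000 * B) < 2 ^ w" "9 * B < 2 ^ w" "(2::nat) ^ L < 2 ^ w"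
proof -
  define P :: nat where "P = 2 ^ L"
  have mP: "m + 2 \<le> P" unfolding P_def L_def by (rule le_two_power_bits)
  have L3: "3 \<le> L"
  proof (rule ccontr)
    assume "\<not> 3 \<le> L"
    then have "(2::nat) ^ L \<le> 2 ^ 2" by (intro power_increasing) auto
    then show False using mP m unfolding P_def by simp
  qed
  have P8: "8 \<le> P"
  proof -
    have "(2::nat) ^ 3 \<le> 2 ^ L" using L3 by (intro power_increasing) auto
    then show ?thesis unfolding P_def by simp
  qed
  have LP: "L < P" unfolding P_def by (rule less_exp)
  have P4: "4096 \<le> P ^ 4"
  proof -
    have "(8::nat) ^ 4 \<le> P ^ 4" using P8 by (intro power_mono) auto
    then show ?thesis by simp
  qed
  have P6: "4096 * (P * P) \<le> P ^ 6" "32768 * P \<le> P ^ 6"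
  proof -
    have eq: "P ^ 6 = P ^ 4 * (P * P)" by (simp add: eval_nat_numeral)
    show a: "4096 * (P * P) \<le> P ^ 6" unfolding eq using P4 by (intro mult_right_mono) auto
    have "8 * P \<le> P * P" using P8 by (intro mult_right_mono) auto
    then show "32768 * P \<le> P ^ 6" using a by linarith
  qed
  have Bge: "P ^ 6 \<le> B" unfolding B_def P_def[symmetric] using P8 by (intro power_increasing) auto
  show "100 * m + 8000 \<le> B" using Bge P6(2) mP by linarith
  show "10000 < B" "4 * m < B" using Bge P6(2) mP P8 by linarith+
  have "m * m \<le> P * P" using mP by (intro mult_mono) auto
  then show "100 * (m * m) \<le> B" using Bge P6(1) by linarith
  have "(2::nat) ^ (c * L) = P ^ c" unfolding P_def by (simp add: power_mult[symmetric] mult.commute)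
  also have "\<dots> \<le> B" unfolding B_def P_def[symmetric] using P8 by (intro power_increasing) auto
  finally show "2 ^ (c * L) \<le> B" .
  have w: "2 ^ w = B * P ^ 6"
  proof -
    have "2 ^ w = P ^ (c + 12)" unfolding w_def P_def by (simp only: power_mult[symmetric] mult.commute)
    also have "\<dots> = P ^ ((c + 6) + 6)" by (simp add: add.assoc)
    finally show ?thesis unfolding power_add B_def P_def[symmetric] .
  qed
  have B0: "0 < B" unfolding B_def by simp
  have eq: "8 * B + (L + 1) * (16000 * B) = B * (8 + (L + 1) * 16000)" by (simp add: algebra_simps)
  have "8 + (16000 * L + 16000) < P ^ 6" using P6(2) LP P8 by linarith
  then have lt: "8 + (L + 1) * 16000 < P ^ 6" by simp
  show "8 * B + (L + 1) * (16000 * B) < 2 ^ w" unfolding eq w using lt B0 by (rule mult_strict_left_mono)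
  have "9 < P ^ 6" using P6(2) P8 by linarith
  then show "9 * B < 2 ^ w" unfolding w using B0 by (simp add: mult.commute)
  have "P < P ^ 6" using P6(2) P8 by linarith
  also have "P ^ 6 \<le> B * P ^ 6" using B0 by simp
  finally show "(2::nat) ^ L < 2 ^ w" unfolding w P_def .
qed

lemma runs_listing_large:
  assumes G: "graph V E" "no_isolated V E" "presents n es V E" and m: "card E = m" "3 \<le> m"
    and detect: "\<And>xs ys. (m, xs, {ys}) \<in> EdgeTriangleDetection \<Longrightarrow>
      \<exists>t s. exec (word_length c m) p (init_state xs) t s \<and> t \<le> F \<and> has_output s ys"
    and R: "regs p \<subseteq> {..<R}"
    and r: "r 0 = 0" "r 1 = 1" "r 2 = 2" "r 3 = 3" "r 4 = m" "r 5 = n"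
    and h: "h = snd (init_state (m # encode_graph n es))"
  shows "runs (word_length (c + 12) m)
    (setup_prog (c + 6) ;; copy_prog ;; Loop (Less 17 5) (edge_detector.level_prog p R) ;; output_prog) r h
    (2 * bits m + c + 60 + 40 * m + (bits m + 1) * (2009000 * m + 16000 * F + 8000 * R + 481001))
    (\<lambda>r' h'. \<exists>L. correct_listing V E m L \<and>
      has_output (r', h') (concat (map (\<lambda>(a, b, c). [a, b, c]) L)))"
    (is "runs _ _ _ _ _ ?Q")
proof -
  define L where "L = bits m"
  define B :: nat where "B = (2 ^ L) ^ (c + 6)"
  define w where "w = (c + 12) * L"
  note bounds = layout_bounds[OF m(2), of c, folded L_def, folded B_def w_def]
  have wls: "word_length (c + 12) m = w" "word_length c m = c * L"
    unfolding w_def L_def word_length_bits by simp_all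
  have V: "V = {..<n}" and dist: "distinct (map unordered es)" and E: "E = set (map unordered es)"
    using G(3) unfolding presents_def by auto
  have finE: "finite E" unfolding E by simp
  have len: "length es = m" using distinct_card[OF dist] m(1) unfolding E[symmetric] by simp
  have n_le: "n \<le> 2 * m" using card_vertices_le[OF G(1,2) finE] m(1) V by simp
  interpret edge_detector w m n B B "2 * B" "3 * B" "4 * B" "5 * B" "6 * B" "7 * B" "8 * B" p "c * L" R F
    by unfold_locales (use m(2) n_le bounds R detect wls in auto)
  have mem: "unordered (es ! j) \<in> E" if "j < m" for j using that len unfolding E by simp
  have ends: "fst (es ! j) < n" "snd (es ! j) < n" "fst (es ! j) \<noteq> snd (es ! j)" if "j < m" for j
  proof -
    obtain a b where ab: "es ! j = (a, b)" by fastforce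
    have "{a, b} \<subseteq> V" "card {a, b} = 2" using mem[OF that] G(1) unfolding ab graph_def by auto
    then show "fst (es ! j) < n" "snd (es ! j) < n" "fst (es ! j) \<noteq> snd (es ! j)"
      unfolding ab V by (auto split: if_splits)
  qed
  define u where "u = (\<lambda>j. min (fst (es ! j)) (snd (es ! j)))"
  define v where "v = (\<lambda>j. max (fst (es ! j)) (snd (es ! j)))"
  have uv: "u j < v j" "v j < n" "{u j, v j} = unordered (es ! j)" if "j < m" for j
  proof -
    show "u j < v j" "v j < n" using ends[OF that] unfolding u_def v_def by auto
    show "{u j, v j} = unordered (es ! j)"
      unfolding u_def v_def by (cases "es ! j") (auto simp: min_def max_def)
  qed
  have inj: "inj_on (\<lambda>j. (u j, v j)) {..<m}"
  proof (rule inj_onI)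
    fix i j assume ij: "i \<in> {..<m}" "j \<in> {..<m}" and eq: "(u i, v i) = (u j, v j)"
    then have "map unordered es ! i = map unordered es ! j" using uv(3)[of i] uv(3)[of j] len by simp
    then show "i = j" using dist ij len by (simp add: nth_eq_iff_index_eq del: nth_map)
  qed
  have n1: "1 < n" using uv(1,2)[of 0] m(2) by linarith
  let ?xs = "m # encode_graph n es"
  have lenx: "length ?xs = 2 * m + 3" unfolding encode_graph_def using len by (simp add: length_concat_map_pair)
  have hz: "h a = 0" if "2 * m + 3 < a" for a using that lenx unfolding h snd_init_state by simp
  have hes: "h (4 + 2 * j) = fst (es ! j)" "h (5 + 2 * j) = snd (es ! j)" if "j < m" for j
  proof -
    have idx: "4 + 2 * j = Suc (Suc (Suc (Suc (2 * j))))" "5 + 2 * j = Suc (Suc (Suc (Suc (Suc (2 * j)))))"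
      by simp_all
    have le: "4 + 2 * j \<le> length ?xs" "5 + 2 * j \<le> length ?xs" using that lenx by linarith+
    show "h (4 + 2 * j) = fst (es ! j)" "h (5 + 2 * j) = snd (es ! j)"
      unfolding h snd_init_state if_P[OF le(1)] if_P[OF le(2)]
      unfolding idx encode_graph_def
      using nth_concat_pair[of j es] that len by simp_all
  qed
  have prep: "runs w (setup_prog (c + 6)) r h (2 * L + (c + 6) + 30) (\<lambda>r' h'. h' = h \<and>
      const_regs r' \<and> r' 16 = 8 * B \<and> r' 17 = 1 \<and> r' 18 = m)"
    by (rule runs_setup_prog[OF ram_axioms r _ _ B_def bounds(7,4,5,8)])
      (use le_two_power_bits bits_le in \<open>simp_all add: L_def\<close>)
  show ?thesis unfolding wls L_def[symmetric]
  proof (rule runs_Seq[OF prep])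
    fix r1 h1 assume "h1 = h \<and> const_regs r1 \<and> r1 16 = 8 * B \<and> r1 17 = 1 \<and> r1 18 = m"
    then have Q1: "h1 = h" "const_regs r1" "r1 16 = 8 * B" "r1 17 = 1" "r1 18 = m" by auto
    have copy: "runs w copy_prog r1 h1 (m * 18 + 2) (\<lambda>r' h'. (\<forall>j<m. h' (B + j) = u j \<and> h' (2 * B + j) = v j \<and>
        h' (6 * B + j) = j) \<and> (\<forall>a \<ge> 8 * B. h' a = h1 a))"
      unfolding u_def v_def
      by (rule runs_copy_prog[OF Q1(2)]) (use hes less_le_trans[OF ends(1) n_le] less_le_trans[OF ends(2) n_le] Q1(1) in simp_all)
    show "runs w (copy_prog ;; Loop (Less 17 5) level_prog ;; output_prog) r1 h1
      (24 + 40 * m + (L + 1) * (2009000 * m + 16000 * F + 8000 * R + 481001)) ?Q"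
    proof (rule runs_Seq[OF copy])
      fix r2 h2 assume Q2: "(\<forall>j<m. h2 (B + j) = u j \<and> h2 (2 * B + j) = v j \<and>
        h2 (6 * B + j) = j) \<and> (\<forall>a \<ge> 8 * B. h2 a = h1 a)"
        and fr: "\<forall>x. x \<notin> writes copy_prog \<longrightarrow> r2 x = r1 x"
      have c2: "const_regs r2"
        by (rule const_regs_frame[OF Q1(2) fr]) (simp add: writes_copy_prog)
      have r2: "r2 16 = 8 * B" "r2 17 = 1" "r2 18 = m" using fr Q1 by (simp_all add: writes_copy_prog)
      have z2: "h2 a = 0" if "8 * B \<le> a" for a
        using Q2 that Q1(1) hz[of a] bounds(4,5) by simp
      \<comment> \<open>The extra round comes from \<open>n <= 2 * m\<close>, whereas
        \<open>bits m\<close> is only measured against \<open>m + 2\<close>.\<close>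
      have nK: "n \<le> 2 ^ (L + 1)" using n_le le_two_power_bits[of m] unfolding L_def by simp
      have levels: "runs w (Loop (Less 17 5) level_prog) r2 h2
        ((L + 1) * (2009000 * m + 16000 * F + 8000 * R + 481001) + 1)
        (\<lambda>r' h'. \<exists>d cs. n \<le> d \<and> 1 < d \<and> d \<le> 4 * m \<and> candidates m u v d cs \<and> r' 18 = length cs \<and>
          (\<forall>q<length cs. h' (6 * B + q) = cs ! q) \<and> (\<forall>j<m. h' (B + j) = u j \<and> h' (2 * B + j) = v j))"
        by (rule runs_levels[OF c2 r2(2,3,1) nK bounds(6) _ _ _ inj n1 z2]) (use Q2 uv in auto)
      show "runs w (Loop (Less 17 5) level_prog ;; output_prog) r2 h2
        (22 + 22 * m + (L + 1) * (2009000 * m + 16000 * F + 8000 * R + 481001)) ?Q"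
      proof (rule runs_Seq[OF levels])
        fix r3 h3 assume "\<exists>d cs. n \<le> d \<and> 1 < d \<and> d \<le> 4 * m \<and> candidates m u v d cs \<and> r3 18 = length cs \<and>
          (\<forall>q<length cs. h3 (6 * B + q) = cs ! q) \<and> (\<forall>j<m. h3 (B + j) = u j \<and> h3 (2 * B + j) = v j)"
          and fr: "\<forall>x. x \<notin> writes (Loop (Less 17 5) level_prog) \<longrightarrow> r3 x = r2 x"
        then obtain d cs where d: "n \<le> d" "1 < d" "d \<le> 4 * m" "candidates m u v d cs" "r3 18 = length cs"
          "\<forall>q<length cs. h3 (6 * B + q) = cs ! q" "\<forall>j<m. h3 (B + j) = u j \<and> h3 (2 * B + j) = v j" by blast
        have c3: "const_regs r3"
          by (rule const_regs_frame[OF c2 fr], simp only: writes.simps, intro ballI writes_level_prog, auto)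
        have lenc: "length cs \<le> m" using d(4) unfolding candidates_def by blast
        have less: "x < 2 ^ w" if "x \<in> set cs" for x
        proof -
          have "x < m * d" using d(4) that unfolding candidates_def by blast
          moreover have "m * d \<le> m * (4 * m)" using d(3) by (rule mult_le_mono2)
          moreover have "m * (4 * m) \<le> 100 * (m * m)" by simp
          ultimately show ?thesis using bounds(2,7) by linarith
        qed
        have list: "correct_listing V E m (map (\<lambda>c. (u (c mod m), v (c mod m), c div m)) cs)"
          by (rule correct_listing_candidates[OF G(1,3) len _ _ d(4,1,2)]) (use uv m(2) in auto)
        have uv2: "u j < 2 * m \<and> v j < 2 * m" if "j < m" for j
          using uv(1,2)[OF that] n_le by linarith
        have "runs w output_prog r3 h3 (m * 16 + 5) (\<lambda>r' h'.
          has_output (r', h') (concat (map (\<lambda>(a, b, c). [a, b, c])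
            (map (\<lambda>c. (u (c mod m), v (c mod m), c div m)) cs))))"
          by (rule runs_output_prog[OF c3 d(5) lenc less])
            (use d uv2 in simp_all)
        then show "runs w output_prog r3 h3 (m * 16 + 5) ?Q"
          by (rule runs_mono) (use list in blast)+
      qed simp
    qed simp
  qed simp
qed

lemma triangles_few_edges:
  assumes G: "graph V E" and finE: "finite E" and few: "card E < 3"
  shows "triangles V E = {}"
proof -
  have False if T: "T \<in> triangles V E" for T
  proof -
    have T3: "card T = 3" "\<And>x y. x \<in> T \<Longrightarrow> y \<in> T \<Longrightarrow> x \<noteq> y \<Longrightarrow> {x, y} \<in> E"
      using T unfolding triangles_def by auto
    obtain x y z where xyz: "T = {x, y, z}" "x \<noteq> y" "x \<noteq> z" "y \<noteq> z"
      using T3(1) by (auto simp: card_3_iff)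
    have "{x, y} \<in> E" "{x, z} \<in> E" "{y, z} \<in> E" using T3(2) xyz by auto
    then have "{{x, y}, {x, z}, {y, z}} \<subseteq> E" by blast
    then have "card {{x, y}, {x, z}, {y, z}} \<le> card E" using finE by (intro card_mono)
    moreover have "card {{x, y}, {x, z}, {y, z}} = 3" using xyz(2-4) by (auto simp: doubleton_eq_iff)
    ultimately show False using few by simp
  qed
  then show ?thesis by blast
qed

definition listing_time :: "nat \<Rightarrow> nat \<Rightarrow> nat \<Rightarrow> nat \<Rightarrow> nat" where
  "listing_time c R F m = 2 * bits m + c + 70 + 40 * m +
     (bits m + 1) * (2009000 * m + 16000 * F + 8000 * R + 481001)"

lemma runs_listing_prog:
  assumes G: "graph V E" "no_isolated V E" "presents n es V E" and m: "card E = m"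
    and detect: "\<And>xs ys. (m, xs, {ys}) \<in> EdgeTriangleDetection \<Longrightarrow>
      \<exists>t s. exec (word_length c m) p (init_state xs) t s \<and> t \<le> F \<and> has_output s ys"
    and R: "regs p \<subseteq> {..<R}"
  shows "runs (word_length (c + 12) m) (listing_prog (c + 6) R p)
    (fst (init_state (m # encode_graph n es))) (snd (init_state (m # encode_graph n es))) (listing_time c R F m)
    (\<lambda>r' h'. \<exists>L. correct_listing V E m L \<and>
      has_output (r', h') (concat (map (\<lambda>(a, b, c). [a, b, c]) L)))"
    (is "runs ?w _ ?r ?h _ ?Q")
proof -
  have dist: "distinct (map unordered es)" and E: "E = set (map unordered es)" and V: "V = {..<n}"
    using G(3) unfolding presents_def by auto
  have finE: "finite E" unfolding E by simp
  have len: "length es = m" using distinct_card[OF dist] m unfolding E[symmetric] by simp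
  have n_le: "n \<le> 2 * m" using card_vertices_le[OF G(1,2) finE] m V by simp
  have hm: "?h 2 = n" "?h 3 = m"
    unfolding snd_init_state encode_graph_def using len by (simp_all add: numeral_2_eq_2 numeral_3_eq_3)
  \<comment> \<open>Since \<open>bits m >= 1\<close> even for \<open>m = 0\<close>, the factor 12
    leaves room for the literals and for \<open>n\<close> before any case distinction on
    \<open>m\<close>.\<close>
  have mw: "4 * m + 8 \<le> 2 ^ ?w"
  proof -
    have "bits m \<ge> 1" using le_two_power_bits[of m] by (cases "bits m") auto
    then have "bits m + 2 \<le> ?w" unfolding word_length_bits by (cases "bits m") (simp_all add: algebra_simps)
    then have "(2::nat) ^ (bits m + 2) \<le> 2 ^ ?w" by (intro power_increasing) auto
    moreover have "(2::nat) ^ (bits m + 2) = 4 * 2 ^ bits m" by (simp add: power_add)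
    ultimately show ?thesis using le_two_power_bits[of m] by linarith
  qed
  have ws: "Suc 0 < 2 ^ ?w" "2 < (2::nat) ^ ?w" "3 < (2::nat) ^ ?w" "m < 2 ^ ?w" "n < 2 ^ ?w"
    using mw n_le by linarith+
  have r: "?r = (\<lambda>_. 0)" unfolding init_state_def by simp
  define r1 where "r1 = ?r(1 := 1, 2 := 2, 3 := 3, 4 := m, 5 := n)"
  have r1: "r1 0 = 0" "r1 1 = 1" "r1 2 = 2" "r1 3 = 3" "r1 4 = m" "r1 5 = n"
    unfolding r1_def r by simp_all
  let ?T = "listing_time c R F m - 8"
  let ?large = "setup_prog (c + 6) ;; copy_prog ;; Loop (Less 17 5) (edge_detector.level_prog p R) ;; output_prog"
  have branch: "runs ?w (Branch (Less 4 3) (Store 0 0) ?large) r1 ?h (?T + 1) ?Q"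
  proof (rule runs_Branch[where T = ?T])
    assume "holds (Less 4 3) r1"
    then have m3: "m < 3" using r1 by simp
    have tr: "triangles V E = {}" using triangles_few_edges[OF G(1) finE] m m3 by simp
    have "correct_listing V E m []"
      unfolding correct_listing_def Let_def tr by simp
    moreover have "has_output (r', ?h(0 := 0)) (concat (map (\<lambda>(a, b, c). [a, b, c]) []))" for r'
      unfolding has_output_def by simp
    ultimately show "runs ?w (Store 0 0) r1 ?h ?T ?Q"
      by (intro runs_wp) (auto simp: r1 listing_time_def intro!: exI[of _ "[]"])
  next
    assume "\<not> holds (Less 4 3) r1"
    then have m3: "3 \<le> m" using r1 by simp
    show "runs ?w ?large r1 ?h ?T ?Q"
      by (rule runs_mono[OF runs_listing_large[OF G m m3 detect R r1 refl]])
        (simp_all add: listing_time_def)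
  qed simp
  show ?thesis
    unfolding listing_prog_def
  proof (rule runs_Seq)
    show "runs ?w (Const 1 1) ?r ?h 1 (\<lambda>r' h'. r' = ?r(1 := 1) \<and> h' = ?h)"
      by (rule runs_wp) (use ws in simp_all)
    fix ra ha assume "ra = ?r(1 := 1) \<and> ha = ?h"
    then have a: "ra = ?r(1 := 1)" "ha = ?h" by auto
    show "runs ?w (Const 2 2 ;; Const 3 3 ;; Load 4 3 ;; Load 5 2 ;; Branch (Less 4 3) (Store 0 0) ?large)
      ra ha (?T + 5) ?Q" unfolding a
    proof (rule runs_Seq)
      show "runs ?w (Const 2 2) (?r(1 := 1)) ?h 1 (\<lambda>r' h'. r' = ?r(1 := 1, 2 := 2) \<and> h' = ?h)"
        by (rule runs_wp) (use ws in simp_all)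
      fix ra ha assume "ra = ?r(1 := 1, 2 := 2) \<and> ha = ?h"
      then have a: "ra = ?r(1 := 1, 2 := 2)" "ha = ?h" by auto
      show "runs ?w (Const 3 3 ;; Load 4 3 ;; Load 5 2 ;; Branch (Less 4 3) (Store 0 0) ?large)
        ra ha (?T + 4) ?Q" unfolding a
      proof (rule runs_Seq)
        show "runs ?w (Const 3 3) (?r(1 := 1, 2 := 2)) ?h 1 (\<lambda>r' h'. r' = ?r(1 := 1, 2 := 2, 3 := 3) \<and> h' = ?h)"
          by (rule runs_wp) (use ws in simp_all)
        fix ra ha assume "ra = ?r(1 := 1, 2 := 2, 3 := 3) \<and> ha = ?h"
        then have a: "ra = ?r(1 := 1, 2 := 2, 3 := 3)" "ha = ?h" by auto
        show "runs ?w (Load 4 3 ;; Load 5 2 ;; Branch (Less 4 3) (Store 0 0) ?large)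
          ra ha (?T + 3) ?Q" unfolding a
        proof (rule runs_Seq)
          show "runs ?w (Load 4 3) (?r(1 := 1, 2 := 2, 3 := 3)) ?h 1
            (\<lambda>r' h'. r' = ?r(1 := 1, 2 := 2, 3 := 3, 4 := m) \<and> h' = ?h)"
            by (rule runs_wp) (use ws hm in simp_all)
          fix ra ha assume "ra = ?r(1 := 1, 2 := 2, 3 := 3, 4 := m) \<and> ha = ?h"
          then have a: "ra = ?r(1 := 1, 2 := 2, 3 := 3, 4 := m)" "ha = ?h" by auto
          show "runs ?w (Load 5 2 ;; Branch (Less 4 3) (Store 0 0) ?large) ra ha (?T + 2) ?Q" unfolding a
          proof (rule runs_Seq)
            show "runs ?w (Load 5 2) (?r(1 := 1, 2 := 2, 3 := 3, 4 := m)) ?h 1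
              (\<lambda>r' h'. r' = r1 \<and> h' = ?h)"
              by (rule runs_wp) (use ws hm in \<open>simp_all add: r1_def\<close>)
            fix ra ha assume "ra = r1 \<and> ha = ?h"
            then show "runs ?w (Branch (Less 4 3) (Store 0 0) ?large) ra ha (?T + 1) ?Q" using branch by simp
          qed simp
        qed simp
      qed simp
    qed simp
  qed (simp add: listing_time_def)
qed

section \<open>A lower bound for edge triangle detection\<close>

text \<open>Such an instance exists for every \<open>m\<close>. This matters because
  \<open>T\<close> is arbitrary: a lower bound at infinitely many \<open>m\<close> would not
  suffice.\<close>

lemma matching_instance:
  defines "es \<equiv> \<lambda>m. map (\<lambda>j. (2 * j, Suc (2 * j))) [0..<m]"
  shows "(m, encode_graph (2 * m) (es m), {replicate m 0}) \<in> EdgeTriangleDetection"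
proof -
  define E where "E = set (map unordered (es m))"
  have dist: "distinct (map unordered (es m))"
    unfolding es_def map_map by (subst distinct_map) (auto intro!: inj_onI simp: doubleton_eq_iff)
  have card: "card E = m" using distinct_card[OF dist] unfolding E_def by (simp add: es_def)
  have E_eq: "E = (\<lambda>j. {2 * j, Suc (2 * j)}) ` {..<m}" unfolding E_def es_def by auto
  have G: "graph {..<2 * m} E" unfolding graph_def E_eq by auto
  have I: "no_isolated {..<2 * m} E" unfolding no_isolated_def
  proof
    fix x :: nat assume "x \<in> {..<2 * m}"
    then have e: "{2 * (x div 2), Suc (2 * (x div 2))} \<in> E" unfolding E_eq by (intro imageI) auto
    have "x = 2 * (x div 2) \<or> x = Suc (2 * (x div 2))" by presburger
    then have "x \<in> {2 * (x div 2), Suc (2 * (x div 2))}" by (simp only: insert_iff empty_iff simp_thms)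
    then show "\<exists>e \<in> E. x \<in> e" using e by (rule bexI)
  qed
  have P: "presents (2 * m) (es m) {..<2 * m} E"
    unfolding presents_def E_def using dist by simp
  have div: "x div 2 = y div 2" if "{x, y} \<in> E" for x y
    using that unfolding E_eq by (auto simp: doubleton_eq_iff)
  have no: "\<not> covered E u v" if "{u, v} \<in> E" for u v
  proof
    assume "covered E u v"
    then obtain w where w: "{u, w} \<in> E" "{v, w} \<in> E" unfolding covered_def by blast
    have neq: "x \<noteq> y" if "{x, y} \<in> E" for x y
    proof -
      have "card {x, y} = 2" using G that unfolding graph_def by blast
      then show ?thesis by auto
    qed
    \<comment> \<open>The ends of an edge differ but agree after division by 2, so their parities
      differ. A triangle would need three different parities.\<close>
    have parity: "x mod 2 \<noteq> y mod 2" if "{x, y} \<in> E" for x y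
      using neq[OF that] div[OF that] by (metis div_mult_mod_eq)
    have "u mod 2 < 2" "v mod 2 < 2" "w mod 2 < 2" by simp_all
    then show False using parity[OF that] parity[OF w(1)] parity[OF w(2)] by linarith
  qed
  have out: "map (\<lambda>(u, v). if \<exists>T \<in> triangles {..<2 * m} E. {u, v} \<subseteq> T then 1 else 0) (es m) = replicate m (0::nat)"
  proof (rule nth_equalityI)
    fix i assume "i < length (map (\<lambda>(u, v). if \<exists>T \<in> triangles {..<2 * m} E. {u, v} \<subseteq> T then 1 else 0::nat) (es m))"
    then have i: "i < m" unfolding es_def by simp
    then have e: "{2 * i, Suc (2 * i)} \<in> E" unfolding E_eq by blast
    show "map (\<lambda>(u, v). if \<exists>T \<in> triangles {..<2 * m} E. {u, v} \<subseteq> T then 1 else 0) (es m) ! i =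
        replicate m (0::nat) ! i"
      using i in_triangle_iff_covered[OF G e] no[OF e] by (simp add: es_def)
  qed (simp add: es_def)
  have "(card E, encode_graph (2 * m) (es m),
      {map (\<lambda>(u, v). if \<exists>T \<in> triangles {..<2 * m} E. {u, v} \<subseteq> T then 1 else 0) (es m)})
      \<in> EdgeTriangleDetection"
    unfolding EdgeTriangleDetection_def using G I P by blast
  then show ?thesis unfolding out card .
qed

text \<open>
  On a perfect matching the encoded edge list is \<open>0, 1, 2, \<dots>\<close>, whereas the output consists of
  zeros, so a correct program overwrites almost all of the first \<open>m\<close> cells.
\<close>

lemma detection_time_lower_bound:
  assumes "exec w p (init_state (encode_graph (2 * m) (map (\<lambda>j. (2 * j, Suc (2 * j))) [0..<m]))) t s"
    "has_output s (replicate m 0)"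
  shows "m \<le> t + 3"
proof -
  let ?es = "map (\<lambda>j. (2 * j, Suc (2 * j))) [0..<m]"
  let ?s = "init_state (encode_graph (2 * m) ?es)"
  \<comment> \<open>Cells 0 to 2 hold the length and the two counts, so cell \<open>a >= 3\<close>
    of the edge list initially holds \<open>a - 3\<close>. This is nonzero from cell 4 on, where the
    output is zero.\<close>
  have "{4..m} \<subseteq> {a. snd s a \<noteq> snd ?s a}"
  proof
    fix a assume a: "a \<in> {4..m}"
    then have "a = Suc (Suc (Suc (a - 3)))" "1 \<le> a - 3" "a - 3 < 2 * m" by auto
    then obtain i where i: "a = Suc (Suc (Suc i))" "1 \<le> i" "i < 2 * m" by blast
    have conc: "concat (map (\<lambda>(u, v). [u, v]) ?es) = [0..<2 * m]"
      using concat_map_pair_upt[of 0 m] by simp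
    have "snd ?s a = i"
      unfolding snd_init_state encode_graph_def conc i using i a by (simp del: map_map)
    moreover have "snd s a = 0"
      using assms(2) a i unfolding has_output_def by (auto simp: nth_Cons')
    ultimately show "a \<in> {a. snd s a \<noteq> snd ?s a}" using i by simp
  qed
  then have "card {4..m} \<le> t"
    using exec_memory_changes[OF assms(1)] card_mono le_trans by blast
  then show ?thesis by simp
qed

text \<open>Translates word lengths into the logarithm of \<open>soft_O\<close>. For
  \<open>m >= 3\<close> one has \<open>ln m >= 1\<close> and \<open>m + 2 <= m ^ 2\<close>, so
  \<open>log 2 (m + 2)\<close> is at most \<open>4 * ln m\<close>, and rounding up and adding 1
  costs at most \<open>2 * ln m\<close> more.\<close>

lemma bits_le_ln:
  assumes "3 \<le> m"
  shows "real (bits m + 1) \<le> 6 * ln (real m)"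
proof -
  have ln1: "1 \<le> ln (real m)"
  proof -
    have "exp 1 \<le> real m" using exp_le assms by linarith
    then show ?thesis using assms by (simp add: ln_ge_iff)
  qed
  have ln2: "1 / 2 \<le> ln (2::real)" by (subst ln_ge_iff) (use exp_half_le2 in simp_all)
  have "real m + 2 \<le> real m ^ 2"
  proof -
    have "3 * real m \<le> real m * real m" using assms by (intro mult_right_mono) auto
    then show ?thesis unfolding power2_eq_square using assms by linarith
  qed
  then have "ln (real m + 2) \<le> ln (real m ^ 2)" using assms by (intro ln_mono) auto
  also have "\<dots> = 2 * ln (real m)" using assms by (simp add: ln_realpow)
  finally have a: "ln (real m + 2) \<le> 2 * ln (real m)" .
  have "log 2 (real m + 2) \<le> 4 * ln (real m)"
  proof -
    have "ln (real m + 2) \<le> 4 * ln (real m) * ln 2"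
      using a mult_left_mono[OF ln2, of "4 * ln (real m)"] ln1 by linarith
    then show ?thesis unfolding log_def using ln2 by (simp add: divide_le_eq)
  qed
  moreover have "real (bits m) \<le> log 2 (real m + 2) + 1"
  proof -
    have "0 \<le> log 2 (real m + 2)" by simp
    then show ?thesis unfolding bits_def by linarith
  qed
  ultimately show ?thesis using ln1 by simp
qed

theorem theorem4:
  fixes T :: "nat \<Rightarrow> real"
  assumes "\<exists>f \<in> O(T). solvable_in_time EdgeTriangleDetection f"
  shows "\<exists>g \<in> soft_O T. solvable_in_time (TriangleListing (\<lambda>m. m)) g"
proof -
  obtain f p c where f: "f \<in> O(T)" and solves: "\<forall>(m, xs, Y) \<in> EdgeTriangleDetection. \<exists>t s ys.
      exec (word_length c m) p (init_state xs) t s \<and> real t \<le> f m \<and> has_output s ys \<and> ys \<in> Y"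
    using assms unfolding solvable_in_time_def by blast
  \<comment> \<open>Running times are natural numbers, so rounding the real bound down loses
    nothing.\<close>
  define F where "F = (\<lambda>m. nat \<lfloor>f m\<rfloor>)"
  have detect: "\<exists>t s. exec (word_length c m) p (init_state xs) t s \<and> t \<le> F m \<and> real t \<le> f m \<and> has_output s ys"
    if "(m, xs, {ys}) \<in> EdgeTriangleDetection" for m xs ys
    using solves that unfolding F_def by (fastforce simp: le_nat_floor)
  \<comment> \<open>Every \<open>m\<close> has an instance, so \<open>f m\<close> bounds an actual
    running time and in particular is nonnegative.\<close>
  have F_lower: "m \<le> F m + 3" and f_nonneg: "0 \<le> f m" for m
  proof -
    obtain t s where ts: "exec (word_length c m) p
        (init_state (encode_graph (2 * m) (map (\<lambda>j. (2 * j, Suc (2 * j))) [0..<m]))) t s"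
      "t \<le> F m" "real t \<le> f m" "has_output s (replicate m 0)"
      using detect[OF matching_instance] by blast
    show "m \<le> F m + 3" using detection_time_lower_bound[OF ts(1,4)] ts(2) by linarith
    show "0 \<le> f m" using ts(3) by linarith
  qed
  have F_le: "real (F m) \<le> f m" for m unfolding F_def using f_nonneg[of m] by simp
  obtain R where R: "regs p \<subseteq> {..<R}"
    using finite_regs[of p] finite_nat_set_iff_bounded by (metis lessThan_iff subsetI)
  define g where "g = (\<lambda>m. real (listing_time c R (F m) m))"
  have "solvable_in_time (TriangleListing (\<lambda>m. m)) g"
    unfolding solvable_in_time_def
  proof (intro exI[of _ "listing_prog (c + 6) R p"] exI[of _ "c + 12"] ballI)
    fix x assume "x \<in> TriangleListing (\<lambda>m. m)"
    then obtain V n E es where G: "graph V E" "no_isolated V E" "presents n es V E" and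
      x: "x = (card E, card E # encode_graph n es,
        {concat (map (\<lambda>(a, b, c). [a, b, c]) L) | L. correct_listing V E (card E) L})"
      unfolding TriangleListing_def by blast
    have "runs (word_length (c + 12) (card E)) (listing_prog (c + 6) R p)
      (fst (init_state (card E # encode_graph n es))) (snd (init_state (card E # encode_graph n es)))
      (listing_time c R (F (card E)) (card E))
      (\<lambda>r' h'. \<exists>L. correct_listing V E (card E) L \<and>
        has_output (r', h') (concat (map (\<lambda>(a, b, c). [a, b, c]) L)))"
      by (rule runs_listing_prog[OF G refl _ R]) (use detect in blast)
    then obtain t r' h' L where
      "exec (word_length (c + 12) (card E)) (listing_prog (c + 6) R p)
        (init_state (card E # encode_graph n es)) t (r', h')"
      "t \<le> listing_time c R (F (card E)) (card E)" "correct_listing V E (card E) L"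
      "has_output (r', h') (concat (map (\<lambda>(a, b, c). [a, b, c]) L))"
      unfolding runs_def by auto
    then show "case x of (m, xs, Y) \<Rightarrow> \<exists>t s ys. exec (word_length (c + 12) m) (listing_prog (c + 6) R p)
        (init_state xs) t s \<and> real t \<le> g m \<and> has_output s ys \<and> ys \<in> Y"
      unfolding x g_def by (auto simp only: prod.case of_nat_le_iff mem_Collect_eq)
  qed
  moreover have "g \<in> soft_O T"
  proof -
    \<comment> \<open>The number 3000000 exceeds every numerical coefficient of
      \<open>listing_time\<close>; \<open>R\<close> and \<open>c\<close> depend only on the
      detection program.\<close>
    define K :: real where "K = 3000000 * (real R + real c + 1)"
    have K: "0 \<le> K" unfolding K_def by simp
    obtain C where C: "C > 0" "\<forall>\<^sub>F m in at_top. norm (f m) \<le> C * norm (T m)"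
      using f by (elim landau_o.bigE)
    have "\<forall>\<^sub>F m in at_top. norm (g m) \<le> (24 * K * C) * norm (T m * ln (real m) ^ 1)"
      using C(2) eventually_ge_at_top[of "6::nat"]
    proof eventually_elim
      case (elim m)
      \<comment> \<open>For \<open>m >= 6\<close> the lower bound gives \<open>f m >= 3\<close>,
        which absorbs the additive constants as well as \<open>m\<close>.\<close>
      have small: "real m + f m + 1 \<le> 4 * f m" using F_lower[of m] F_le[of m] elim(2) by linarith
      have b: "real (bits m + 1) \<le> 6 * ln (real m)" using bits_le_ln elim(2) by simp
      have "real (listing_time c R (F m) m) \<le> real (bits m + 1) * (K * (real m + f m + 1))"
      proof -
        let ?X = "2009040 * real m + 16000 * f m + 8000 * real R + 481075 + real c"
        have "listing_time c R (F m) m \<le> (bits m + 1) * (2009040 * m + 16000 * F m + 8000 * R + 481075 + c)"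
          unfolding listing_time_def by (simp add: algebra_simps)
        then have "real (listing_time c R (F m) m) \<le>
            real ((bits m + 1) * (2009040 * m + 16000 * F m + 8000 * R + 481075 + c))"
          by (simp only: of_nat_le_iff)
        also have "\<dots> = real (bits m + 1) * (2009040 * real m + 16000 * real (F m) + 8000 * real R + 481075 + real c)"
          by (simp only: of_nat_mult of_nat_add of_nat_numeral)
        also have "\<dots> \<le> real (bits m + 1) * ?X"
          using F_le[of m] by (intro mult_left_mono) auto
        also have "\<dots> \<le> real (bits m + 1) * (K * (real m + f m + 1))"
        proof (intro mult_left_mono)
          have "0 \<le> (real R + real c) * (real m + f m)" using f_nonneg[of m] by (intro mult_nonneg_nonneg) auto
          then show "?X \<le> K * (real m + f m + 1)"
            unfolding K_def using f_nonneg[of m] by (simp add: algebra_simps)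
        qed simp
        finally show ?thesis .
      qed
      also have "\<dots> \<le> 6 * ln (real m) * (K * (4 * f m))"
        using b small K f_nonneg[of m] by (intro mult_mono mult_left_mono mult_nonneg_nonneg) auto
      also have "\<dots> = (24 * K * ln (real m)) * f m" by simp
      also have "\<dots> \<le> (24 * K * ln (real m)) * (C * norm (T m))"
        using elim K f_nonneg[of m] by (intro mult_left_mono mult_nonneg_nonneg) auto
      also have "\<dots> = (24 * K * C) * norm (T m * ln (real m) ^ 1)"
        using elim(2) by (simp add: abs_mult)
      finally show ?case unfolding g_def by simp
    qed
    then have "g \<in> O(\<lambda>m. T m * ln (real m) ^ 1)" by (rule bigoI)
    then show ?thesis unfolding soft_O_def by blast
  qed
  ultimately show ?thesis by blast
qed

end
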